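(* Let $y_0>0$ be given, let $\Omega=\{(x,y): x\in\mathbb{R},\ -y_0\le y\le 0\}$, and let $ds^2=E(y)\,dx^2+cE(y)\,dy^2$ be a catenoid metric on $\Omega$: $c>0$ is a constant, $E(y)>0$, $E'(y)<0$ for $y<0$, and the Gauss curvature of the metric is $K(y)=-k_0E(y)^{-\beta^2}$ with constants $k_0>0$ and $\beta\ge\sqrt2$. Let the initial data $$(u,v)|_{y=-y_0}=(\bar u_0(x),\bar v_0(x)),\qquad x\in\mathbb{R},$$ be such that $\bar u_0+\bar v_0$ and $\bar u_0-\bar v_0$ are bounded on $\mathbb{R}$ and $$\inf_{x\in\mathbb{R}}\left(\bar u_0(x)+\bar v_0(x)\right)>0,\qquad \sup_{x\in\mathbb{R}}\left(\bar u_0(x)-\bar v_0(x)\right)<0 .$$ Then the Gauss-Codazzi system $$\begin{cases} M_x-L_y=\Gamma^2_{22}L-2\Gamma^2_{12}M+\Gamma^2_{11}N,\\ N_x-M_y=-\Gamma^1_{22}L+2\Gamma^1_{12}M-\Gamma^1_{11}N,\\ LN-M^2=K,\end{cases}$$ associated with this metric has a weak solution $(L,M,N)\in L^\infty(\Omega)^3$ in $\Omega$ with this initial data.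
   Context: Metric: it has the form $E\,dx^2+2F\,dx\,dy+G\,dy^2$ with $F\equiv 0$ and $G=cE$, where $E=E(y)$ is a $C^{1,1}$ function on an interval containing $[-y_0,0]$. The $\Gamma^k_{ij}$ are its Christoffel symbols, explicitly $$\Gamma^2_{22}=\frac{E'}{2E},\quad \Gamma^2_{12}=0,\quad \Gamma^2_{11}=-\frac{E'}{2cE},\quad \Gamma^1_{22}=0,\quad \Gamma^1_{12}=\frac{E'}{2E},\quad \Gamma^1_{11}=0.$$ Unknowns: $L=h_{11}/\sqrt{|g|}$, $M=h_{12}/\sqrt{|g|}$, $N=h_{22}/\sqrt{|g|}$, where $h_{11}dx^2+2h_{12}dx\,dy+h_{22}dy^2$ is the second fundamental form and $|g|=EG-F^2$. Subscripts $x,y$ denote partial derivatives; $y$ plays the role of time. Variables $(u,v)$: write $K=-\gamma^2$ with $\gamma>0$, and set $\tilde L=L/\gamma$, $\tilde M=M/\gamma$, $\tilde N=N/\gamma$, and $u=-\tilde M/\tilde L$, $v=1/\tilde L$, so that $\tilde L=1/v$, $\tilde M=-u/v$, $\tilde N=(u^2-v^2)/v$. Thus the initial data $(\bar u_0,\bar v_0)$ (measurable functions on $\mathbb{R}$) prescribe at $y=-y_0$ the values $$L_0(x)=\frac{\gamma(-y_0)}{\bar v_0(x)},\quad M_0(x)=-\frac{\gamma(-y_0)\bar u_0(x)}{\bar v_0(x)},\quad N_0(x)=\frac{\gamma(-y_0)\left(\bar u_0(x)^2-\bar v_0(x)^2\right)}{\bar v_0(x)}.$$ Weak solution with this initial data: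 $L,M,N\in L^\infty(\Omega)$, the equation $LN-M^2=K$ holds almost everywhere in $\Omega$, and the first two equations hold in the sense of distributions with initial data taken in the weak sense, i.e. for every $\phi\in C_c^\infty(\mathbb{R}\times[-y_0,0))$, $$\iint_\Omega\left(-M\phi_x+L\phi_y\right)dx\,dy+\int_{\mathbb{R}}L_0(x)\phi(x,-y_0)\,dx=\iint_\Omega\left(\Gamma^2_{22}L-2\Gamma^2_{12}M+\Gamma^2_{11}N\right)\phi\,dx\,dy,$$ $$\iint_\Omega\left(-N\phi_x+M\phi_y\right)dx\,dy+\int_{\mathbb{R}}M_0(x)\phi(x,-y_0)\,dx=\iint_\Omega\left(-\Gamma^1_{22}L+2\Gamma^1_{12}M-\Gamma^1_{11}N\right)\phi\,dx\,dy.$$ *)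

theory Defs
  imports "HOL-Analysis.Analysis"
begin

text \<open>Christoffel symbols of the metric \<open>E(y) dx\<^sup>2 + c E(y) dy\<^sup>2\<close> on the \<open>(x,y)\<close>-plane;
  \<open>E'\<close> stands for the derivative of \<open>E\<close>, and \<open>\<Gamma>kij\<close> for the symbol with upper index \<open>k\<close>
  and lower indices \<open>i\<close>, \<open>j\<close> (1 for \<open>x\<close>, 2 for \<open>y\<close>).\<close>

definition \<Gamma>111 :: "real \<Rightarrow> (real \<Rightarrow> real) \<Rightarrow> (real \<Rightarrow> real) \<Rightarrow> real \<Rightarrow> real"
  where "\<Gamma>111 c E E' y = 0"

definition \<Gamma>112 :: "real \<Rightarrow> (real \<Rightarrow> real) \<Rightarrow> (real \<Rightarrow> real) \<Rightarrow> real \<Rightarrow> real"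
  where "\<Gamma>112 c E E' y = E' y / (2 * E y)"

definition \<Gamma>122 :: "real \<Rightarrow> (real \<Rightarrow> real) \<Rightarrow> (real \<Rightarrow> real) \<Rightarrow> real \<Rightarrow> real"
  where "\<Gamma>122 c E E' y = 0"

definition \<Gamma>211 :: "real \<Rightarrow> (real \<Rightarrow> real) \<Rightarrow> (real \<Rightarrow> real) \<Rightarrow> real \<Rightarrow> real"
  where "\<Gamma>211 c E E' y = - E' y / (2 * c * E y)"

definition \<Gamma>212 :: "real \<Rightarrow> (real \<Rightarrow> real) \<Rightarrow> (real \<Rightarrow> real) \<Rightarrow> real \<Rightarrow> real"
  where "\<Gamma>212 c E E' y = 0"

definition \<Gamma>222 :: "real \<Rightarrow> (real \<Rightarrow> real) \<Rightarrow> (real \<Rightarrow> real) \<Rightarrow> real \<Rightarrow> real"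
  where "\<Gamma>222 c E E' y = E' y / (2 * E y)"

text \<open>The Gauss curvature \<open>\<kappa>\<close> of the same metric at height \<open>y\<close>, through the Gauss formula
  \[ -E\kappa = \partial_x\Gamma^2_{12} - \partial_y\Gamma^2_{11} + \Gamma^1_{12}\Gamma^2_{11}
     + (\Gamma^2_{12})^2 - \Gamma^2_{11}\Gamma^2_{22} - \Gamma^1_{11}\Gamma^2_{12}, \]
  whose first term vanishes because nothing depends on \<open>x\<close>. It amounts to
  \<open>\<kappa> = - (E'/E)' / (2 c E)\<close>. Since \<open>E\<close> is only of class \<open>C\<^sup>1\<^sup>,\<^sup>1\<close>, the curvature exists at
  almost every \<open>y\<close> only, hence a predicate.\<close>

definition has_gauss_curvature ::
    "real \<Rightarrow> (real \<Rightarrow> real) \<Rightarrow> (real \<Rightarrow> real) \<Rightarrow> real \<Rightarrow> real \<Rightarrow> bool"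
  where "has_gauss_curvature c E E' \<kappa> y \<longleftrightarrow>
    (\<exists>D. (\<Gamma>211 c E E' has_real_derivative D) (at y) \<and>
         - E y * \<kappa> = - D + \<Gamma>112 c E E' y * \<Gamma>211 c E E' y + (\<Gamma>212 c E E' y)\<^sup>2
                    - \<Gamma>211 c E E' y * \<Gamma>222 c E E' y - \<Gamma>111 c E E' y * \<Gamma>212 c E E' y)"

text \<open>\<open>C_class k \<phi>\<close>: the function \<open>\<phi>\<close> is of class \<open>C\<^sup>k\<close> on the plane.\<close>

primrec C_class :: "nat \<Rightarrow> (real \<times> real \<Rightarrow> real) \<Rightarrow> bool" where
  "C_class 0 \<phi> \<longleftrightarrow> continuous_on UNIV \<phi>"
| "C_class (Suc k) \<phi> \<longleftrightarrow>
    (\<exists>\<phi>x \<phi>y. (\<forall>p. (\<phi> has_derivative (\<lambda>h. \<phi>x p * fst h + \<phi>y p * snd h)) (at p)) \<and>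
             C_class k \<phi>x \<and> C_class k \<phi>y)"

text \<open>The elements of \<open>C\<^sub>c\<^sup>\<infinity>(\<real> \<times> [-y\<^sub>0, 0))\<close> are the restrictions to the strip of smooth functions on
  the plane whose support is a compact subset of \<open>\<real> \<times> (-\<infinity>, 0)\<close>: they vanish near the edge
  \<open>y = 0\<close>, but need not vanish at \<open>y = -y\<^sub>0\<close>.\<close>

definition test_function :: "(real \<times> real \<Rightarrow> real) \<Rightarrow> bool"
  where "test_function \<phi> \<longleftrightarrow>
    (\<forall>k. C_class k \<phi>) \<and> compact (closure {p. \<phi> p \<noteq> 0}) \<and>
    closure {p. \<phi> p \<noteq> 0} \<subseteq> UNIV \<times> {..<0}"

definition dx :: "(real \<times> real \<Rightarrow> real) \<Rightarrow> real \<times> real \<Rightarrow> real"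
  where "dx \<phi> p = deriv (\<lambda>s. \<phi> (s, snd p)) (fst p)"

definition dy :: "(real \<times> real \<Rightarrow> real) \<Rightarrow> real \<times> real \<Rightarrow> real"
  where "dy \<phi> p = deriv (\<lambda>t. \<phi> (fst p, t)) (snd p)"

definition strip :: "real \<Rightarrow> (real \<times> real) set"
  where "strip y0 = UNIV \<times> {-y0..0}"

definition L_infinity :: "'a::euclidean_space set \<Rightarrow> ('a \<Rightarrow> real) \<Rightarrow> bool"
  where "L_infinity S f \<longleftrightarrow>
    f \<in> borel_measurable (lebesgue_on S) \<and> (\<exists>B. AE p in lebesgue_on S. \<bar>f p\<bar> \<le> B)"

text \<open>Weak solutions \<open>(L, M, N)\<close> of the Gauss-Codazzi system with Gauss curvature \<open>K(y)\<close> and initial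
  data \<open>L0\<close>, \<open>M0\<close> at \<open>y = -y0\<close>. The initial value of \<open>N\<close> does not enter the weak formulation, as the
  equations contain no \<open>y\<close>-derivative of \<open>N\<close>.\<close>

definition gauss_codazzi_weak_solution ::
    "real \<Rightarrow> real \<Rightarrow> (real \<Rightarrow> real) \<Rightarrow> (real \<Rightarrow> real) \<Rightarrow> (real \<Rightarrow> real) \<Rightarrow>
     (real \<Rightarrow> real) \<Rightarrow> (real \<Rightarrow> real) \<Rightarrow>
     (real \<times> real \<Rightarrow> real) \<Rightarrow> (real \<times> real \<Rightarrow> real) \<Rightarrow> (real \<times> real \<Rightarrow> real) \<Rightarrow> bool"
  where "gauss_codazzi_weak_solution y0 c E E' K L0 M0 L M N \<longleftrightarrow>
    L_infinity (strip y0) L \<and> L_infinity (strip y0) M \<and> L_infinity (strip y0) N \<and>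
    (AE p in lebesgue_on (strip y0). L p * N p - (M p)\<^sup>2 = K (snd p)) \<and>
    (\<forall>\<phi>. test_function \<phi> \<longrightarrow>
      (LINT p|lebesgue_on (strip y0). - M p * dx \<phi> p + L p * dy \<phi> p)
        + (LINT x|lebesgue. L0 x * \<phi> (x, - y0))
      = (LINT p|lebesgue_on (strip y0).
          (\<Gamma>222 c E E' (snd p) * L p - 2 * \<Gamma>212 c E E' (snd p) * M p
            + \<Gamma>211 c E E' (snd p) * N p) * \<phi> p)) \<and>
    (\<forall>\<phi>. test_function \<phi> \<longrightarrow>
      (LINT p|lebesgue_on (strip y0). - N p * dx \<phi> p + M p * dy \<phi> p)
        + (LINT x|lebesgue. M0 x * \<phi> (x, - y0))
      = (LINT p|lebesgue_on (strip y0).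
          (- \<Gamma>122 c E E' (snd p) * L p + 2 * \<Gamma>112 c E E' (snd p) * M p
            - \<Gamma>111 c E E' (snd p) * N p) * \<phi> p))"

end

(* Write w = u + v and z = u - v. The system becomes w_y + z w_x = a (...), z_y + w z_x = a (...)
   with a = - E'/(2E): both fields are linearly degenerate, and for beta^2 >= 2 the box
   [delta, W] x [-W, -delta] with delta W = c (beta^2 - 1) is invariant. Since w > 0 > z, characteristics of
   the two families can serve as coordinates (alpha, beta), in which x, y, w, z and the derivatives
   p = y_alpha, q = - y_beta solve a semilinear system with data on the diagonal. Picard iteration
   solves it for merely measurable data, without any compactness argument. The map (alpha, beta) -> (x, y)
   is injective and bi-Lipschitz. In the new coordinates L dx + M dy = gamma (p d alpha + q d beta) and
   M dx + N dy = - gamma (w p d alpha + z q d beta), so the weak equations follow from Stokes' theorem on the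
   half-plane alpha >= beta; applied to dx itself it also yields the change of variables. *)

theory Submission
  imports Defs
begin

subsection \<open>Indefinite integrals and the chain rule\<close>

text \<open>With merely measurable data, \<open>w\<close> has no regularity across the curves along
  which it is transported. The system is therefore arranged so that \<open>w\<close> and
  \<open>p\<close> are differentiated in the second coordinate only, \<open>z\<close> and
  \<open>q\<close> in the first only, and just \<open>x\<close> and \<open>y\<close> in both; no
  derivative of the data occurs. The product \<delta> W is dictated by the corners (\<delta>, -W)
  and (W, -\<delta>) of the box. With \<kappa> = beta^2 - 2 and \<delta> W = c (1 + \<kappa>) the
  rates of w there are \<kappa> (W - \<delta>) / 2 and its negative, which have the right signs
  because \<kappa> is nonnegative. The coordinates degenerate if p or q approaches 0 or infinity.
  Their logarithmic derivatives are bounded by a constant times a(y) |dy|, so a finite integral of a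
  over y >= -y0 confines both to fixed bounds. This is why a is continued beyond y = 0 so as to
  vanish eventually. The continuation also spares a description of the free curve y = 0 in the new
  coordinates: the half-plane covers all of y >= -y0 up to a null set.\<close>

lemma set_integrable_bounded_Icc:
  fixes g :: "real \<Rightarrow> 'a::euclidean_space"
  assumes "g \<in> borel_measurable borel" "\<And>t. s \<le> t \<Longrightarrow> t \<le> t' \<Longrightarrow> norm (g t) \<le> B"
  shows "set_integrable lborel {s..t'} g"
  unfolding set_integrable_def
  by (rule integrableI_bounded_set_indicator[where B = B]) (use assms in \<open>auto simp: emeasure_lborel_Icc_eq\<close>)

lemma set_integral_norm_le_integral:
  fixes h :: "real \<Rightarrow> 'a::euclidean_space"
  assumes "h \<in> borel_measurable borel" "continuous_on {b..a} g"
    "\<And>t. b \<le> t \<Longrightarrow> t \<le> a \<Longrightarrow> norm (h t) \<le> g t"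
  shows "norm (LBINT t:{b..a}. h t) \<le> (LBINT t:{b..a}. g t)"
proof -
  have g: "set_integrable lborel {b..a} g"
    unfolding set_integrable_def using borel_integrable_atLeastAtMost'[OF assms(2)]
    by (simp add: set_integrable_def)
  have h: "set_integrable lborel {b..a} h"
    by (rule set_integrable_bound[OF g])
      (use assms in \<open>auto simp: set_borel_measurable_def intro!: always_eventually order_trans[OF assms(3)]\<close>)
  have "norm (LBINT t:{b..a}. h t) \<le> (LINT t|lborel. norm (indicator {b..a} t *\<^sub>R h t))"
    unfolding set_lebesgue_integral_def by (rule integral_norm_bound)
  also have "\<dots> \<le> (LBINT t:{b..a}. g t)"
    unfolding set_lebesgue_integral_def
  proof (rule integral_mono)
    show "integrable lborel (\<lambda>t. norm (indicator {b..a} t *\<^sub>R h t))"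
      using h unfolding set_integrable_def by (rule integrable_norm)
    show "integrable lborel (\<lambda>t. indicator {b..a} t *\<^sub>R g t)"
      using g unfolding set_integrable_def .
    show "norm (indicator {b..a} t *\<^sub>R h t) \<le> indicator {b..a} t *\<^sub>R g t" for t
      using assms(3) by (auto simp: indicator_def)
  qed
  finally show ?thesis .
qed

lemma set_integral_norm_bound_Icc:
  fixes g :: "real \<Rightarrow> 'a::euclidean_space"
  assumes "g \<in> borel_measurable borel" "\<And>t. s \<le> t \<Longrightarrow> t \<le> t' \<Longrightarrow> norm (g t) \<le> B" "s \<le> t'"
  shows "norm (LBINT t:{s..t'}. g t) \<le> B * (t' - s)"
  using set_integral_norm_le_integral[OF assms(1) continuous_on_const, of s t' B] assms(2,3)
  by (simp add: set_lebesgue_integral_def mult.commute)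

lemma set_integral_Icc_combine:
  fixes g :: "real \<Rightarrow> 'a::euclidean_space"
  assumes "set_integrable lborel {r..t} g" "r \<le> s" "s \<le> t"
  shows "(LBINT u:{r..t}. g u) = (LBINT u:{r..s}. g u) + (LBINT u:{s..t}. g u)"
proof -
  have eq: "{r..t} = {r..s} \<union> {s..t}" using assms by auto
  have "set_integrable lborel {r..s} g" "set_integrable lborel {s..t} g"
    using assms by (auto intro: set_integrable_subset)
  moreover have "AE x in lborel. \<not> (x \<in> {r..s} \<and> x \<in> {s..t})"
    using AE_lborel_singleton[of s] by eventually_elim auto
  ultimately show ?thesis
    unfolding eq by (intro set_integral_Un_AE) auto
qed

text \<open>A substitute for absolute continuity that avoids derivatives almost everywhere.\<close>

definition primitive_on :: "(real \<Rightarrow> real) \<Rightarrow> (real \<Rightarrow> real) \<Rightarrow> real \<Rightarrow> real \<Rightarrow> bool"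
  where "primitive_on f g a b \<longleftrightarrow>
    g \<in> borel_measurable borel \<and> (\<exists>B. \<forall>t\<in>{a..b}. \<bar>g t\<bar> \<le> B) \<and>
    (\<forall>s t. a \<le> s \<longrightarrow> s \<le> t \<longrightarrow> t \<le> b \<longrightarrow> f t - f s = (LBINT u:{s..t}. g u))"

lemma primitive_onD:
  "primitive_on f g a b \<Longrightarrow> a \<le> s \<Longrightarrow> s \<le> t \<Longrightarrow> t \<le> b \<Longrightarrow> f t - f s = (LBINT u:{s..t}. g u)"
  unfolding primitive_on_def by blast

lemma primitive_onI:
  assumes "g \<in> borel_measurable borel" "\<And>t. a \<le> t \<Longrightarrow> t \<le> b \<Longrightarrow> \<bar>g t\<bar> \<le> B"
    "\<And>t. a \<le> t \<Longrightarrow> t \<le> b \<Longrightarrow> f t = f a + (LBINT u:{a..t}. g u)"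
  shows "primitive_on f g a b"
  unfolding primitive_on_def
proof (intro conjI allI impI)
  fix s t assume st: "a \<le> s" "s \<le> t" "t \<le> b"
  have "(LBINT u:{a..t}. g u) = (LBINT u:{a..s}. g u) + (LBINT u:{s..t}. g u)"
    using st assms(1,2) by (intro set_integral_Icc_combine set_integrable_bounded_Icc[where B = B]) auto
  then show "f t - f s = (LBINT u:{s..t}. g u)"
    using assms(3)[of t] assms(3)[of s] st by simp
qed (use assms in \<open>auto intro!: exI[of _ B]\<close>)

text \<open>For data at the right end point: on a line of fixed first coordinate the diagonal is met
  at the upper end of the interval.\<close>

lemma primitive_onI_backward:
  assumes "g \<in> borel_measurable borel" "\<And>t. a \<le> t \<Longrightarrow> t \<le> b \<Longrightarrow> \<bar>g t\<bar> \<le> B"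
    "\<And>t. a \<le> t \<Longrightarrow> t \<le> b \<Longrightarrow> f t = f b + (LBINT u:{t..b}. - g u)"
  shows "primitive_on f g a b"
  unfolding primitive_on_def
proof (intro conjI allI impI)
  fix s t assume st: "a \<le> s" "s \<le> t" "t \<le> b"
  have "(LBINT u:{s..b}. - g u) = (LBINT u:{s..t}. - g u) + (LBINT u:{t..b}. - g u)"
    using st assms(1,2) by (intro set_integral_Icc_combine set_integrable_bounded_Icc[where B = B]) auto
  moreover have "(LBINT u:{s..t}. - g u) = - (LBINT u:{s..t}. g u)"
    using st assms(1,2) by (intro set_integral_uminus set_integrable_bounded_Icc[where B = B]) auto
  ultimately show "f t - f s = (LBINT u:{s..t}. g u)"
    using assms(3)[of t] assms(3)[of s] st by simp
qed (use assms in \<open>auto intro!: exI[of _ B]\<close>)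

lemma primitive_on_lipschitz:
  assumes "primitive_on f g a b"
  obtains B where "B \<ge> 0" "\<And>s t. s \<in> {a..b} \<Longrightarrow> t \<in> {a..b} \<Longrightarrow> \<bar>f t - f s\<bar> \<le> B * \<bar>t - s\<bar>"
    "\<And>t. t \<in> {a..b} \<Longrightarrow> \<bar>g t\<bar> \<le> B"
proof -
  obtain B where B: "\<And>t. t \<in> {a..b} \<Longrightarrow> \<bar>g t\<bar> \<le> B" and g: "g \<in> borel_measurable borel"
    using assms unfolding primitive_on_def by blast
  have le: "\<bar>f t - f s\<bar> \<le> \<bar>B\<bar> * (t - s)" if "a \<le> s" "s \<le> t" "t \<le> b" for s t
  proof -
    have "norm (g u) \<le> \<bar>B\<bar>" if "s \<le> u" "u \<le> t" for u
      using B[of u] that \<open>a \<le> s\<close> \<open>t \<le> b\<close> by force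
    then show ?thesis
      using set_integral_norm_bound_Icc[of g s t "\<bar>B\<bar>"] g that(2) primitive_onD[OF assms that] by simp
  qed
  have "\<bar>f t - f s\<bar> \<le> \<bar>B\<bar> * \<bar>t - s\<bar>" if "s \<in> {a..b}" "t \<in> {a..b}" for s t
    using le[of s t] le[of t s] that by (cases "s \<le> t") (auto simp: abs_minus_commute)
  moreover have "\<bar>g t\<bar> \<le> \<bar>B\<bar>" if "t \<in> {a..b}" for t
    using B[OF that] by linarith
  ultimately show thesis
    using that[of "\<bar>B\<bar>"] by simp
qed

lemma primitive_on_continuous:
  assumes "primitive_on f g a b"
  shows "continuous_on {a..b} f"
proof -
  obtain B where "B \<ge> 0" "\<And>s t. s \<in> {a..b} \<Longrightarrow> t \<in> {a..b} \<Longrightarrow> \<bar>f t - f s\<bar> \<le> B * \<bar>t - s\<bar>"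
    using primitive_on_lipschitz[OF assms] by metis
  then have "B-lipschitz_on {a..b} f"
    by (auto intro!: lipschitz_onI simp: dist_real_def abs_minus_commute)
  then show ?thesis
    by (rule lipschitz_on_continuous_on)
qed

lemma primitive_on_minus: "primitive_on f g a b \<Longrightarrow> primitive_on (\<lambda>t. - f t) (\<lambda>t. - g t) a b"
  unfolding primitive_on_def by (force simp: set_lebesgue_integral_def)

lemma borel_measurable_indicator_continuous:
  fixes f :: "real \<Rightarrow> real"
  assumes "continuous_on {a..b} f"
  shows "(\<lambda>t. indicator {a..b} t * f t) \<in> borel_measurable borel"
  using borel_measurable_continuous_on_indicator[OF _ assms] by simp

text \<open>No differentiability almost everywhere is needed: the difference of the two sides has
  derivative zero at every point.\<close>

lemma chain_rule_primitive:
  fixes \<phi> \<phi>x \<phi>y :: "real \<times> real \<Rightarrow> real"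
  assumes f: "primitive_on f f' a b" and g: "primitive_on g g' a b"
    and S: "\<And>t. t \<in> {a..b} \<Longrightarrow> (f t, g t) \<in> S"
    and \<phi>: "\<And>p. p \<in> S \<Longrightarrow> (\<phi> has_derivative (\<lambda>h. \<phi>x p * fst h + \<phi>y p * snd h)) (at p within S)"
    and cx: "continuous_on S \<phi>x" and cy: "continuous_on S \<phi>y"
    and st: "a \<le> s" "s \<le> t" "t \<le> b"
  shows "\<phi> (f t, g t) - \<phi> (f s, g s) = (LBINT u:{s..t}. \<phi>x (f u, g u) * f' u + \<phi>y (f u, g u) * g' u)"
proof -
  obtain B1 where B1: "B1 \<ge> 0" "\<And>s t. s \<in> {a..b} \<Longrightarrow> t \<in> {a..b} \<Longrightarrow> \<bar>f t - f s\<bar> \<le> B1 * \<bar>t - s\<bar>"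
    "\<And>t. t \<in> {a..b} \<Longrightarrow> \<bar>f' t\<bar> \<le> B1" using primitive_on_lipschitz[OF f] by metis
  obtain B2 where B2: "B2 \<ge> 0" "\<And>s t. s \<in> {a..b} \<Longrightarrow> t \<in> {a..b} \<Longrightarrow> \<bar>g t - g s\<bar> \<le> B2 * \<bar>t - s\<bar>"
    "\<And>t. t \<in> {a..b} \<Longrightarrow> \<bar>g' t\<bar> \<le> B2" using primitive_on_lipschitz[OF g] by metis
  define B where "B = B1 + B2 + 1"
  have B: "B > 0" "B1 \<le> B" "B2 \<le> B" using B1(1) B2(1) by (auto simp: B_def)
  have f'm: "f' \<in> borel_measurable borel" and g'm: "g' \<in> borel_measurable borel"
    using f g unfolding primitive_on_def by auto
  have cfg: "continuous_on {a..b} (\<lambda>t. (f t, g t))"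
    using primitive_on_continuous[OF f] primitive_on_continuous[OF g] by (intro continuous_intros)
  have ckx: "continuous_on {a..b} (\<lambda>t. \<phi>x (f t, g t))" and cky: "continuous_on {a..b} (\<lambda>t. \<phi>y (f t, g t))"
    using continuous_on_compose2[OF cx cfg] continuous_on_compose2[OF cy cfg] S by blast+
  define G where "G = (\<lambda>u. \<phi>x (f u, g u) * f' u + \<phi>y (f u, g u) * g' u)"
  \<comment> \<open>Outside \<open>{a..b}\<close> nothing is known about \<open>f\<close> and
    \<open>g\<close>; the indicator makes the integrand Borel on the whole line without changing
    integrals inside \<open>{a..b}\<close>.\<close>
  define G0 where "G0 = (\<lambda>u. (indicator {a..b} u * \<phi>x (f u, g u)) * f' u + (indicator {a..b} u * \<phi>y (f u, g u)) * g' u)"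
  have G0m: "G0 \<in> borel_measurable borel"
    unfolding G0_def using borel_measurable_indicator_continuous[OF ckx] borel_measurable_indicator_continuous[OF cky] f'm g'm
    by measurable
  have GG0: "(LBINT u:{s..t}. G u) = (LBINT u:{s..t}. G0 u)" if "a \<le> s" "t \<le> b" for s t
    using that by (intro set_lebesgue_integral_cong) (auto simp: G_def G0_def)
  have "bounded ((\<lambda>t. \<phi>x (f t, g t)) ` {a..b})" "bounded ((\<lambda>t. \<phi>y (f t, g t)) ` {a..b})"
    using ckx cky by (auto intro!: compact_imp_bounded compact_continuous_image)
  then obtain X Y where X: "\<And>u. u \<in> {a..b} \<Longrightarrow> \<bar>\<phi>x (f u, g u)\<bar> \<le> X" and Y: "\<And>u. u \<in> {a..b} \<Longrightarrow> \<bar>\<phi>y (f u, g u)\<bar> \<le> Y"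
    unfolding bounded_iff ball_simps(9) real_norm_def by blast
  have G0b: "\<bar>G0 u\<bar> \<le> X * B1 + Y * B2" if "u \<in> {a..b}" for u
  proof -
    have "\<bar>G0 u\<bar> \<le> \<bar>\<phi>x (f u, g u) * f' u\<bar> + \<bar>\<phi>y (f u, g u) * g' u\<bar>"
      using that by (auto simp: G0_def)
    also have "\<dots> \<le> X * B1 + Y * B2"
      unfolding abs_mult using X[OF that] Y[OF that] B1(3)[OF that] B2(3)[OF that]
      by (intro add_mono mult_mono) auto
    finally show ?thesis .
  qed
  have int0: "set_integrable lborel {s..t} G0" if "a \<le> s" "t \<le> b" for s t
    using that G0b by (intro set_integrable_bounded_Icc[OF G0m, where B="X * B1 + Y * B2"]) auto
  define D where "D = (\<lambda>t. \<phi> (f t, g t) - (LBINT u:{a..t}. G0 u))"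
  have Ddiff: "D t - D s = \<phi> (f t, g t) - \<phi> (f s, g s) - (LBINT u:{s..t}. G0 u)"
    if "a \<le> s" "s \<le> t" "t \<le> b" for s t
    using set_integral_Icc_combine[OF int0[of a t], of s] that unfolding D_def by auto
  have "(D has_field_derivative 0) (at r within {a..b})" if r: "r \<in> {a..b}" for r
    unfolding has_field_derivative_iff
  proof (rule LIM_zero_cancel, simp, rule tendstoI)
    fix e :: real assume "e > 0"
    \<comment> \<open>Linearising \<phi> and freezing its partial derivatives each cost
      \<open>2 * e' * B\<close> per unit length, together \<open>e / 2\<close>.\<close>
    define e' where "e' = e / (8 * B)"
    have e': "e' > 0" using \<open>e > 0\<close> B by (simp add: e'_def)
    let ?p = "(f r, g r)"
    obtain d1 where d1: "d1 > 0" "\<And>q. q \<in> S \<Longrightarrow> norm (q - ?p) < d1 \<Longrightarrow>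
       \<bar>\<phi> q - \<phi> ?p - (\<phi>x ?p * fst (q - ?p) + \<phi>y ?p * snd (q - ?p))\<bar> \<le> e' * norm (q - ?p)"
      using conjunct2[OF \<phi>[OF S[OF r], unfolded has_derivative_within_alt], rule_format, OF e']
      by (auto simp del: fst_diff snd_diff)
    obtain d2 where d2: "d2 > 0" "\<And>u. u \<in> {a..b} \<Longrightarrow> \<bar>u - r\<bar> < d2 \<Longrightarrow> \<bar>\<phi>x (f u, g u) - \<phi>x ?p\<bar> < e'"
      using ckx r e' unfolding continuous_on_iff dist_real_def by meson
    obtain d3 where d3: "d3 > 0" "\<And>u. u \<in> {a..b} \<Longrightarrow> \<bar>u - r\<bar> < d3 \<Longrightarrow> \<bar>\<phi>y (f u, g u) - \<phi>y ?p\<bar> < e'"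
      using cky r e' unfolding continuous_on_iff dist_real_def by meson
    define d where "d = min (d1 / (2 * B)) (min d2 d3)"
    have d: "d > 0" using d1(1) d2(1) d3(1) B by (simp add: d_def)
    have main: "\<bar>D t - D s\<bar> \<le> (e / 2) * (t - s)"
      if st: "a \<le> s" "s \<le> t" "t \<le> b" "t - s < d" "r = s \<or> r = t" for s t
    proof -
      define \<Delta>f where "\<Delta>f = f t - f s"
      define \<Delta>g where "\<Delta>g = g t - g s"
      have \<Delta>: "\<bar>\<Delta>f\<bar> \<le> B * (t - s)" "\<bar>\<Delta>g\<bar> \<le> B * (t - s)"
        using B1(2)[of s t] B2(2)[of s t] st B
        by (auto simp: \<Delta>f_def \<Delta>g_def intro: order_trans[OF _ mult_right_mono[of _ B]])
      have nrm: "norm (\<Delta>f, \<Delta>g) \<le> 2 * B * (t - s)"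
        using norm_Pair_le[of \<Delta>f \<Delta>g] \<Delta> by simp
      have "2 * B * (t - s) < d1"
      proof -
        have "t - s < d1 / (2 * B)" using st(4) by (simp add: d_def)
        then show ?thesis using B by (simp add: field_simps)
      qed
      then have nd: "norm (\<Delta>f, \<Delta>g) < d1" using nrm by linarith
      have 1: "\<bar>\<phi> (f t, g t) - \<phi> (f s, g s) - (\<phi>x ?p * \<Delta>f + \<phi>y ?p * \<Delta>g)\<bar> \<le> e' * (2 * B * (t - s))"
      proof (cases "r = s")
        case True
        have "\<bar>\<phi> (f t, g t) - \<phi> (f s, g s) - (\<phi>x ?p * \<Delta>f + \<phi>y ?p * \<Delta>g)\<bar> \<le> e' * norm (\<Delta>f, \<Delta>g)"
          using d1(2)[OF S[of t]] nd st True by (simp add: \<Delta>f_def \<Delta>g_def)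
        also have "\<dots> \<le> e' * (2 * B * (t - s))" using nrm e' by (intro mult_left_mono) auto
        finally show ?thesis .
      next
        case False
        then have rt: "r = t" using st by auto
        have n: "norm ((f s, g s) - (f t, g t)) = norm (\<Delta>f, \<Delta>g)"
          by (simp add: \<Delta>f_def \<Delta>g_def norm_Pair power2_commute)
        have "\<bar>\<phi> (f s, g s) - \<phi> (f t, g t) - (\<phi>x ?p * (- \<Delta>f) + \<phi>y ?p * (- \<Delta>g))\<bar> \<le> e' * norm (\<Delta>f, \<Delta>g)"
          using d1(2)[OF S[of s]] nd n st rt by (simp add: \<Delta>f_def \<Delta>g_def)
        also have "\<dots> \<le> e' * (2 * B * (t - s))" using nrm e' by (intro mult_left_mono) auto
        finally show ?thesis by (simp add: abs_le_iff)
      qed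
      define R where "R = (\<lambda>u. G0 u - (\<phi>x ?p * f' u + \<phi>y ?p * g' u))"
      have f'i: "set_integrable lborel {s..t} f'" using B1(3) st by (intro set_integrable_bounded_Icc[OF f'm, where B = B1]) auto
      have g'i: "set_integrable lborel {s..t} g'" using B2(3) st by (intro set_integrable_bounded_Icc[OF g'm, where B = B2]) auto
      have 2: "(LBINT u:{s..t}. R u) = (LBINT u:{s..t}. G0 u) - (\<phi>x ?p * \<Delta>f + \<phi>y ?p * \<Delta>g)"
        unfolding R_def \<Delta>f_def \<Delta>g_def primitive_onD[OF f st(1-3)] primitive_onD[OF g st(1-3)]
        using int0[of s t] f'i g'i st by simp
      have 3: "norm (LBINT u:{s..t}. R u) \<le> (2 * e' * B) * (t - s)"
      proof (rule set_integral_norm_bound_Icc[OF _ _ st(2)])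
        show "R \<in> borel_measurable borel" unfolding R_def using G0m f'm g'm by measurable
        fix u assume u: "s \<le> u" "u \<le> t"
        then have uab: "u \<in> {a..b}" using st by auto
        have ur: "\<bar>u - r\<bar> < d2" "\<bar>u - r\<bar> < d3" using u st by (auto simp: d_def)
        have "R u = (\<phi>x (f u, g u) - \<phi>x ?p) * f' u + (\<phi>y (f u, g u) - \<phi>y ?p) * g' u"
          using uab by (simp add: R_def G0_def algebra_simps)
        then have "\<bar>R u\<bar> \<le> \<bar>\<phi>x (f u, g u) - \<phi>x ?p\<bar> * \<bar>f' u\<bar> + \<bar>\<phi>y (f u, g u) - \<phi>y ?p\<bar> * \<bar>g' u\<bar>"
          by (metis abs_mult abs_triangle_ineq)
        also have "\<dots> \<le> e' * B + e' * B"
          using d2(2)[OF uab ur(1)] d3(2)[OF uab ur(2)] B1(3)[OF uab] B2(3)[OF uab] B e'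
          by (intro add_mono mult_mono) auto
        finally show "norm (R u) \<le> 2 * e' * B" by (simp add: mult_ac)
      qed
      have "\<bar>D t - D s\<bar> \<le> e' * (2 * B * (t - s)) + (2 * e' * B) * (t - s)"
        using 1 2 3 Ddiff[OF st(1-3)] unfolding real_norm_def by linarith
      also have "\<dots> = (e / 2) * (t - s)" using B by (simp add: e'_def field_simps)
      finally show ?thesis .
    qed
    have "\<bar>(D x - D r) / (x - r)\<bar> < e" if x: "x \<in> {a..b}" "x \<noteq> r" "dist x r < d" for x
    proof -
      have "\<bar>D x - D r\<bar> \<le> (e / 2) * \<bar>x - r\<bar>"
        using main[of r x] main[of x r] x r by (cases "r \<le> x") (auto simp: dist_real_def abs_minus_commute)
      then have "\<bar>(D x - D r) / (x - r)\<bar> \<le> e / 2"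
        using x by (simp add: abs_divide divide_le_eq)
      then show ?thesis using \<open>e > 0\<close> by linarith
    qed
    then show "\<forall>\<^sub>F x in at r within {a..b}. dist ((D x - D r) / (x - r)) 0 < e"
      unfolding eventually_at using d by (auto simp: dist_real_def)
  qed
  then have "\<exists>c. \<forall>x\<in>{a..b}. D x = c"
    by (intro has_field_derivative_zero_constant) auto
  then have "D t = D s" using st by auto
  then show ?thesis
    using Ddiff[OF st] GG0[of s t] st by (simp add: G_def)
qed

text \<open>Measurability of the new density is a separate premise because \<open>f\<close> and
  \<open>g\<close> are controlled on \<open>{a..b}\<close> only, while \<open>primitive_on\<close>
  wants a density that is Borel on the whole line.\<close>

lemma primitive_on_compose:
  fixes \<phi> \<phi>x \<phi>y :: "real \<times> real \<Rightarrow> real"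
  assumes f: "primitive_on f f' a b" and g: "primitive_on g g' a b"
    and S: "\<And>t. t \<in> {a..b} \<Longrightarrow> (f t, g t) \<in> S"
    and \<phi>: "\<And>p. p \<in> S \<Longrightarrow> (\<phi> has_derivative (\<lambda>h. \<phi>x p * fst h + \<phi>y p * snd h)) (at p within S)"
    and cx: "continuous_on S \<phi>x" and cy: "continuous_on S \<phi>y"
    and m: "(\<lambda>u. \<phi>x (f u, g u) * f' u + \<phi>y (f u, g u) * g' u) \<in> borel_measurable borel"
  shows "primitive_on (\<lambda>t. \<phi> (f t, g t)) (\<lambda>u. \<phi>x (f u, g u) * f' u + \<phi>y (f u, g u) * g' u) a b"
  unfolding primitive_on_def
proof (intro conjI allI impI m)
  have cfg: "continuous_on {a..b} (\<lambda>t. (f t, g t))"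
    using primitive_on_continuous[OF f] primitive_on_continuous[OF g] by (intro continuous_intros)
  have ckx: "continuous_on {a..b} (\<lambda>t. \<phi>x (f t, g t))" and cky: "continuous_on {a..b} (\<lambda>t. \<phi>y (f t, g t))"
    using continuous_on_compose2[OF cx cfg] continuous_on_compose2[OF cy cfg] S by blast+
  have "bounded ((\<lambda>t. \<phi>x (f t, g t)) ` {a..b})" "bounded ((\<lambda>t. \<phi>y (f t, g t)) ` {a..b})"
    using ckx cky by (auto intro!: compact_imp_bounded compact_continuous_image)
  then obtain X Y where X: "\<And>u. u \<in> {a..b} \<Longrightarrow> \<bar>\<phi>x (f u, g u)\<bar> \<le> X" and Y: "\<And>u. u \<in> {a..b} \<Longrightarrow> \<bar>\<phi>y (f u, g u)\<bar> \<le> Y"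
    unfolding bounded_iff ball_simps(9) real_norm_def by blast
  obtain B C where B: "\<And>t. t \<in> {a..b} \<Longrightarrow> \<bar>f' t\<bar> \<le> B" and C: "\<And>t. t \<in> {a..b} \<Longrightarrow> \<bar>g' t\<bar> \<le> C"
    using f g unfolding primitive_on_def by blast
  have "\<bar>\<phi>x (f u, g u) * f' u + \<phi>y (f u, g u) * g' u\<bar> \<le> X * B + Y * C" if u: "u \<in> {a..b}" for u
  proof -
    have "\<bar>\<phi>x (f u, g u) * f' u + \<phi>y (f u, g u) * g' u\<bar> \<le> \<bar>\<phi>x (f u, g u)\<bar> * \<bar>f' u\<bar> + \<bar>\<phi>y (f u, g u)\<bar> * \<bar>g' u\<bar>"
      by (metis abs_mult abs_triangle_ineq)
    also have "\<dots> \<le> X * B + Y * C"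
      using X[OF u] Y[OF u] B[OF u] C[OF u] by (intro add_mono mult_mono) auto
    finally show ?thesis .
  qed
  then show "\<exists>B. \<forall>u\<in>{a..b}. \<bar>\<phi>x (f u, g u) * f' u + \<phi>y (f u, g u) * g' u\<bar> \<le> B" by blast
qed (rule chain_rule_primitive[OF assms(1-6)], auto)

lemma primitive_on_mult:
  assumes f: "primitive_on f f' a b" and g: "primitive_on g g' a b"
    and m: "(\<lambda>t. f' t * g t + f t * g' t) \<in> borel_measurable borel"
  shows "primitive_on (\<lambda>t. f t * g t) (\<lambda>t. f' t * g t + f t * g' t) a b"
proof -
  have "primitive_on (\<lambda>t. (\<lambda>p. fst p * snd p) (f t, g t)) (\<lambda>t. snd (f t, g t) * f' t + fst (f t, g t) * g' t) a b"
    by (rule primitive_on_compose[OF f g, where S = UNIV])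
      (use m in \<open>auto intro!: derivative_eq_intros continuous_intros simp: algebra_simps\<close>)
  then show ?thesis by (simp add: mult.commute)
qed

subsection \<open>Integral equations with data on the diagonal\<close>

lemma borel_measurable_integral_snd_Icc:
  fixes h :: "real \<times> real \<Rightarrow> 'a::euclidean_space"
  assumes "h \<in> borel_measurable borel"
  shows "(\<lambda>p. LBINT t:{snd p..fst p}. h (fst p, t)) \<in> borel_measurable borel"
proof -
  have [measurable]: "h \<in> borel_measurable (borel \<Otimes>\<^sub>M borel)"
    using assms by (simp add: borel_prod)
  have "(\<lambda>p. LINT t|lborel. (if snd p \<le> t \<and> t \<le> fst p then h (fst p, t) else 0)) \<in> borel_measurable borel"
    unfolding borel_prod[symmetric] by measurable
  also have "(\<lambda>p. LINT t|lborel. (if snd p \<le> t \<and> t \<le> fst p then h (fst p, t) else 0))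
      = (\<lambda>p. LBINT t:{snd p..fst p}. h (fst p, t))"
    unfolding set_lebesgue_integral_def by (intro ext Bochner_Integration.integral_cong) (auto simp: indicator_def)
  finally show ?thesis .
qed

lemma borel_measurable_integral_fst_Icc:
  fixes h :: "real \<times> real \<Rightarrow> 'a::euclidean_space"
  assumes "h \<in> borel_measurable borel"
  shows "(\<lambda>p. LBINT s:{snd p..fst p}. h (s, snd p)) \<in> borel_measurable borel"
proof -
  have [measurable]: "h \<in> borel_measurable (borel \<Otimes>\<^sub>M borel)"
    using assms by (simp add: borel_prod)
  have "(\<lambda>p. LINT s|lborel. (if snd p \<le> s \<and> s \<le> fst p then h (s, snd p) else 0)) \<in> borel_measurable borel"
    unfolding borel_prod[symmetric] by measurable
  also have "(\<lambda>p. LINT s|lborel. (if snd p \<le> s \<and> s \<le> fst p then h (s, snd p) else 0))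
      = (\<lambda>p. LBINT s:{snd p..fst p}. h (s, snd p))"
    unfolding set_lebesgue_integral_def by (intro ext Bochner_Integration.integral_cong) (auto simp: indicator_def)
  finally show ?thesis .
qed

text \<open>Integrating against the exponential weight gains the factor \<open>1 / l\<close>. This
  gain, here and in the companion estimate for the other direction, makes the Picard map contract
  for large \<open>l\<close>.\<close>

lemma set_integral_norm_le_exp_down:
  fixes h :: "real \<Rightarrow> 'a::euclidean_space"
  assumes "h \<in> borel_measurable borel" "\<And>t. b \<le> t \<Longrightarrow> t \<le> a \<Longrightarrow> norm (h t) \<le> c * exp (l * (a - t))"
    "l > 0" "c \<ge> 0" "b \<le> a"
  shows "norm (LBINT t:{b..a}. h t) \<le> c / l * exp (l * (a - b))"
proof -
  have cont: "continuous_on {b..a} (\<lambda>t. c * exp (l * (a - t)))"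
    by (intro continuous_intros)
  have "(LBINT t:{b..a}. c * exp (l * (a - t))) = (- c / l * exp (l * (a - a))) - (- c / l * exp (l * (a - b)))"
    unfolding set_lebesgue_integral_def
    by (rule integral_FTC_atLeastAtMost[OF assms(5) _ cont])
      (use assms(3) in \<open>auto intro!: derivative_eq_intros simp: has_real_derivative_iff_has_vector_derivative[symmetric]\<close>)
  also have "\<dots> \<le> c / l * exp (l * (a - b))"
    using assms(3,4) by simp
  finally show ?thesis
    using set_integral_norm_le_integral[OF assms(1) cont assms(2)] by linarith
qed

lemma set_integral_norm_le_exp_up:
  fixes h :: "real \<Rightarrow> 'a::euclidean_space"
  assumes "h \<in> borel_measurable borel" "\<And>t. b \<le> t \<Longrightarrow> t \<le> a \<Longrightarrow> norm (h t) \<le> c * exp (l * (t - b))"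
    "l > 0" "c \<ge> 0" "b \<le> a"
  shows "norm (LBINT t:{b..a}. h t) \<le> c / l * exp (l * (a - b))"
proof -
  have cont: "continuous_on {b..a} (\<lambda>t. c * exp (l * (t - b)))"
    by (intro continuous_intros)
  have "(LBINT t:{b..a}. c * exp (l * (t - b))) = (c / l * exp (l * (a - b))) - (c / l * exp (l * (b - b)))"
    unfolding set_lebesgue_integral_def
    by (rule integral_FTC_atLeastAtMost[OF assms(5) _ cont])
      (use assms(3) in \<open>auto intro!: derivative_eq_intros simp: has_real_derivative_iff_has_vector_derivative[symmetric]\<close>)
  also have "\<dots> \<le> c / l * exp (l * (a - b))"
    using assms(3,4) by simp
  finally show ?thesis
    using set_integral_norm_le_integral[OF assms(1) cont assms(2)] by linarith
qed

lemma borel_measurable_slice: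
  fixes Z :: "real \<times> real \<Rightarrow> 'a::topological_space"
  assumes [measurable]: "Z \<in> borel_measurable borel"
  shows "(\<lambda>t. Z (a, t)) \<in> borel_measurable borel" "(\<lambda>s. Z (s, a)) \<in> borel_measurable borel"
  by (measurable; simp add: borel_prod[symmetric])+

text \<open>Picard iteration for the Cauchy problem with data on the diagonal, contracting in the norm
  weighted by \<open>exp (- l (fst p - snd p))\<close>.\<close>

lemma characteristic_cauchy_problem:
  fixes H1 :: "'a::euclidean_space \<times> 'b::euclidean_space \<Rightarrow> 'a" and H2 :: "'a \<times> 'b \<Rightarrow> 'b"
    and A0 :: "real \<Rightarrow> 'a" and B0 :: "real \<Rightarrow> 'b"
  assumes H1: "C-lipschitz_on UNIV H1" and H2: "C-lipschitz_on UNIV H2"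
    and m[measurable]: "A0 \<in> borel_measurable borel" "B0 \<in> borel_measurable borel"
    and D: "\<And>s. norm (A0 s) \<le> D" "\<And>s. norm (B0 s) \<le> D"
  obtains Z where "Z \<in> borel_measurable borel"
    "\<And>p. snd p \<le> fst p \<Longrightarrow> Z p =
      (A0 (fst p) + (LBINT t:{snd p..fst p}. H1 (Z (fst p, t))),
       B0 (snd p) + (LBINT s:{snd p..fst p}. H2 (Z (s, snd p))))"
    "\<And>\<tau>. \<exists>B. \<forall>p. fst p - snd p \<le> \<tau> \<longrightarrow> norm (Z p) \<le> B"
proof -
  have C: "C \<ge> 0" using H1 by (rule lipschitz_on_nonneg)
  have H1c: "continuous_on UNIV H1" and H2c: "continuous_on UNIV H2"
    using H1 H2 by (auto intro: lipschitz_on_continuous_on)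
  have H1m[measurable]: "H1 \<in> borel_measurable borel" and H2m[measurable]: "H2 \<in> borel_measurable borel"
    using H1c H2c by (auto intro: borel_measurable_continuous_onI)
  have lip: "norm (H1 x - H1 y) \<le> C * norm (x - y)" "norm (H2 x - H2 y) \<le> C * norm (x - y)" for x y
    using lipschitz_onD[OF H1] lipschitz_onD[OF H2] by (auto simp: dist_norm)
  have D0: "D \<ge> 0" using D(1)[of 0] norm_ge_zero order_trans by blast
  \<comment> \<open>Each of the two integrals contributes \<open>C / l\<close> to the contraction
    constant; this \<open>l\<close> brings the sum below 1/2.\<close>
  define l where "l = 4 * C + 1"
  have l: "l > 0" "2 * C / l \<le> 1 / 2" using C by (auto simp: l_def field_simps)
  define N0 where "N0 = norm (H1 0) + norm (H2 0) + C * (2 * D)"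
  have N0: "N0 \<ge> 0" using C D0 by (simp add: N0_def)
  \<comment> \<open>\<open>N0\<close> bounds both right-hand sides along the zeroth iterate, so
    \<open>M\<close> bounds the first increment in the weighted norm, and the later ones decay
    geometrically from it.\<close>
  define M where "M = 2 * N0 / l"
  have M: "M \<ge> 0" using N0 l by (simp add: M_def)
  define W where "W = (\<lambda>p :: real \<times> real. exp (l * (fst p - snd p)))"
  define F where "F = (\<lambda>Z (p :: real \<times> real).
      (A0 (fst p) + (LBINT t:{snd p..fst p}. H1 (Z (fst p, t))),
       B0 (snd p) + (LBINT s:{snd p..fst p}. H2 (Z (s, snd p)))))"
  define Z where "Z = rec_nat (\<lambda>p. (A0 (fst p), B0 (snd p))) (\<lambda>_. F)"
  have Z0: "Z 0 = (\<lambda>p. (A0 (fst p), B0 (snd p)))" and ZS: "Z (Suc n) = F (Z n)" for n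
    by (simp_all add: Z_def)
  have Zm: "Z n \<in> borel_measurable borel" for n
  proof (induction n)
    case 0
    show ?case unfolding Z0 borel_prod[symmetric] by measurable
  next
    case (Suc n)
    note [measurable] = Suc
    have 1: "(\<lambda>p. LBINT t:{snd p..fst p}. H1 (Z n (fst p, t))) \<in> borel_measurable borel"
      by (rule borel_measurable_integral_snd_Icc) measurable
    have 2: "(\<lambda>p. LBINT s:{snd p..fst p}. H2 (Z n (s, snd p))) \<in> borel_measurable borel"
      by (rule borel_measurable_integral_fst_Icc) measurable
    have 3: "(\<lambda>p::real\<times>real. A0 (fst p)) \<in> borel_measurable borel" "(\<lambda>p::real\<times>real. B0 (snd p)) \<in> borel_measurable borel"
      unfolding borel_prod[symmetric] by measurable
    show ?case
      unfolding ZS F_def by (intro borel_measurable_Pair borel_measurable_add 1 2 3)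
  qed
  have H1Zm: "(\<lambda>t. H1 (Z n (a, t))) \<in> borel_measurable borel"
    and H2Zm: "(\<lambda>s. H2 (Z n (s, a))) \<in> borel_measurable borel" for n a
    using measurable_compose[OF borel_measurable_slice(1)[OF Zm] H1m]
      measurable_compose[OF borel_measurable_slice(2)[OF Zm] H2m] by auto
  have H0: "norm (H1 (Z 0 p)) \<le> N0" "norm (H2 (Z 0 p)) \<le> N0" for p
  proof -
    have "norm (Z 0 p) \<le> 2 * D"
      unfolding Z0 using norm_Pair_le[of "A0 (fst p)" "B0 (snd p)"] D[of "fst p"] D[of "snd p"] by simp
    then have "C * norm (Z 0 p) \<le> C * (2 * D)" using C by (rule mult_left_mono)
    then show "norm (H1 (Z 0 p)) \<le> N0"
      using lip(1)[of "Z 0 p" 0] norm_triangle_sub[of "H1 (Z 0 p)" "H1 0"] norm_ge_zero[of "H2 0"]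
      unfolding N0_def diff_zero by linarith
    show "norm (H2 (Z 0 p)) \<le> N0"
      using \<open>C * norm (Z 0 p) \<le> C * (2 * D)\<close> lip(2)[of "Z 0 p" 0]
        norm_triangle_sub[of "H2 (Z 0 p)" "H2 0"] norm_ge_zero[of "H1 0"]
      unfolding N0_def diff_zero by linarith
  qed
  have step: "norm (Z (Suc n) p) \<le> 2 * D + (2 - 2 * (1/2) ^ Suc n) * M * W p"
    if "norm (Z n p) \<le> 2 * D + (2 - 2 * (1/2) ^ n) * M * W p" "norm (Z (Suc n) p - Z n p) \<le> (1/2) ^ n * M * W p" for n p
    using norm_triangle_sub[of "Z (Suc n) p" "Z n p"] that by (simp add: algebra_simps)
  \<comment> \<open>Bound and increment estimate go through one induction: the bound supplies the
    integrability needed to write the difference of two iterates as the integral of a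
    difference.\<close>
  have Zind: "norm (Z n p) \<le> 2 * D + (2 - 2 * (1/2) ^ n) * M * W p \<and> norm (Z (Suc n) p - Z n p) \<le> (1/2) ^ n * M * W p" for n p
  proof (induction n arbitrary: p)
    case 0
    have "norm (Z 0 p) \<le> 2 * D + (2 - 2 * (1/2) ^ 0) * M * W p"
      unfolding Z0 using norm_Pair_le[of "A0 (fst p)" "B0 (snd p)"] D[of "fst p"] D[of "snd p"] by simp
    moreover have "norm (Z (Suc 0) p - Z 0 p) \<le> (1/2) ^ 0 * M * W p"
    proof (cases "snd p \<le> fst p")
      case True
      have 1: "norm (LBINT t:{snd p..fst p}. H1 (Z 0 (fst p, t))) \<le> N0 / l * exp (l * (fst p - snd p))"
      proof (rule set_integral_norm_le_exp_down[OF H1Zm])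
        show "norm (H1 (Z 0 (fst p, t))) \<le> N0 * exp (l * (fst p - t))" if "t \<le> fst p" for t
          using H0(1)[of "(fst p, t)"] mult_left_mono[of 1 "exp (l * (fst p - t))" N0] N0 l that
          by simp
      qed (use l N0 True in auto)
      have 2: "norm (LBINT s:{snd p..fst p}. H2 (Z 0 (s, snd p))) \<le> N0 / l * exp (l * (fst p - snd p))"
      proof (rule set_integral_norm_le_exp_up[OF H2Zm])
        show "norm (H2 (Z 0 (t, snd p))) \<le> N0 * exp (l * (t - snd p))" if "snd p \<le> t" for t
          using H0(2)[of "(t, snd p)"] mult_left_mono[of 1 "exp (l * (t - snd p))" N0] N0 l that
          by simp
      qed (use l N0 True in auto)
      have "norm (Z (Suc 0) p - Z 0 p) \<le> norm (LBINT t:{snd p..fst p}. H1 (Z 0 (fst p, t)))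
          + norm (LBINT s:{snd p..fst p}. H2 (Z 0 (s, snd p)))"
        unfolding ZS F_def Z0 using norm_Pair_le by simp
      also have "\<dots> \<le> M * W p" using 1 2 by (simp add: M_def W_def)
      finally show ?thesis by simp
    next
      case False
      \<comment> \<open>Below the diagonal the intervals of integration are empty, so all iterates
        coincide there.\<close>
      then show ?thesis unfolding ZS F_def Z0 using M by (simp add: W_def zero_prod_def[symmetric] set_lebesgue_integral_def)
    qed
    ultimately show ?case ..
  next
    case (Suc n)
    have Zb': "norm (Z (Suc n) q) \<le> 2 * D + (2 - 2 * (1/2) ^ Suc n) * M * W q" for q
      using step Suc by blast
    have bnd: "norm (Z k q) \<le> 2 * D + 2 * M * W p" if "k = n \<or> k = Suc n" "fst q - snd q \<le> fst p - snd p" for k q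
    proof -
      have "norm (Z k q) \<le> 2 * D + (2 - 2 * (1/2) ^ k) * M * W q" using Suc[of q] Zb'[of q] that(1) by auto
      also have "\<dots> \<le> 2 * D + 2 * M * W p"
        using M l that(2) by (intro add_left_mono mult_mono) (auto simp: W_def mult_le_cancel_right1)
      finally show ?thesis .
    qed
    have Hbnd: "norm (H1 (Z k q)) \<le> norm (H1 0) + C * (2 * D + 2 * M * W p)"
      "norm (H2 (Z k q)) \<le> norm (H2 0) + C * (2 * D + 2 * M * W p)"
      if "k = n \<or> k = Suc n" "fst q - snd q \<le> fst p - snd p" for k q
      using lip[of "Z k q" 0] mult_left_mono[OF bnd[OF that] C]
        norm_triangle_sub[of "H1 (Z k q)" "H1 0"] norm_triangle_sub[of "H2 (Z k q)" "H2 0"] by auto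
    define c where "c = C * ((1/2) ^ n * M)"
    have c: "c \<ge> 0" using C M by (simp add: c_def)
    have "norm (Z (Suc (Suc n)) p - Z (Suc n) p) \<le> (1/2) ^ Suc n * M * W p"
    proof (cases "snd p \<le> fst p")
      case True
      have i1: "set_integrable lborel {snd p..fst p} (\<lambda>t. H1 (Z k (fst p, t)))" if "k = n \<or> k = Suc n" for k
        by (rule set_integrable_bounded_Icc[OF H1Zm]) (rule Hbnd(1)[OF that], simp)
      have i2: "set_integrable lborel {snd p..fst p} (\<lambda>t. H2 (Z k (t, snd p)))" if "k = n \<or> k = Suc n" for k
        by (rule set_integrable_bounded_Icc[OF H2Zm]) (rule Hbnd(2)[OF that], simp)
      have 1: "norm (LBINT t:{snd p..fst p}. H1 (Z (Suc n) (fst p, t)) - H1 (Z n (fst p, t))) \<le> c / l * exp (l * (fst p - snd p))"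
      proof (rule set_integral_norm_le_exp_down)
        show "norm (H1 (Z (Suc n) (fst p, t)) - H1 (Z n (fst p, t))) \<le> c * exp (l * (fst p - t))" if "t \<le> fst p" for t
          using lip(1)[of "Z (Suc n) (fst p, t)" "Z n (fst p, t)"] mult_left_mono[OF conjunct2[OF Suc[of "(fst p, t)"]] C]
          by (simp add: c_def W_def mult_ac)
      qed (use l c True H1Zm in auto)
      have 2: "norm (LBINT s:{snd p..fst p}. H2 (Z (Suc n) (s, snd p)) - H2 (Z n (s, snd p))) \<le> c / l * exp (l * (fst p - snd p))"
      proof (rule set_integral_norm_le_exp_up)
        show "norm (H2 (Z (Suc n) (t, snd p)) - H2 (Z n (t, snd p))) \<le> c * exp (l * (t - snd p))" if "snd p \<le> t" for t
          using lip(2)[of "Z (Suc n) (t, snd p)" "Z n (t, snd p)"] mult_left_mono[OF conjunct2[OF Suc[of "(t, snd p)"]] C]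
          by (simp add: c_def W_def mult_ac)
      qed (use l c True H2Zm in auto)
      have eq: "Z (Suc (Suc n)) p - Z (Suc n) p =
          (LBINT t:{snd p..fst p}. H1 (Z (Suc n) (fst p, t)) - H1 (Z n (fst p, t)),
           LBINT s:{snd p..fst p}. H2 (Z (Suc n) (s, snd p)) - H2 (Z n (s, snd p)))"
        unfolding ZS[of "Suc n"] using i1 i2 by (subst ZS) (simp add: F_def)
      have "norm (Z (Suc (Suc n)) p - Z (Suc n) p) \<le> 2 * (c / l * exp (l * (fst p - snd p)))"
        unfolding eq using order_trans[OF norm_Pair_le add_mono[OF 1 2]] by simp
      also have "\<dots> = (2 * C / l) * ((1/2) ^ n * M * W p)"
        by (simp add: c_def W_def)
      also have "\<dots> \<le> (1/2) * ((1/2) ^ n * M * W p)"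
        using l M by (intro mult_right_mono) (auto simp: W_def)
      finally show ?thesis by simp
    next
      case False
      then have "Z (Suc (Suc n)) p - Z (Suc n) p = 0"
        unfolding ZS F_def by (simp add: zero_prod_def set_lebesgue_integral_def)
      then show ?thesis using M by (simp add: W_def)
    qed
    with Zb' show ?case by blast
  qed
  then have Zb: "norm (Z n p) \<le> 2 * D + (2 - 2 * (1/2) ^ n) * M * W p"
    and Zd: "norm (Z (Suc n) p - Z n p) \<le> (1/2) ^ n * M * W p" for n p
    by blast+
  have Zconv: "\<exists>L. (\<lambda>n. Z n p) \<longlonglongrightarrow> L" for p
  proof -
    have "summable (\<lambda>n. Z (Suc n) p - Z n p)"
    proof (rule summable_comparison_test)
      show "summable (\<lambda>n. (1/2) ^ n * M * W p :: real)"
        by (intro summable_mult2 summable_geometric) simp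
    qed (use Zd in blast)
    then have "(\<lambda>n. Z n p - Z 0 p) \<longlonglongrightarrow> (\<Sum>n. Z (Suc n) p - Z n p)"
      using summable_LIMSEQ[of "\<lambda>n. Z (Suc n) p - Z n p"] sum_lessThan_telescope[of "\<lambda>n. Z n p"] by simp
    then have "(\<lambda>n. (Z n p - Z 0 p) + Z 0 p) \<longlonglongrightarrow> (\<Sum>n. Z (Suc n) p - Z n p) + Z 0 p"
      by (intro tendsto_intros)
    then show ?thesis unfolding diff_add_cancel by blast
  qed
  define L where "L = (\<lambda>p. lim (\<lambda>n. Z n p))"
  have ZL: "(\<lambda>n. Z n p) \<longlonglongrightarrow> L p" for p
    unfolding L_def using Zconv[of p] by (metis limI)
  have Lm: "L \<in> borel_measurable borel"
    by (rule borel_measurable_LIMSEQ_metric[OF Zm ZL])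
  have Zb': "norm (Z n q) \<le> 2 * D + 2 * M * exp (l * \<tau>)" if "fst q - snd q \<le> \<tau>" for n q \<tau>
  proof -
    have "norm (Z n q) \<le> 2 * D + (2 - 2 * (1/2) ^ n) * M * W q" by (rule Zb)
    also have "\<dots> \<le> 2 * D + 2 * M * exp (l * \<tau>)"
      using M l that by (intro add_left_mono mult_mono) (auto simp: W_def mult_le_cancel_right1)
    finally show ?thesis .
  qed
  have Lb: "norm (L q) \<le> 2 * D + 2 * M * exp (l * \<tau>)" if "fst q - snd q \<le> \<tau>" for q \<tau>
    using Lim_bounded[OF tendsto_norm[OF ZL[of q]], of 0] Zb'[OF that] by auto
  have Hb: "norm (H1 (Z n q)) \<le> norm (H1 0) + C * (2 * D + 2 * M * exp (l * \<tau>))"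
    "norm (H2 (Z n q)) \<le> norm (H2 0) + C * (2 * D + 2 * M * exp (l * \<tau>))" if "fst q - snd q \<le> \<tau>" for n q \<tau>
    using lip[of "Z n q" 0] mult_left_mono[OF Zb'[OF that, of n] C]
      norm_triangle_sub[of "H1 (Z n q)" "H1 0"] norm_triangle_sub[of "H2 (Z n q)" "H2 0"] by auto
  have HL1: "(\<lambda>n. H1 (Z n q)) \<longlonglongrightarrow> H1 (L q)" and HL2: "(\<lambda>n. H2 (Z n q)) \<longlonglongrightarrow> H2 (L q)" for q
    using continuous_on_tendsto_compose[OF H1c ZL[of q]] continuous_on_tendsto_compose[OF H2c ZL[of q]]
    by simp_all
  have dc: "(\<lambda>n. LBINT t:{b..a}. h n t) \<longlonglongrightarrow> (LBINT t:{b..a}. h' t)"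
    if "\<And>n. h n \<in> borel_measurable borel" "h' \<in> borel_measurable borel"
      "\<And>t. (\<lambda>n. h n t) \<longlonglongrightarrow> h' t" "\<And>n t. t \<in> {b..a} \<Longrightarrow> norm (h n t) \<le> B"
    for h :: "nat \<Rightarrow> real \<Rightarrow> 'c::euclidean_space" and h' B a b
    unfolding set_lebesgue_integral_def
  proof (rule integral_dominated_convergence[where w = "\<lambda>t. indicator {b..a} t * B"])
    show "integrable lborel (\<lambda>t. indicator {b..a} t * B)"
      by (intro integrable_mult_left integrable_real_indicator) (auto simp: emeasure_lborel_Icc_eq)
    show "AE t in lborel. norm (indicator {b..a} t *\<^sub>R h n t) \<le> indicator {b..a} t * B" for n
      using that(4)[of _ n] by (auto simp: indicator_def)
  qed (use that in \<open>auto intro!: tendsto_intros\<close>)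
  have "L p = F L p" if "snd p \<le> fst p" for p
  proof -
    have "(\<lambda>n. F (Z n) p) \<longlonglongrightarrow> F L p"
      unfolding F_def
    proof (intro tendsto_intros)
      show "(\<lambda>n. LBINT t:{snd p..fst p}. H1 (Z n (fst p, t))) \<longlonglongrightarrow> (LBINT t:{snd p..fst p}. H1 (L (fst p, t)))"
        by (rule dc[OF H1Zm _ HL1]; (rule Hb(1)[where \<tau> = "fst p - snd p"])?)
          (auto intro!: measurable_compose[OF borel_measurable_slice(1)[OF Lm] H1m])
      show "(\<lambda>n. LBINT t:{snd p..fst p}. H2 (Z n (t, snd p))) \<longlonglongrightarrow> (LBINT t:{snd p..fst p}. H2 (L (t, snd p)))"
        by (rule dc[OF H2Zm _ HL2]; (rule Hb(2)[where \<tau> = "fst p - snd p"])?)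
          (auto intro!: measurable_compose[OF borel_measurable_slice(2)[OF Lm] H2m])
    qed
    moreover have "(\<lambda>n. F (Z n) p) \<longlonglongrightarrow> L p"
      using LIMSEQ_Suc[OF ZL[of p]] unfolding ZS .
    ultimately show ?thesis using LIMSEQ_unique by blast
  qed
  then show thesis
    using that[OF Lm] Lb unfolding F_def by blast
qed

section \<open>Reversal of direction, monotonicity and barriers for primitives\<close>

lemma set_integral_reflect_Icc:
  fixes g :: "real \<Rightarrow> real"
  shows "(LBINT u:{-t..-s}. g (- u)) = (LBINT u:{s..t}. g u)"
proof -
  have "(LBINT u:{s..t}. g u) = (LINT u|lborel. indicator {s..t} (- u) *\<^sub>R g (- u))"
    unfolding set_lebesgue_integral_def
    by (subst lborel_integral_real_affine[where c = "-1" and t = 0]) auto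
  also have "\<dots> = (LBINT u:{-t..-s}. g (- u))"
    unfolding set_lebesgue_integral_def
    by (intro Bochner_Integration.integral_cong) (auto simp: indicator_def)
  finally show ?thesis by simp
qed

lemma primitive_on_reflect:
  assumes "primitive_on f g a b"
  shows "primitive_on (\<lambda>t. f (- t)) (\<lambda>t. - g (- t)) (- b) (- a)"
  unfolding primitive_on_def
proof (intro conjI allI impI)
  have "g \<in> borel_measurable borel"
    using assms unfolding primitive_on_def by blast
  note [measurable] = measurable_compose[OF _ this]
  show "(\<lambda>t. - g (- t)) \<in> borel_measurable borel"
    by measurable
  obtain B where "\<And>t. t \<in> {a..b} \<Longrightarrow> \<bar>g t\<bar> \<le> B"
    using assms unfolding primitive_on_def by blast
  then show "\<exists>B. \<forall>t\<in>{- b..- a}. \<bar>- g (- t)\<bar> \<le> B"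
    by (intro exI[of _ B]) auto
  fix s t assume "- b \<le> s" "s \<le> t" "t \<le> - a"
  then have "f (- s) - f (- t) = (LBINT u:{-t..-s}. g u)"
    using primitive_onD[OF assms, of "- t" "- s"] by auto
  also have "\<dots> = (LBINT u:{s..t}. g (- u))"
    using set_integral_reflect_Icc[of t s "\<lambda>u. g (- u)"] by simp
  finally show "f (- t) - f (- s) = (LBINT u:{s..t}. - g (- u))"
    by (simp add: set_lebesgue_integral_def)
qed

lemma primitive_on_cong:
  assumes "primitive_on f g a b" "\<And>t. a \<le> t \<Longrightarrow> t \<le> b \<Longrightarrow> g t = g' t" "g' \<in> borel_measurable borel"
  shows "primitive_on f g' a b"
  unfolding primitive_on_def
proof (intro conjI allI impI assms(3))
  show "\<exists>B. \<forall>t\<in>{a..b}. \<bar>g' t\<bar> \<le> B"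
    using assms unfolding primitive_on_def by auto
  fix s t assume st: "a \<le> s" "s \<le> t" "t \<le> b"
  have "(LBINT u:{s..t}. g u) = (LBINT u:{s..t}. g' u)"
    using st assms(2) by (intro set_lebesgue_integral_cong) auto
  then show "f t - f s = (LBINT u:{s..t}. g' u)"
    using primitive_onD[OF assms(1) st] by simp
qed

text \<open>The left end point is exempt from the sign condition because the barrier argument starts
  at the last time when the barrier still holds, where the sign of the density is unknown.\<close>

lemma primitive_on_increasing:
  assumes "primitive_on f g a b" "a \<le> s" "s \<le> t" "t \<le> b"
    "\<And>u. s < u \<Longrightarrow> u \<le> t \<Longrightarrow> g u \<ge> 0"
  shows "f s \<le> f t"
proof -
  have "AE u in lborel. 0 \<le> indicator {s..t} u *\<^sub>R g u"
    using AE_lborel_singleton[of s] by eventually_elim (use assms(5) in \<open>auto simp: indicator_def\<close>)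
  then have "0 \<le> (LBINT u:{s..t}. g u)"
    unfolding set_lebesgue_integral_def by (rule integral_nonneg_AE)
  then show ?thesis
    using primitive_onD[OF assms(1-4)] by simp
qed

text \<open>After the last time before \<open>t\<close> with \<open>f \<ge> d\<close>, the function
  lies below \<open>d\<close>, so its density is nonnegative there and \<open>f\<close> cannot have
  come down.\<close>

lemma primitive_on_barrier:
  assumes f: "primitive_on f g a b" and "f a \<ge> d"
    and g: "\<And>u. a \<le> u \<Longrightarrow> u \<le> b \<Longrightarrow> f u < d \<Longrightarrow> g u \<ge> 0" and t: "a \<le> t" "t \<le> b"
  shows "f t \<ge> d"
proof (rule ccontr)
  assume "\<not> f t \<ge> d"
  then have ft: "f t < d" by simp
  define S where "S = {s \<in> {a..t}. f s \<ge> d}"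
  have "continuous_on {a..t} f"
    using primitive_on_continuous[OF f] t by (auto intro: continuous_on_subset)
  then have "closed S"
    unfolding S_def by (intro continuous_on_closed_Collect_le continuous_intros) auto
  moreover have "bdd_above S" "a \<in> S"
    using assms(2) t by (auto simp: S_def intro!: bdd_aboveI[of _ t])
  ultimately have S: "Sup S \<in> S" "\<And>s. s \<in> S \<Longrightarrow> s \<le> Sup S"
    using closed_contains_Sup[of S] cSup_upper by blast+
  have "f (Sup S) \<le> f t"
  proof (rule primitive_on_increasing[OF f])
    fix u assume u: "Sup S < u" "u \<le> t"
    then have "u \<notin> S" using S(2) by force
    then have "f u < d" using u S(1) unfolding S_def by auto
    then show "g u \<ge> 0" using g u S(1) t unfolding S_def by auto
  qed (use S(1) t in \<open>auto simp: S_def\<close>)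
  then show False using S(1) ft by (simp add: S_def)
qed

lemma primitive_on_barrier_backward:
  assumes "primitive_on f g a b" "f b \<ge> d"
    "\<And>u. a \<le> u \<Longrightarrow> u \<le> b \<Longrightarrow> f u < d \<Longrightarrow> g u \<le> 0" "a \<le> t" "t \<le> b"
  shows "f t \<ge> d"
  using primitive_on_barrier[OF primitive_on_reflect[OF assms(1)], of d "- t"] assms(2-) by auto

subsection \<open>Partial primitives on a half-plane\<close>

text \<open>In characteristic coordinates everything lives on the half-plane \<open>snd p \<le> fst p\<close>, whose
  boundary carries the initial data.\<close>

definition halfplane :: "(real \<times> real) set"
  where "halfplane = {p. snd p \<le> fst p}"

text \<open>The triangles in the bound exhaust the half-plane. Below the diagonal only Borel
  measurability is demanded.\<close>

definition locally_bounded :: "(real \<times> real \<Rightarrow> real) \<Rightarrow> bool"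
  where "locally_bounded f \<longleftrightarrow> f \<in> borel_measurable borel \<and>
    (\<forall>\<tau>. \<exists>B. \<forall>s t. - \<tau> \<le> t \<longrightarrow> t \<le> s \<longrightarrow> s \<le> \<tau> \<longrightarrow> \<bar>f (s, t)\<bar> \<le> B)"

lemma locally_boundedE:
  assumes "locally_bounded f"
  obtains B where "B \<ge> 0" "\<And>s t. - \<tau> \<le> t \<Longrightarrow> t \<le> s \<Longrightarrow> s \<le> \<tau> \<Longrightarrow> \<bar>f (s, t)\<bar> \<le> B"
proof -
  obtain B where "\<And>s t. - \<tau> \<le> t \<Longrightarrow> t \<le> s \<Longrightarrow> s \<le> \<tau> \<Longrightarrow> \<bar>f (s, t)\<bar> \<le> B"
    using assms unfolding locally_bounded_def by meson
  then show thesis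
    using that[of "\<bar>B\<bar>"] order_trans[OF _ abs_ge_self] by auto
qed

lemma locally_bounded_measurable: "locally_bounded f \<Longrightarrow> f \<in> borel_measurable borel"
  by (simp add: locally_bounded_def)

lemma locally_boundedI:
  assumes "f \<in> borel_measurable borel"
    "\<And>\<tau>. \<exists>B. \<forall>s t. - \<tau> \<le> t \<longrightarrow> t \<le> s \<longrightarrow> s \<le> \<tau> \<longrightarrow> \<bar>f (s, t)\<bar> \<le> B"
  shows "locally_bounded f"
  using assms unfolding locally_bounded_def by blast

lemma locally_bounded_const: "locally_bounded (\<lambda>p. c)"
  by (rule locally_boundedI) auto

lemma locally_bounded_minus: "locally_bounded f \<Longrightarrow> locally_bounded (\<lambda>p. - f p)"
  unfolding locally_bounded_def by auto

lemma locally_bounded_add: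
  assumes "locally_bounded f" "locally_bounded g"
  shows "locally_bounded (\<lambda>p. f p + g p)"
proof (rule locally_boundedI)
  show "(\<lambda>p. f p + g p) \<in> borel_measurable borel"
    using assms[THEN locally_bounded_measurable] by measurable
  fix \<tau>
  obtain B where B: "\<And>s t. - \<tau> \<le> t \<Longrightarrow> t \<le> s \<Longrightarrow> s \<le> \<tau> \<Longrightarrow> \<bar>f (s, t)\<bar> \<le> B"
    using locally_boundedE[OF assms(1)] by metis
  obtain C where C: "\<And>s t. - \<tau> \<le> t \<Longrightarrow> t \<le> s \<Longrightarrow> s \<le> \<tau> \<Longrightarrow> \<bar>g (s, t)\<bar> \<le> C"
    using locally_boundedE[OF assms(2)] by metis
  show "\<exists>B. \<forall>s t. - \<tau> \<le> t \<longrightarrow> t \<le> s \<longrightarrow> s \<le> \<tau> \<longrightarrow> \<bar>f (s, t) + g (s, t)\<bar> \<le> B"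
    by (intro exI[of _ "B + C"] allI impI order_trans[OF abs_triangle_ineq] add_mono B C)
qed

lemma locally_bounded_mult:
  assumes "locally_bounded f" "locally_bounded g"
  shows "locally_bounded (\<lambda>p. f p * g p)"
proof (rule locally_boundedI)
  show "(\<lambda>p. f p * g p) \<in> borel_measurable borel"
    using assms[THEN locally_bounded_measurable] by measurable
  fix \<tau>
  obtain B where B: "B \<ge> 0" "\<And>s t. - \<tau> \<le> t \<Longrightarrow> t \<le> s \<Longrightarrow> s \<le> \<tau> \<Longrightarrow> \<bar>f (s, t)\<bar> \<le> B"
    using locally_boundedE[OF assms(1)] by metis
  obtain C where C: "\<And>s t. - \<tau> \<le> t \<Longrightarrow> t \<le> s \<Longrightarrow> s \<le> \<tau> \<Longrightarrow> \<bar>g (s, t)\<bar> \<le> C"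
    using locally_boundedE[OF assms(2)] by metis
  show "\<exists>B. \<forall>s t. - \<tau> \<le> t \<longrightarrow> t \<le> s \<longrightarrow> s \<le> \<tau> \<longrightarrow> \<bar>f (s, t) * g (s, t)\<bar> \<le> B"
    unfolding abs_mult by (intro exI[of _ "B * C"] allI impI mult_mono B C) auto
qed

lemma locally_bounded_compose:
  assumes "locally_bounded f" "locally_bounded g" and \<phi>: "continuous_on UNIV (\<phi> :: real \<times> real \<Rightarrow> real)"
  shows "locally_bounded (\<lambda>p. \<phi> (f p, g p))"
proof (rule locally_boundedI)
  note [measurable] = assms(1,2)[THEN locally_bounded_measurable] borel_measurable_continuous_onI[OF \<phi>]
  show "(\<lambda>p. \<phi> (f p, g p)) \<in> borel_measurable borel"
    by measurable
  fix \<tau>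
  obtain B where B: "\<And>s t. - \<tau> \<le> t \<Longrightarrow> t \<le> s \<Longrightarrow> s \<le> \<tau> \<Longrightarrow> \<bar>f (s, t)\<bar> \<le> B"
    using locally_boundedE[OF assms(1)] by metis
  obtain C where C: "\<And>s t. - \<tau> \<le> t \<Longrightarrow> t \<le> s \<Longrightarrow> s \<le> \<tau> \<Longrightarrow> \<bar>g (s, t)\<bar> \<le> C"
    using locally_boundedE[OF assms(2)] by metis
  have "compact ({-B..B} \<times> {-C..C})"
    by (intro compact_Times compact_Icc)
  then have "bounded (\<phi> ` ({-B..B} \<times> {-C..C}))"
    using \<phi> by (intro compact_imp_bounded compact_continuous_image) (auto intro: continuous_on_subset)
  then obtain D where "\<And>q. q \<in> {-B..B} \<times> {-C..C} \<Longrightarrow> \<bar>\<phi> q\<bar> \<le> D"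
    unfolding bounded_iff ball_simps(9) real_norm_def by blast
  then show "\<exists>B. \<forall>s t. - \<tau> \<le> t \<longrightarrow> t \<le> s \<longrightarrow> s \<le> \<tau> \<longrightarrow> \<bar>\<phi> (f (s, t), g (s, t))\<bar> \<le> B"
    using B C by (intro exI[of _ D]) (auto simp: abs_le_iff minus_le_iff)
qed

text \<open>Regularity in one direction only: the line of fixed \<open>t\<close> is entered at its
  diagonal point \<open>(t, t)\<close>, the dependence on \<open>t\<close> is merely Borel, and for
  \<open>s < t\<close> the interval is empty.\<close>

definition fst_primitive :: "(real \<times> real \<Rightarrow> real) \<Rightarrow> (real \<times> real \<Rightarrow> real) \<Rightarrow> bool"
  where "fst_primitive f g \<longleftrightarrow> locally_bounded f \<and> locally_bounded g \<and>
    (\<forall>s t. primitive_on (\<lambda>u. f (u, t)) (\<lambda>u. g (u, t)) t s)"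

definition snd_primitive :: "(real \<times> real \<Rightarrow> real) \<Rightarrow> (real \<times> real \<Rightarrow> real) \<Rightarrow> bool"
  where "snd_primitive f g \<longleftrightarrow> locally_bounded f \<and> locally_bounded g \<and>
    (\<forall>s t. primitive_on (\<lambda>u. f (s, u)) (\<lambda>u. g (s, u)) t s)"

lemma fst_primitiveD:
  assumes "fst_primitive f g"
  shows "locally_bounded f" "locally_bounded g" "primitive_on (\<lambda>u. f (u, t)) (\<lambda>u. g (u, t)) t s"
  using assms unfolding fst_primitive_def by auto

lemma snd_primitiveD:
  assumes "snd_primitive f g"
  shows "locally_bounded f" "locally_bounded g" "primitive_on (\<lambda>u. f (s, u)) (\<lambda>u. g (s, u)) t s"
  using assms unfolding snd_primitive_def by auto

lemma fst_primitiveI: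
  assumes "locally_bounded f" "locally_bounded g"
    "\<And>s t. t \<le> s \<Longrightarrow> f (s, t) = f (t, t) + (LBINT u:{t..s}. g (u, t))"
  shows "fst_primitive f g"
  unfolding fst_primitive_def
proof (intro conjI allI assms(1,2))
  fix s t :: real
  obtain B where "\<And>u v. - (\<bar>s\<bar> + \<bar>t\<bar>) \<le> v \<Longrightarrow> v \<le> u \<Longrightarrow> u \<le> \<bar>s\<bar> + \<bar>t\<bar> \<Longrightarrow> \<bar>g (u, v)\<bar> \<le> B"
    using locally_boundedE[OF assms(2)] by metis
  then show "primitive_on (\<lambda>u. f (u, t)) (\<lambda>u. g (u, t)) t s"
    by (intro primitive_onI[where B = B] borel_measurable_slice locally_bounded_measurable assms) auto
qed

lemma snd_primitiveI:
  assumes "locally_bounded f" "locally_bounded g"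
    "\<And>s t. t \<le> s \<Longrightarrow> f (s, t) = f (s, s) + (LBINT u:{t..s}. - g (s, u))"
  shows "snd_primitive f g"
  unfolding snd_primitive_def
proof (intro conjI allI assms(1,2))
  fix s t :: real
  obtain B where "\<And>u v. - (\<bar>s\<bar> + \<bar>t\<bar>) \<le> v \<Longrightarrow> v \<le> u \<Longrightarrow> u \<le> \<bar>s\<bar> + \<bar>t\<bar> \<Longrightarrow> \<bar>g (u, v)\<bar> \<le> B"
    using locally_boundedE[OF assms(2)] by metis
  then show "primitive_on (\<lambda>u. f (s, u)) (\<lambda>u. g (s, u)) t s"
    by (intro primitive_onI_backward[where B = B] borel_measurable_slice locally_bounded_measurable assms) auto
qed

lemma fst_primitive_eq:
  "fst_primitive f g \<Longrightarrow> t \<le> s \<Longrightarrow> f (s, t) = f (t, t) + (LBINT u:{t..s}. g (u, t))"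
  using primitive_onD[OF fst_primitiveD(3), of f g t t s s] by simp

lemma snd_primitive_eq:
  assumes "snd_primitive f g" "t \<le> s"
  shows "f (s, t) = f (s, s) - (LBINT u:{t..s}. g (s, u))"
  using primitive_onD[OF snd_primitiveD(3)[OF assms(1)], of t t s s] assms(2) by simp

text \<open>Densities matter on the half-plane only; this lets truncated right-hand sides be
  replaced by the true ones once the truncations are known to be inactive there.\<close>

lemma fst_primitive_cong:
  assumes "fst_primitive f g" "\<And>p. p \<in> halfplane \<Longrightarrow> g p = g' p" "locally_bounded g'"
  shows "fst_primitive f g'"
  unfolding fst_primitive_def
  using assms(2) by (auto intro!: primitive_on_cong[OF fst_primitiveD(3)[OF assms(1)]]
      fst_primitiveD(1)[OF assms(1)] assms(3) borel_measurable_slice locally_bounded_measurable simp: halfplane_def)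

lemma snd_primitive_cong:
  assumes "snd_primitive f g" "\<And>p. p \<in> halfplane \<Longrightarrow> g p = g' p" "locally_bounded g'"
  shows "snd_primitive f g'"
  unfolding snd_primitive_def
  using assms(2) by (auto intro!: primitive_on_cong[OF snd_primitiveD(3)[OF assms(1)]]
      snd_primitiveD(1)[OF assms(1)] assms(3) borel_measurable_slice locally_bounded_measurable simp: halfplane_def)

lemma fst_primitive_minus: "fst_primitive f g \<Longrightarrow> fst_primitive (\<lambda>p. - f p) (\<lambda>p. - g p)"
  unfolding fst_primitive_def by (auto intro: locally_bounded_minus primitive_on_minus)

lemma snd_primitive_minus: "snd_primitive f g \<Longrightarrow> snd_primitive (\<lambda>p. - f p) (\<lambda>p. - g p)"
  unfolding snd_primitive_def by (auto intro: locally_bounded_minus primitive_on_minus)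

lemma fst_primitive_mult:
  assumes "fst_primitive f f'" "fst_primitive g g'"
  shows "fst_primitive (\<lambda>p. f p * g p) (\<lambda>p. f' p * g p + f p * g' p)"
proof -
  have b: "locally_bounded (\<lambda>p. f' p * g p + f p * g' p)"
    using assms by (auto intro!: locally_bounded_add locally_bounded_mult dest: fst_primitiveD)
  then show ?thesis
    unfolding fst_primitive_def using assms
    by (auto intro!: locally_bounded_mult primitive_on_mult borel_measurable_slice(2)[OF locally_bounded_measurable[OF b]]
        dest: fst_primitiveD)
qed

lemma snd_primitive_mult:
  assumes "snd_primitive f f'" "snd_primitive g g'"
  shows "snd_primitive (\<lambda>p. f p * g p) (\<lambda>p. f' p * g p + f p * g' p)"
proof -
  have b: "locally_bounded (\<lambda>p. f' p * g p + f p * g' p)"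
    using assms by (auto intro!: locally_bounded_add locally_bounded_mult dest: snd_primitiveD)
  then show ?thesis
    unfolding snd_primitive_def using assms
    by (auto intro!: locally_bounded_mult primitive_on_mult borel_measurable_slice(1)[OF locally_bounded_measurable[OF b]]
        dest: snd_primitiveD)
qed

lemma fst_primitive_compose:
  fixes \<phi> \<phi>x \<phi>y :: "real \<times> real \<Rightarrow> real"
  assumes "fst_primitive f f'" "fst_primitive g g'"
    and \<phi>: "\<And>p. (\<phi> has_derivative (\<lambda>h. \<phi>x p * fst h + \<phi>y p * snd h)) (at p)"
    and c: "continuous_on UNIV \<phi>x" "continuous_on UNIV \<phi>y"
  shows "fst_primitive (\<lambda>p. \<phi> (f p, g p)) (\<lambda>p. \<phi>x (f p, g p) * f' p + \<phi>y (f p, g p) * g' p)"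
proof -
  have c\<phi>: "continuous_on UNIV \<phi>"
    using \<phi> by (auto intro!: continuous_at_imp_continuous_on has_derivative_continuous)
  have b: "locally_bounded (\<lambda>p. \<phi>x (f p, g p) * f' p + \<phi>y (f p, g p) * g' p)"
    by (intro locally_bounded_add locally_bounded_mult locally_bounded_compose c fst_primitiveD(1,2)[OF assms(1)] fst_primitiveD(1,2)[OF assms(2)])
  show ?thesis
    unfolding fst_primitive_def
  proof (intro conjI allI b locally_bounded_compose c\<phi> fst_primitiveD(1)[OF assms(1)] fst_primitiveD(1)[OF assms(2)])
    fix s t
    show "primitive_on (\<lambda>u. \<phi> (f (u, t), g (u, t)))
      (\<lambda>u. \<phi>x (f (u, t), g (u, t)) * f' (u, t) + \<phi>y (f (u, t), g (u, t)) * g' (u, t)) t s"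
      by (rule primitive_on_compose[OF fst_primitiveD(3)[OF assms(1)] fst_primitiveD(3)[OF assms(2)], where S = UNIV])
        (use \<phi> c borel_measurable_slice(2)[OF locally_bounded_measurable[OF b]] in auto)
  qed
qed

lemma snd_primitive_compose:
  fixes \<phi> \<phi>x \<phi>y :: "real \<times> real \<Rightarrow> real"
  assumes "snd_primitive f f'" "snd_primitive g g'"
    and \<phi>: "\<And>p. (\<phi> has_derivative (\<lambda>h. \<phi>x p * fst h + \<phi>y p * snd h)) (at p)"
    and c: "continuous_on UNIV \<phi>x" "continuous_on UNIV \<phi>y"
  shows "snd_primitive (\<lambda>p. \<phi> (f p, g p)) (\<lambda>p. \<phi>x (f p, g p) * f' p + \<phi>y (f p, g p) * g' p)"
proof -
  have c\<phi>: "continuous_on UNIV \<phi>"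
    using \<phi> by (auto intro!: continuous_at_imp_continuous_on has_derivative_continuous)
  have b: "locally_bounded (\<lambda>p. \<phi>x (f p, g p) * f' p + \<phi>y (f p, g p) * g' p)"
    by (intro locally_bounded_add locally_bounded_mult locally_bounded_compose c snd_primitiveD(1,2)[OF assms(1)] snd_primitiveD(1,2)[OF assms(2)])
  show ?thesis
    unfolding snd_primitive_def
  proof (intro conjI allI b locally_bounded_compose c\<phi> snd_primitiveD(1)[OF assms(1)] snd_primitiveD(1)[OF assms(2)])
    fix s t
    show "primitive_on (\<lambda>u. \<phi> (f (s, u), g (s, u)))
      (\<lambda>u. \<phi>x (f (s, u), g (s, u)) * f' (s, u) + \<phi>y (f (s, u), g (s, u)) * g' (s, u)) t s"
      by (rule primitive_on_compose[OF snd_primitiveD(3)[OF assms(1)] snd_primitiveD(3)[OF assms(2)], where S = UNIV])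
        (use \<phi> c borel_measurable_slice(1)[OF locally_bounded_measurable[OF b]] in auto)
  qed
qed

lemma triangle_Fubini:
  assumes R: "locally_bounded R" and "b \<le> a"
  shows "(LBINT s:{b..a}. LBINT t:{b..s}. R (s, t)) = (LBINT t:{b..a}. LBINT s:{t..a}. R (s, t))"
proof -
  define T where "T = {p :: real \<times> real. b \<le> snd p \<and> snd p \<le> fst p \<and> fst p \<le> a}"
  have [measurable]: "R \<in> borel_measurable (borel \<Otimes>\<^sub>M borel)"
    using locally_bounded_measurable[OF R] by (simp add: borel_prod)
  have "closed T"
    unfolding T_def by (intro closed_Collect_conj closed_Collect_le continuous_intros)
  then have T[measurable]: "T \<in> sets borel" by simp
  obtain B where B: "\<And>s t. - (\<bar>a\<bar> + \<bar>b\<bar>) \<le> t \<Longrightarrow> t \<le> s \<Longrightarrow> s \<le> \<bar>a\<bar> + \<bar>b\<bar> \<Longrightarrow> \<bar>R (s, t)\<bar> \<le> B"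
    using locally_boundedE[OF R] by metis
  have sub: "T \<subseteq> cbox (b, b) (a, a)" unfolding T_def by (auto simp: cbox_Pair_iff)
  have "integrable lborel (\<lambda>p. indicator T p *\<^sub>R R p)"
  proof (rule integrableI_bounded_set_indicator[where B = B])
    show "emeasure lborel T < \<infinity>"
      using emeasure_mono[OF sub, of lborel] emeasure_lborel_cbox_finite[of "(b,b)" "(a,a)"] by (auto simp: less_top top_unique)
    show "AE p in lborel. p \<in> T \<longrightarrow> norm (R p) \<le> B"
      using B by (auto simp: T_def)
  qed (use locally_bounded_measurable[OF R] in auto)
  then have int: "integrable (lborel \<Otimes>\<^sub>M lborel) (\<lambda>(s, t). indicator T (s, t) *\<^sub>R R (s, t))"
    unfolding lborel_prod by (simp add: split_beta')
  have "(LBINT s:{b..a}. LBINT t:{b..s}. R (s, t)) = (LINT s|lborel. LINT t|lborel. indicator T (s, t) *\<^sub>R R (s, t))"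
    unfolding set_lebesgue_integral_def 
  proof (intro Bochner_Integration.integral_cong refl)
    fix s :: real
    show "indicator {b..a} s *\<^sub>R (LINT t|lborel. indicator {b..s} t *\<^sub>R R (s, t)) = (LINT t|lborel. indicator T (s, t) *\<^sub>R R (s, t))"
      unfolding integral_scaleR_right[symmetric]
      by (intro Bochner_Integration.integral_cong) (auto simp: T_def indicator_def)
  qed
  also have "\<dots> = (LINT t|lborel. LINT s|lborel. indicator T (s, t) *\<^sub>R R (s, t))"
    using lborel_pair.Fubini_integral[OF int] by simp
  also have "\<dots> = (LBINT t:{b..a}. LBINT s:{t..a}. R (s, t))"
    unfolding set_lebesgue_integral_def
  proof (intro Bochner_Integration.integral_cong refl)
    fix t :: real
    show "(LINT s|lborel. indicator T (s, t) *\<^sub>R R (s, t)) = indicator {b..a} t *\<^sub>R (LINT s|lborel. indicator {t..a} s *\<^sub>R R (s, t))"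
      unfolding integral_scaleR_right[symmetric]
      by (intro Bochner_Integration.integral_cong) (auto simp: T_def indicator_def)
  qed
  finally show ?thesis .
qed

text \<open>The form \<open>A d\<alpha> + B d\<beta>\<close> with \<open>A\<^sub>\<beta> = B\<^sub>\<alpha>\<close> is closed, so its integrals over
  the two legs of a characteristic triangle add up to the integral over the diagonal.\<close>

lemma closed_form_triangle:
  assumes A: "snd_primitive A R" and B: "fst_primitive B R" and ba: "b \<le> a"
  shows "(LBINT s:{b..a}. A (s, b)) + (LBINT t:{b..a}. B (a, t)) = (LBINT s:{b..a}. A (s, s) + B (s, s))"
proof -
  note R = snd_primitiveD(2)[OF A]
  note Ab = snd_primitiveD(1)[OF A] and Bb = fst_primitiveD(1)[OF B]
  have Am: "A \<in> borel_measurable borel" and Bm: "B \<in> borel_measurable borel" and Rm: "R \<in> borel_measurable borel"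
    using Ab Bb R by (auto dest: locally_bounded_measurable)
  have diag: "(\<lambda>s::real. f (s, s)) \<in> borel_measurable borel" if "f \<in> borel_measurable borel" for f :: "real \<times> real \<Rightarrow> real"
    by (rule measurable_compose[OF _ that]) simp
  obtain CA where CA: "\<And>s t. - (\<bar>a\<bar> + \<bar>b\<bar>) \<le> t \<Longrightarrow> t \<le> s \<Longrightarrow> s \<le> \<bar>a\<bar> + \<bar>b\<bar> \<Longrightarrow> \<bar>A (s, t)\<bar> \<le> CA" using locally_boundedE[OF Ab] by metis
  obtain CB where CB: "\<And>s t. - (\<bar>a\<bar> + \<bar>b\<bar>) \<le> t \<Longrightarrow> t \<le> s \<Longrightarrow> s \<le> \<bar>a\<bar> + \<bar>b\<bar> \<Longrightarrow> \<bar>B (s, t)\<bar> \<le> CB" using locally_boundedE[OF Bb] by metis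
  have iA: "set_integrable lborel {b..a} (\<lambda>s. A (s, s))" "set_integrable lborel {b..a} (\<lambda>s. A (s, b))"
    by (rule set_integrable_bounded_Icc[where B = CA]; use CA ba diag[OF Am] borel_measurable_slice[OF Am] in force)+
  have iB: "set_integrable lborel {b..a} (\<lambda>s. B (s, s))" "set_integrable lborel {b..a} (\<lambda>s. B (a, s))"
    by (rule set_integrable_bounded_Icc[where B = CB]; use CB ba diag[OF Bm] borel_measurable_slice[OF Bm] in force)+
  have "(LBINT s:{b..a}. A (s, s)) - (LBINT s:{b..a}. A (s, b)) = (LBINT s:{b..a}. A (s, s) - A (s, b))"
    using iA by simp
  \<comment> \<open>The change of \<open>A\<close> from the lower leg to the diagonal and that of
    \<open>B\<close> from the diagonal to the other leg are double integrals of the common mixed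
    derivative \<open>R\<close> over the same triangle.\<close>
  also have "\<dots> = (LBINT s:{b..a}. LBINT t:{b..s}. R (s, t))"
  proof (intro set_lebesgue_integral_cong allI impI)
    fix s assume "s \<in> {b..a}"
    then show "A (s, s) - A (s, b) = (LBINT t:{b..s}. R (s, t))"
      using snd_primitive_eq[OF A, of b s] by simp
  qed simp
  also have "\<dots> = (LBINT t:{b..a}. LBINT s:{t..a}. R (s, t))"
    by (rule triangle_Fubini[OF R ba])
  also have "\<dots> = (LBINT t:{b..a}. B (a, t) - B (t, t))"
  proof (intro set_lebesgue_integral_cong allI impI)
    fix t assume "t \<in> {b..a}"
    then show "(LBINT s:{t..a}. R (s, t)) = B (a, t) - B (t, t)"
      using fst_primitive_eq[OF B, of t a] by simp
  qed simp
  also have "\<dots> = (LBINT t:{b..a}. B (a, t)) - (LBINT t:{b..a}. B (t, t))"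
    using iB by simp
  finally show ?thesis
    using iA iB by simp
qed

subsection \<open>The system in characteristic coordinates\<close>

text \<open>Boundedness is included because it makes Lipschitz functions closed under products.
  Polynomial right-hand sides of truncated unknowns thereby become globally Lipschitz, as the Picard
  scheme demands.\<close>

definition bounded_lipschitz :: "('a::metric_space \<Rightarrow> real) \<Rightarrow> bool"
  where "bounded_lipschitz f \<longleftrightarrow> (\<exists>B. \<forall>x. \<bar>f x\<bar> \<le> B) \<and> (\<exists>C. C-lipschitz_on UNIV f)"

lemma bounded_lipschitz_const: "bounded_lipschitz (\<lambda>x. c)"
  unfolding bounded_lipschitz_def by (auto intro: lipschitz_on_constant)

lemma bounded_lipschitz_add:
  assumes "bounded_lipschitz f" "bounded_lipschitz g"
  shows "bounded_lipschitz (\<lambda>x. f x + g x)"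
proof -
  obtain B B' C C' where "\<And>x. \<bar>f x\<bar> \<le> B" "\<And>x. \<bar>g x\<bar> \<le> B'" "C-lipschitz_on UNIV f" "C'-lipschitz_on UNIV g"
    using assms unfolding bounded_lipschitz_def by blast
  then show ?thesis
    unfolding bounded_lipschitz_def
    by (intro conjI exI[of _ "B + B'"] exI[of _ "C + C'"] allI order_trans[OF abs_triangle_ineq] add_mono lipschitz_on_add)
qed

lemma bounded_lipschitz_mult:
  assumes "bounded_lipschitz f" "bounded_lipschitz g"
  shows "bounded_lipschitz (\<lambda>x. f x * g x)"
proof -
  obtain B B' C C' where B: "\<And>x. \<bar>f x\<bar> \<le> B" and B': "\<And>x. \<bar>g x\<bar> \<le> B'"
    and C: "C-lipschitz_on UNIV f" and C': "C'-lipschitz_on UNIV g"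
    using assms unfolding bounded_lipschitz_def by blast
  have pos: "B \<ge> 0" "B' \<ge> 0" using B B' by (meson abs_ge_zero order_trans)+
  have cpos: "C \<ge> 0" "C' \<ge> 0" using C C' by (auto dest: lipschitz_on_nonneg)
  have "(B * C' + B' * C)-lipschitz_on UNIV (\<lambda>x. f x * g x)"
  proof (rule lipschitz_onI)
    fix x y
    have "f x * g x - f y * g y = f x * (g x - g y) + g y * (f x - f y)"
      by (simp add: algebra_simps)
    then have "dist (f x * g x) (f y * g y) \<le> \<bar>f x\<bar> * \<bar>g x - g y\<bar> + \<bar>g y\<bar> * \<bar>f x - f y\<bar>"
      unfolding dist_real_def by (metis abs_mult abs_triangle_ineq)
    also have "\<dots> \<le> B * (C' * dist x y) + B' * (C * dist x y)"
      using lipschitz_onD[OF C] lipschitz_onD[OF C'] B B' pos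
      by (intro add_mono mult_mono) (auto simp: dist_real_def)
    finally show "dist (f x * g x) (f y * g y) \<le> (B * C' + B' * C) * dist x y"
      by (simp add: algebra_simps)
  qed (use pos cpos in simp)
  moreover have "\<bar>f x * g x\<bar> \<le> B * B'" for x
    unfolding abs_mult using B B' pos by (intro mult_mono) auto
  ultimately show ?thesis
    unfolding bounded_lipschitz_def by blast
qed

lemma bounded_lipschitz_minus: "bounded_lipschitz f \<Longrightarrow> bounded_lipschitz (\<lambda>x. - f x)"
  unfolding bounded_lipschitz_def by auto

lemma bounded_lipschitz_compose:
  assumes "bounded_lipschitz f" "C-lipschitz_on UNIV g"
  shows "bounded_lipschitz (\<lambda>x. f (g x))"
proof -
  obtain B D where B: "\<And>x. \<bar>f x\<bar> \<le> B" and D: "D-lipschitz_on UNIV f"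
    using assms(1) unfolding bounded_lipschitz_def by blast
  have "(D * C)-lipschitz_on UNIV (\<lambda>x. f (g x))"
    by (rule lipschitz_on_compose2[OF assms(2) lipschitz_on_subset[OF D]]) simp
  then show ?thesis unfolding bounded_lipschitz_def using B by blast
qed

lemma lipschitz_on_fst: "C-lipschitz_on U g \<Longrightarrow> C-lipschitz_on U (\<lambda>x. fst (g x))"
  unfolding lipschitz_on_def by (meson dist_fst_le order_trans)

lemma lipschitz_on_snd: "C-lipschitz_on U g \<Longrightarrow> C-lipschitz_on U (\<lambda>x. snd (g x))"
  unfolding lipschitz_on_def by (meson dist_snd_le order_trans)

definition clip :: "real \<Rightarrow> real \<Rightarrow> real \<Rightarrow> real"
  where "clip lo hi r = max lo (min hi r)"

lemma clip_bounds: "lo \<le> hi \<Longrightarrow> lo \<le> clip lo hi r" "lo \<le> hi \<Longrightarrow> clip lo hi r \<le> hi"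
  by (auto simp: clip_def)

lemma clip_id: "lo \<le> r \<Longrightarrow> r \<le> hi \<Longrightarrow> clip lo hi r = r"
  by (auto simp: clip_def)

lemma lipschitz_on_clip: "1-lipschitz_on UNIV (clip lo hi)"
  by (rule lipschitz_onI) (auto simp: clip_def dist_real_def max_def min_def)

lemma bounded_lipschitz_clip: "bounded_lipschitz (clip lo hi)"
proof -
  have "\<bar>clip lo hi r\<bar> \<le> \<bar>lo\<bar> + \<bar>hi\<bar>" for r
    by (auto simp: clip_def max_def min_def)
  then show ?thesis
    unfolding bounded_lipschitz_def using lipschitz_on_clip by blast
qed

lemma locally_bounded_lipschitz_compose:
  assumes "bounded_lipschitz f" "Z \<in> borel_measurable borel"
  shows "locally_bounded (\<lambda>p. f (Z p))"
proof -
  obtain B C where B: "\<And>x. \<bar>f x\<bar> \<le> B" and C: "C-lipschitz_on UNIV f"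
    using assms(1) unfolding bounded_lipschitz_def by blast
  have "f \<in> borel_measurable borel"
    using C by (auto intro: borel_measurable_continuous_onI lipschitz_on_continuous_on)
  then show ?thesis
    using B measurable_compose[OF assms(2)] by (intro locally_boundedI) blast+
qed

text \<open>Used with coordinate projections, to split the vector-valued integral equation into its
  scalar components.\<close>

lemma set_integral_bounded_linear:
  assumes "bounded_linear T" "set_integrable M S h"
  shows "T (LINT t:S|M. h t) = (LINT t:S|M. T (h t))"
proof -
  interpret T: bounded_linear T by fact
  show ?thesis
    using integral_bounded_linear[OF assms(1) assms(2)[unfolded set_integrable_def]]
    unfolding set_lebesgue_integral_def by (simp add: T.scaleR)
qed

lemma set_integral_singleton_Icc: "(LBINT u:{s..s :: real}. (g u :: real)) = 0"
  unfolding set_lebesgue_integral_def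
  by (rule integral_eq_zero_AE) (use AE_lborel_singleton[of s] in eventually_elim, auto simp: indicator_def)

text \<open>A Gronwall estimate in the variable \<open>y\<close>: the hypothesis says that ln f +
  \<sigma> H G(y) has nonnegative and ln f - \<sigma> H G(y) nonpositive density. The bound sees the
  interval only through the increment of \<open>G\<close>, so it does not deteriorate with length
  when \<open>G\<close> stays bounded. The sign \<sigma> allows for a decreasing
  \<open>y\<close>.\<close>

lemma ln_primitive_bound:
  assumes f: "primitive_on f f' a b" and y: "primitive_on y y' a b" and ab: "a \<le> b"
    and G: "\<And>r. (G has_real_derivative g r) (at r)" "continuous_on UNIV g"
    and pos: "\<And>u. u \<in> {a..b} \<Longrightarrow> f u > 0"
    and f': "\<And>u. u \<in> {a..b} \<Longrightarrow> \<bar>f' u\<bar> \<le> H * g (y u) * (\<sigma> * y' u) * f u"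
  shows "\<bar>ln (f b) - ln (f a)\<bar> \<le> \<sigma> * H * (G (y b) - G (y a))"
proof -
  have key: "ln (f b) + k * G (y b) - (ln (f a) + k * G (y a)) = (LBINT u:{a..b}. 1 / f u * f' u + k * g (y u) * y' u)" for k
  proof -
    have "(\<lambda>r. ln (fst r) + k * G (snd r)) (f b, y b) - (\<lambda>r. ln (fst r) + k * G (snd r)) (f a, y a) =
        (LBINT u:{a..b}. (\<lambda>r. 1 / fst r) (f u, y u) * f' u + (\<lambda>r. k * g (snd r)) (f u, y u) * y' u)"
    proof (rule chain_rule_primitive[OF f y, where S = "{0<..} \<times> UNIV"])
      fix r :: "real \<times> real" assume r: "r \<in> {0<..} \<times> UNIV"
      have "((\<lambda>r. G (snd r)) has_derivative (\<lambda>h. g (snd r) * snd h)) (at r within {0<..} \<times> UNIV)"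
        using has_derivative_compose[OF has_derivative_snd[OF has_derivative_ident] G(1)[unfolded has_field_derivative_def], of r "{0<..} \<times> UNIV"] by simp
      then show "((\<lambda>r. ln (fst r) + k * G (snd r)) has_derivative (\<lambda>h. (1 / fst r) * fst h + (k * g (snd r)) * snd h)) (at r within {0<..} \<times> UNIV)"
        using r by (auto intro!: derivative_eq_intros simp: field_simps)
    next
      show "continuous_on ({0<..} \<times> UNIV) (\<lambda>r :: real \<times> real. 1 / fst r)"
        "continuous_on ({0<..} \<times> UNIV) (\<lambda>r :: real \<times> real. k * g (snd r))"
        by (auto intro!: continuous_intros continuous_on_compose2[OF G(2)])
    qed (use pos ab in auto)
    then show ?thesis by simp
  qed
  have f'': "\<bar>1 / f u * f' u\<bar> \<le> \<sigma> * H * g (y u) * y' u" if "u \<in> {a..b}" for u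
    using f'[OF that] pos[OF that] by (simp add: abs_mult divide_le_eq mult_ac)
  have nn: "0 \<le> (LBINT u:{a..b}. g u)" if "\<And>u. u \<in> {a..b} \<Longrightarrow> 0 \<le> g u" for g :: "real \<Rightarrow> real"
    unfolding set_lebesgue_integral_def using that by (intro Bochner_Integration.integral_nonneg) (auto simp: indicator_def)
  have 1: "0 \<le> (LBINT u:{a..b}. 1 / f u * f' u + (\<sigma> * H) * g (y u) * y' u)"
  proof (rule nn)
    fix u assume "u \<in> {a..b}"
    from f''[OF this] show "0 \<le> 1 / f u * f' u + (\<sigma> * H) * g (y u) * y' u" by linarith
  qed
  have "0 \<le> (LBINT u:{a..b}. - (1 / f u * f' u + (- (\<sigma> * H)) * g (y u) * y' u))"
  proof (rule nn)
    fix u assume "u \<in> {a..b}"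
    from abs_le_D1[OF f''[OF this]] show "0 \<le> - (1 / f u * f' u + (- (\<sigma> * H)) * g (y u) * y' u)"
      unfolding mult_minus_left by linarith
  qed
  then have 2: "0 \<le> - (LBINT u:{a..b}. 1 / f u * f' u + (- (\<sigma> * H)) * g (y u) * y' u)"
    by (simp only: set_lebesgue_integral_def scaleR_minus_right Bochner_Integration.integral_minus)
  show ?thesis
    using 1 2 unfolding key[symmetric] by (simp add: abs_le_iff algebra_simps)
qed

text \<open>The data of the reduced problem. The functions \<open>w = u + v\<close> and \<open>z = u - v\<close> are the Riemann
  invariants; they satisfy \<open>w\<^sub>y + z w\<^sub>x = a rate_w\<close> and \<open>z\<^sub>y + w z\<^sub>x = a rate_z\<close> with \<open>a = - E' / (2 E)\<close>
  and \<open>\<kappa> = \<beta>\<^sup>2 - 2\<close>. The choice \<open>\<delta> W = c (1 + \<kappa>)\<close> makes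
  \<open>[\<delta>, W] \<times> [-W, -\<delta>]\<close> an invariant region.\<close>

locale characteristic_data =
  fixes y0 c \<kappa> \<delta> W Amax Imax :: real and a A w0 z0 :: "real \<Rightarrow> real"
  assumes c: "c > 0" and \<kappa>: "\<kappa> \<ge> 0" and \<delta>: "\<delta> > 0" "\<delta> \<le> W" and \<delta>W: "\<delta> * W = c * (1 + \<kappa>)"
    and a_lip: "\<exists>C. C-lipschitz_on UNIV a" and a_nonneg: "\<And>y. 0 \<le> a y" and a_le: "\<And>y. a y \<le> Amax"
    and A: "\<And>y. (A has_real_derivative a y) (at y)" and A_init: "A (- y0) = 0" and A_le: "\<And>y. A y \<le> Imax"
    and w0_m: "w0 \<in> borel_measurable borel" and z0_m: "z0 \<in> borel_measurable borel"
    and w0: "\<And>s. \<delta> \<le> w0 s" "\<And>s. w0 s \<le> W" and z0: "\<And>s. - W \<le> z0 s" "\<And>s. z0 s \<le> - \<delta>"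
begin

definition rate_w :: "real \<Rightarrow> real \<Rightarrow> real"
  where "rate_w w z = w * (1 + w * z / c) + \<kappa> * (w - z) / 2"

definition rate_z :: "real \<Rightarrow> real \<Rightarrow> real"
  where "rate_z w z = z * (1 + w * z / c) - \<kappa> * (w - z) / 2"

text \<open>This is the quotient (rate_w - rate_z) / (w - z), the one value for which the two
  expressions for the mixed derivative of \<open>x\<close> agree.\<close>

definition rate_p :: "real \<Rightarrow> real \<Rightarrow> real"
  where "rate_p w z = 1 + \<kappa> + w * z / c"

lemma W: "W > 0"
  using \<delta> by simp

lemma rate_diff: "rate_w w z - rate_z w z = (w - z) * rate_p w z"
  using c by (simp add: rate_w_def rate_z_def rate_p_def field_simps)

text \<open>The reflection (w, z) to (-z, -w) preserves the box and exchanges the two families, so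
  wall estimates are needed for \<open>rate_w\<close> only.\<close>

lemma rate_z_conv_rate_w: "rate_z w z = - rate_w (- z) (- w)"
  using c by (simp add: rate_w_def rate_z_def field_simps)

text \<open>Eliminates \<open>c\<close> in favour of the box; the rates on the walls then become
  sums of terms of one sign.\<close>

lemma divide_c: "u / c = (1 + \<kappa>) * u / (\<delta> * W)"
proof -
  have "1 + \<kappa> \<noteq> 0" using \<kappa> by simp
  then show ?thesis unfolding \<delta>W by simp
qed

text \<open>Multiplied by \<open>W\<close>, the rate splits into products of nonnegative factors,
  with coefficient \<kappa> in the second group. At the corner z = -W only \<kappa> W (W - \<delta>)
  / 2 survives, so both the sign of \<kappa> and the value of \<delta> W are essential here.\<close>

lemma rate_w_lower:
  assumes "- W \<le> z" "z \<le> - \<delta>"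
  shows "rate_w \<delta> z \<ge> 0"
proof -
  have "W * rate_w \<delta> z = \<delta> * (W + z) + \<kappa> * ((- z) * (W - \<delta>) + \<delta> * (W + z)) / 2"
    unfolding rate_w_def divide_c using \<delta> W \<kappa> by (simp add: field_simps)
  also have "\<dots> \<ge> 0"
  proof -
    have 1: "0 \<le> \<delta> * (W + z)" and 2: "0 \<le> (- z) * (W - \<delta>)"
      using assms \<delta> by (auto intro!: mult_nonneg_nonneg mult_nonpos_nonneg)
    show ?thesis
      by (intro add_nonneg_nonneg[OF 1] divide_nonneg_nonneg mult_nonneg_nonneg[OF \<kappa>] add_nonneg_nonneg[OF 2 1]) simp
  qed
  finally show ?thesis using W by (simp add: zero_le_mult_iff)
qed

lemma rate_w_upper:
  assumes "- W \<le> z" "z \<le> - \<delta>"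
  shows "rate_w W z \<le> 0"
proof -
  have "\<delta> * (- rate_w W z) = W * (- z - \<delta>) + \<kappa> * (W * (- z - \<delta>) + (- z) * (W - \<delta>)) / 2"
    unfolding rate_w_def divide_c using \<delta> W \<kappa> by (simp add: field_simps)
  also have "\<dots> \<ge> 0"
  proof -
    have 1: "0 \<le> W * (- z - \<delta>)" and 2: "0 \<le> (- z) * (W - \<delta>)"
      using assms \<delta> by (auto intro!: mult_nonneg_nonneg mult_nonpos_nonneg)
    show ?thesis
      by (intro add_nonneg_nonneg[OF 1] divide_nonneg_nonneg mult_nonneg_nonneg[OF \<kappa>] add_nonneg_nonneg[OF 1 2]) simp
  qed
  finally show ?thesis using \<delta> by (simp add: mult_le_0_iff)
qed

lemma abs_rate_p:
  assumes "\<delta> \<le> w" "w \<le> W" "- W \<le> z" "z \<le> - \<delta>"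
  shows "\<bar>rate_p w z\<bar> \<le> 1 + \<kappa> + W\<^sup>2 / c"
proof -
  have "\<bar>w * z\<bar> \<le> W * W"
    unfolding abs_mult using assms \<delta> by (intro mult_mono) auto
  then have "\<bar>w * z / c\<bar> \<le> W\<^sup>2 / c"
    using c by (simp add: abs_divide power2_eq_square divide_right_mono)
  then show ?thesis unfolding rate_p_def using \<kappa> by linarith
qed

lemma a_continuous: "continuous_on UNIV a"
  using a_lip by (auto intro: lipschitz_on_continuous_on)

lemma a_bounded_lipschitz: "bounded_lipschitz a"
  unfolding bounded_lipschitz_def using a_lip a_nonneg a_le by (auto intro!: exI[of _ Amax])

end

text \<open>In characteristic coordinates \<open>(\<alpha>, \<beta>)\<close>, along which \<open>dx = w dy\<close> resp. \<open>dx = z dy\<close>, all of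
  \<open>x\<close>, \<open>y\<close>, \<open>w\<close>, \<open>z\<close> become unknowns, with \<open>p = y\<^sub>\<alpha>\<close> and \<open>q = - y\<^sub>\<beta>\<close>. The equations for \<open>p\<close> and \<open>q\<close>
  both say \<open>y\<^sub>\<alpha>\<^sub>\<beta> = a rate_p p q\<close>; this is the compatibility of the two equations for \<open>x\<close>.\<close>

locale characteristic_solution = characteristic_data +
  fixes w z p q x y :: "real \<times> real \<Rightarrow> real" and m M :: real
  assumes w_snd: "snd_primitive w (\<lambda>r. - (a (y r) * rate_w (w r) (z r) * q r))"
    and z_fst: "fst_primitive z (\<lambda>r. a (y r) * rate_z (w r) (z r) * p r)"
    and p_snd: "snd_primitive p (\<lambda>r. a (y r) * rate_p (w r) (z r) * p r * q r)"
    and q_fst: "fst_primitive q (\<lambda>r. - (a (y r) * rate_p (w r) (z r) * p r * q r))"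
    and y_fst: "fst_primitive y p" and y_snd: "snd_primitive y (\<lambda>r. - q r)"
    and x_fst: "fst_primitive x (\<lambda>r. w r * p r)" and x_snd: "snd_primitive x (\<lambda>r. - (z r * q r))"
    and w_init: "\<And>s. w (s, s) = w0 s" and z_init: "\<And>s. z (s, s) = z0 s"
    and p_init: "\<And>s. p (s, s) = 1 / (w0 s - z0 s)" and q_init: "\<And>s. q (s, s) = 1 / (w0 s - z0 s)"
    and y_init: "\<And>s. y (s, s) = - y0" and x_init: "\<And>s. x (s, s) = s"
    and w_bounds: "\<And>r. r \<in> halfplane \<Longrightarrow> \<delta> \<le> w r \<and> w r \<le> W"
    and z_bounds: "\<And>r. r \<in> halfplane \<Longrightarrow> - W \<le> z r \<and> z r \<le> - \<delta>"
    and p_bounds: "\<And>r. r \<in> halfplane \<Longrightarrow> m \<le> p r \<and> p r \<le> M"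
    and q_bounds: "\<And>r. r \<in> halfplane \<Longrightarrow> m \<le> q r \<and> q r \<le> M"
    and m: "m > 0"

context characteristic_data
begin

text \<open>The form w p d\<alpha> - z q d\<beta>, which is to be dx, is closed: the product rule in
  either direction yields the same density by \<open>rate_diff\<close>. This serves both to
  construct \<open>x\<close> and to compute areas.\<close>

lemma mixed_derivative_x:
  assumes w: "snd_primitive w (\<lambda>r. - (a (y r) * rate_w (w r) (z r) * q r))"
    and z: "fst_primitive z (\<lambda>r. a (y r) * rate_z (w r) (z r) * p r)"
    and p: "snd_primitive p (\<lambda>r. a (y r) * rate_p (w r) (z r) * p r * q r)"
    and q: "fst_primitive q (\<lambda>r. - (a (y r) * rate_p (w r) (z r) * p r * q r))"
  shows "\<exists>R. snd_primitive (\<lambda>r. w r * p r) R \<and> fst_primitive (\<lambda>r. - z r * q r) R"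
proof -
  define R where "R = (\<lambda>r. - (a (y r) * rate_w (w r) (z r) * q r) * p r + w r * (a (y r) * rate_p (w r) (z r) * p r * q r))"
  have R: "R r = - (a (y r) * rate_z (w r) (z r) * p r) * q r + (- z r) * - (a (y r) * rate_p (w r) (z r) * p r * q r)" for r
  proof -
    have "R r - (- (a (y r) * rate_z (w r) (z r) * p r) * q r + (- z r) * - (a (y r) * rate_p (w r) (z r) * p r * q r))
        = a (y r) * p r * q r * ((w r - z r) * rate_p (w r) (z r) - (rate_w (w r) (z r) - rate_z (w r) (z r)))"
      by (simp add: R_def algebra_simps)
    then show ?thesis by (simp add: rate_diff)
  qed
  have "snd_primitive (\<lambda>r. w r * p r) R"
    unfolding R_def by (rule snd_primitive_mult[OF w p])
  moreover have "fst_primitive (\<lambda>r. - z r * q r) R"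
    unfolding R[abs_def] by (rule fst_primitive_mult[OF fst_primitive_minus[OF z] q])
  ultimately show ?thesis by blast
qed

text \<open>Solve the system with all unknowns but \<open>y\<close> cut off, then show that the cut-offs are inactive:
  for \<open>w\<close> and \<open>z\<close> by the invariant region, for \<open>p\<close> and \<open>q\<close> by moving away from the diagonal in small
  steps, since \<open>ln p\<close> and \<open>ln q\<close> are controlled by the antiderivative \<open>A\<close> of \<open>a\<close> at \<open>y\<close>.\<close>

lemma characteristic_solution_exists:
  "\<exists>w z p q x y m M. characteristic_solution y0 c \<kappa> \<delta> W Amax Imax a A w0 z0 w z p q x y m M"
proof -
  define Hm where "Hm = 1 + \<kappa> + W\<^sup>2 / c"
  have Hm: "Hm > 0" using \<kappa> c by (auto simp: Hm_def intro!: add_pos_nonneg)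
  have Imax: "Imax \<ge> 0" using A_le[of "- y0"] A_init by simp
  have Amax: "Amax \<ge> 0" using a_le[of 0] a_nonneg[of 0] by linarith
  \<comment> \<open>On the diagonal \<open>p\<close> and \<open>q\<close> lie between
    \<open>1 / (2 * W)\<close> and \<open>1 / (2 * \<delta>)\<close>, and their logarithms change by
    at most \<open>Hm * Imax\<close>. The additional factor 2 on either side is slack for the
    continuation argument.\<close>
  define m where "m = exp (- (Hm * Imax)) / (4 * W)"
  define M where "M = exp (Hm * Imax) / \<delta>"
  have m: "m > 0" using W by (simp add: m_def)
  have mM: "2 * m \<le> M / 2"
  proof -
    have "exp (- (Hm * Imax)) \<le> exp (Hm * Imax)"
      using Hm Imax by simp
    then show ?thesis
      unfolding m_def M_def using \<delta> W by (simp add: frac_le)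
  qed
  have mM': "m \<le> M" using m mM by linarith
  \<comment> \<open>Differentiating x(s, s) = s and y(s, s) = -y0 along the diagonal gives w p - z q
    = 1 and p = q, hence this common initial value.\<close>
  define r0 where "r0 = (\<lambda>s. 1 / (w0 s - z0 s))"
  have r0: "1 / (2 * W) \<le> r0 s" "r0 s \<le> 1 / (2 * \<delta>)" "r0 s > 0" for s
    unfolding r0_def using w0[of s] z0[of s] \<delta> by (auto intro!: divide_left_mono mult_pos_pos)
  \<comment> \<open>The vector of unknowns is ((w, p, y), (z, q)): the first block is integrated in
    the second coordinate, the second block in the first. \<open>y\<close> needs no truncation since
    it enters only through the bounded Lipschitz function \<open>a\<close>.\<close>
  define cw where "cw = (\<lambda>v :: (real \<times> real \<times> real) \<times> (real \<times> real). clip \<delta> W (fst (fst v)))"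
  define cp where "cp = (\<lambda>v :: (real \<times> real \<times> real) \<times> (real \<times> real). clip m M (fst (snd (fst v))))"
  define ay where "ay = (\<lambda>v :: (real \<times> real \<times> real) \<times> (real \<times> real). a (snd (snd (fst v))))"
  define cz where "cz = (\<lambda>v :: (real \<times> real \<times> real) \<times> (real \<times> real). clip (- W) (- \<delta>) (fst (snd v)))"
  define cq where "cq = (\<lambda>v :: (real \<times> real \<times> real) \<times> (real \<times> real). clip m M (snd (snd v)))"
  have idl: "1-lipschitz_on UNIV (\<lambda>v :: (real \<times> real \<times> real) \<times> (real \<times> real). v)"
    by (rule lipschitz_on_id)
  have bl: "bounded_lipschitz cw" "bounded_lipschitz cp" "bounded_lipschitz ay" "bounded_lipschitz cz" "bounded_lipschitz cq"
    unfolding cw_def cp_def ay_def cz_def cq_def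
    by (rule bounded_lipschitz_compose[OF bounded_lipschitz_clip lipschitz_on_fst[OF lipschitz_on_fst[OF idl]]]
        bounded_lipschitz_compose[OF bounded_lipschitz_clip lipschitz_on_fst[OF lipschitz_on_snd[OF lipschitz_on_fst[OF idl]]]]
        bounded_lipschitz_compose[OF a_bounded_lipschitz lipschitz_on_snd[OF lipschitz_on_snd[OF lipschitz_on_fst[OF idl]]]]
        bounded_lipschitz_compose[OF bounded_lipschitz_clip lipschitz_on_fst[OF lipschitz_on_snd[OF idl]]]
        bounded_lipschitz_compose[OF bounded_lipschitz_clip lipschitz_on_snd[OF lipschitz_on_snd[OF idl]]])+
  define hw where "hw = (\<lambda>v. ay v * rate_w (cw v) (cz v) * cq v)"
  define hz where "hz = (\<lambda>v. ay v * rate_z (cw v) (cz v) * cp v)"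
  define hp where "hp = (\<lambda>v. ay v * rate_p (cw v) (cz v) * cp v * cq v)"
  have h_bl: "bounded_lipschitz hw" "bounded_lipschitz hz" "bounded_lipschitz hp"
    unfolding hw_def hz_def hp_def rate_w_def rate_z_def rate_p_def divide_inverse diff_conv_add_uminus
    by (intro bounded_lipschitz_mult bounded_lipschitz_add bounded_lipschitz_minus bounded_lipschitz_const bl)+
  \<comment> \<open>The integrals of \<open>H1\<close> run from the point up to the diagonal, so its
    signs are opposite to those of the derivatives in the second coordinate. The last entry is the
    untruncated \<open>q\<close>, which keeps y_\<beta> = -q exact from the outset.\<close>
  define H1 where "H1 = (\<lambda>v. (hw v, - hp v, snd (snd v)))"
  define H2 where "H2 = (\<lambda>v. (hz v, - hp v))"
  obtain C1 C2 C3 where C: "C1-lipschitz_on UNIV hw" "C2-lipschitz_on UNIV hz" "C3-lipschitz_on UNIV hp"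
    using h_bl unfolding bounded_lipschitz_def by blast
  have L1: "(sqrt (C1\<^sup>2 + (sqrt (C3\<^sup>2 + 1\<^sup>2))\<^sup>2))-lipschitz_on UNIV H1"
    unfolding H1_def by (intro lipschitz_on_Pair C lipschitz_on_minus lipschitz_on_snd idl)
  have L2: "(sqrt (C2\<^sup>2 + C3\<^sup>2))-lipschitz_on UNIV H2"
    unfolding H2_def by (intro lipschitz_on_Pair C lipschitz_on_minus)
  define C where "C = max (sqrt (C1\<^sup>2 + (sqrt (C3\<^sup>2 + 1\<^sup>2))\<^sup>2)) (sqrt (C2\<^sup>2 + C3\<^sup>2))"
  have lip: "C-lipschitz_on UNIV H1" "C-lipschitz_on UNIV H2"
    by (rule lipschitz_on_mono[OF L1] lipschitz_on_mono[OF L2]; simp add: C_def)+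
  define A0 where "A0 = (\<lambda>s. (w0 s, r0 s, - y0))"
  define B0 where "B0 = (\<lambda>s. (z0 s, r0 s))"
  note [measurable] = w0_m z0_m
  have r0m[measurable]: "r0 \<in> borel_measurable borel" unfolding r0_def by measurable
  have A0m: "A0 \<in> borel_measurable borel" and B0m: "B0 \<in> borel_measurable borel"
    unfolding A0_def B0_def by (intro borel_measurable_Pair; measurable)+
  define D where "D = W + 1 / (2 * \<delta>) + \<bar>y0\<bar>"
  have nw: "\<bar>w0 s\<bar> \<le> W" "\<bar>z0 s\<bar> \<le> W" "\<bar>r0 s\<bar> \<le> 1 / (2 * \<delta>)" for s
    using w0[of s] z0[of s] r0[of s] \<delta> by auto
  have D: "norm (A0 s) \<le> D" "norm (B0 s) \<le> D" for s
    using norm_Pair_le[of "w0 s" "(r0 s, - y0)"] norm_Pair_le[of "r0 s" "- y0"] norm_Pair_le[of "z0 s" "r0 s"] nw[of s]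
    unfolding A0_def B0_def D_def by auto
  obtain Z where Zm: "Z \<in> borel_measurable borel"
    and Zeq: "\<And>r. snd r \<le> fst r \<Longrightarrow> Z r =
      (A0 (fst r) + (LBINT t:{snd r..fst r}. H1 (Z (fst r, t))),
       B0 (snd r) + (LBINT s:{snd r..fst r}. H2 (Z (s, snd r))))"
    and Zb: "\<And>\<tau>. \<exists>B. \<forall>r. fst r - snd r \<le> \<tau> \<longrightarrow> norm (Z r) \<le> B"
    using characteristic_cauchy_problem[OF lip A0m B0m D] by blast
  define w where "w = (\<lambda>r. fst (fst (Z r)))"
  define p where "p = (\<lambda>r. fst (snd (fst (Z r))))"
  define y where "y = (\<lambda>r. snd (snd (fst (Z r))))"
  define z where "z = (\<lambda>r. fst (snd (Z r)))"
  define q where "q = (\<lambda>r. snd (snd (Z r)))"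
  have H1m: "H1 \<in> borel_measurable borel" and H2m: "H2 \<in> borel_measurable borel"
    using lip by (auto intro!: borel_measurable_continuous_onI lipschitz_on_continuous_on)
  have int1: "set_integrable lborel {t..s} (\<lambda>u. H1 (Z (s, u)))" and int2: "set_integrable lborel {t..s} (\<lambda>u. H2 (Z (u, t)))" for s t
  proof -
    obtain B where B: "\<And>r. fst r - snd r \<le> s - t \<Longrightarrow> norm (Z r) \<le> B" using Zb by meson
    have C0: "C \<ge> 0" using lip(1) by (rule lipschitz_on_nonneg)
    have "norm (H1 (Z r)) \<le> norm (H1 0) + C * B" "norm (H2 (Z r)) \<le> norm (H2 0) + C * B" if "fst r - snd r \<le> s - t" for r
      using lipschitz_onD[OF lip(1), of "Z r" 0] lipschitz_onD[OF lip(2), of "Z r" 0] mult_left_mono[OF B[OF that] C0]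
        norm_triangle_sub[of "H1 (Z r)" "H1 0"] norm_triangle_sub[of "H2 (Z r)" "H2 0"]
      by (auto simp: dist_norm)
    note b = this
    show "set_integrable lborel {t..s} (\<lambda>u. H1 (Z (s, u)))"
      by (rule set_integrable_bounded_Icc[OF measurable_compose[OF borel_measurable_slice(1)[OF Zm] H1m]])
        (rule b(1), simp)
    show "set_integrable lborel {t..s} (\<lambda>u. H2 (Z (u, t)))"
      by (rule set_integrable_bounded_Icc[OF measurable_compose[OF borel_measurable_slice(2)[OF Zm] H2m]])
        (rule b(2), simp)
  qed
  have bl1: "bounded_linear (\<lambda>v :: real \<times> real \<times> real. fst (snd v))" "bounded_linear (\<lambda>v :: real \<times> real \<times> real. snd (snd v))"
    using bounded_linear_compose[OF bounded_linear_fst bounded_linear_snd] bounded_linear_compose[OF bounded_linear_snd bounded_linear_snd] by blast+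
  have w_eq: "w (s, t) = w0 s + (LBINT u:{t..s}. hw (Z (s, u)))"
    and p_eq: "p (s, t) = r0 s + (LBINT u:{t..s}. - hp (Z (s, u)))"
    and y_eq: "y (s, t) = - y0 + (LBINT u:{t..s}. q (s, u))"
    and z_eq: "z (s, t) = z0 t + (LBINT u:{t..s}. hz (Z (u, t)))"
    and q_eq: "q (s, t) = r0 t + (LBINT u:{t..s}. - hp (Z (u, t)))" if "t \<le> s" for s t
  proof -
    have "Z (s, t) = (A0 s + (LBINT u:{t..s}. H1 (Z (s, u))), B0 t + (LBINT u:{t..s}. H2 (Z (u, t))))"
      using Zeq[of "(s, t)"] that by simp
    moreover have "fst (LBINT u:{t..s}. H1 (Z (s, u))) = (LBINT u:{t..s}. hw (Z (s, u)))"
      using set_integral_bounded_linear[OF bounded_linear_fst int1] by (simp add: H1_def)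
    moreover have "fst (snd (LBINT u:{t..s}. H1 (Z (s, u)))) = (LBINT u:{t..s}. - hp (Z (s, u)))"
      using set_integral_bounded_linear[OF bl1(1) int1] by (simp add: H1_def)
    moreover have "snd (snd (LBINT u:{t..s}. H1 (Z (s, u)))) = (LBINT u:{t..s}. q (s, u))"
      using set_integral_bounded_linear[OF bl1(2) int1] by (simp add: H1_def q_def)
    moreover have "fst (LBINT u:{t..s}. H2 (Z (u, t))) = (LBINT u:{t..s}. hz (Z (u, t)))"
      using set_integral_bounded_linear[OF bounded_linear_fst int2] by (simp add: H2_def)
    moreover have "snd (LBINT u:{t..s}. H2 (Z (u, t))) = (LBINT u:{t..s}. - hp (Z (u, t)))"
      using set_integral_bounded_linear[OF bounded_linear_snd int2] by (simp add: H2_def)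
    ultimately show "w (s, t) = w0 s + (LBINT u:{t..s}. hw (Z (s, u)))"
      "p (s, t) = r0 s + (LBINT u:{t..s}. - hp (Z (s, u)))"
      "y (s, t) = - y0 + (LBINT u:{t..s}. q (s, u))"
      "z (s, t) = z0 t + (LBINT u:{t..s}. hz (Z (u, t)))"
      "q (s, t) = r0 t + (LBINT u:{t..s}. - hp (Z (u, t)))"
      unfolding w_def p_def y_def z_def q_def by (simp_all add: A0_def B0_def)
  qed
  have w_init: "w (s, s) = w0 s" and p_init: "p (s, s) = r0 s" and y_init: "y (s, s) = - y0"
    and z_init: "z (s, s) = z0 s" and q_init: "q (s, s) = r0 s" for s
    by (simp_all only: w_eq p_eq y_eq z_eq q_eq order_refl set_integral_singleton_Icc add_0_right)
  have fstm: "(fst :: 'u::euclidean_space \<times> 'v::euclidean_space \<Rightarrow> 'u) \<in> borel_measurable borel"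
    and sndm: "(snd :: 'u::euclidean_space \<times> 'v::euclidean_space \<Rightarrow> 'v) \<in> borel_measurable borel"
    by (auto intro!: borel_measurable_continuous_onI continuous_intros)
  have bb: "locally_bounded w" "locally_bounded p" "locally_bounded y" "locally_bounded z" "locally_bounded q"
  proof -
    have *: "locally_bounded f" if f: "f \<in> borel_measurable borel" "\<And>r. \<bar>f r\<bar> \<le> norm (Z r)" for f
    proof (rule locally_boundedI[OF f(1)])
      fix \<tau>
      obtain B where "\<And>r. fst r - snd r \<le> 2 * \<tau> \<Longrightarrow> norm (Z r) \<le> B" using Zb by meson
      then have "\<bar>f (s, t)\<bar> \<le> B" if "- \<tau> \<le> t" "s \<le> \<tau>" for s t
        using order_trans[OF f(2)[of "(s, t)"]] that by simp
      then show "\<exists>B. \<forall>s t. - \<tau> \<le> t \<longrightarrow> t \<le> s \<longrightarrow> s \<le> \<tau> \<longrightarrow> \<bar>f (s, t)\<bar> \<le> B"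
        by blast
    qed
    have n: "norm (fst v) \<le> norm v" "norm (snd v) \<le> norm v" for v :: "'u::euclidean_space \<times> 'v::euclidean_space"
      using norm_fst_le[of "fst v" "snd v"] norm_snd_le[of "snd v" "fst v"] by simp_all
    have n1: "\<bar>fst (fst v)\<bar> \<le> norm v" "\<bar>fst (snd (fst v))\<bar> \<le> norm v" "\<bar>snd (snd (fst v))\<bar> \<le> norm v"
      "\<bar>fst (snd v)\<bar> \<le> norm v" "\<bar>snd (snd v)\<bar> \<le> norm v" for v :: "(real \<times> real \<times> real) \<times> (real \<times> real)"
      using n(1)[of v] n(2)[of v] n(1)[of "fst v"] n(2)[of "fst v"] n(1)[of "snd (fst v)"] n(2)[of "snd (fst v)"]
        n(1)[of "snd v"] n(2)[of "snd v"] by simp_all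
    note mc = measurable_compose[OF _ fstm] measurable_compose[OF _ sndm]
    show "locally_bounded w" unfolding w_def by (rule *[OF _ n1(1)]) (intro mc Zm)
    show "locally_bounded p" unfolding p_def by (rule *[OF _ n1(2)]) (intro mc Zm)
    show "locally_bounded y" unfolding y_def by (rule *[OF _ n1(3)]) (intro mc Zm)
    show "locally_bounded z" unfolding z_def by (rule *[OF _ n1(4)]) (intro mc Zm)
    show "locally_bounded q" unfolding q_def by (rule *[OF _ n1(5)]) (intro mc Zm)
  qed
  have bbh: "locally_bounded (\<lambda>r. hw (Z r))" "locally_bounded (\<lambda>r. hz (Z r))" "locally_bounded (\<lambda>r. hp (Z r))"
    by (intro locally_bounded_lipschitz_compose h_bl Zm)+
  have w_snd: "snd_primitive w (\<lambda>r. - hw (Z r))"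
    by (rule snd_primitiveI) (use bb bbh w_eq w_init in \<open>auto intro: locally_bounded_minus\<close>)
  have p_snd: "snd_primitive p (\<lambda>r. hp (Z r))"
    by (rule snd_primitiveI) (use bb bbh p_eq p_init in \<open>auto intro: locally_bounded_minus\<close>)
  have y_snd: "snd_primitive y (\<lambda>r. - q r)"
    by (rule snd_primitiveI) (use bb bbh y_eq y_init in \<open>auto intro: locally_bounded_minus\<close>)
  have z_fst: "fst_primitive z (\<lambda>r. hz (Z r))"
    by (rule fst_primitiveI) (use bb bbh z_eq z_init in \<open>auto intro: locally_bounded_minus\<close>)
  have q_fst: "fst_primitive q (\<lambda>r. - hp (Z r))"
    by (rule fst_primitiveI) (use bb bbh q_eq q_init in \<open>auto intro: locally_bounded_minus\<close>)
  have q_fst': "fst_primitive (\<lambda>r. - q r) (\<lambda>r. hp (Z r))"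
    using fst_primitive_minus[OF q_fst] by simp
  \<comment> \<open>So far \<open>y\<close> was integrated in the second coordinate only. Its other
    derivative comes from closedness of p d\<alpha> - q d\<beta>, whose diagonal integral vanishes
    because p = q there. Truncation does no harm, as both equations contain the same
    \<open>hp\<close>.\<close>
  have y_fst: "fst_primitive y p"
  proof (rule fst_primitiveI[OF bb(3,2)])
    fix s t :: real assume ts: "t \<le> s"
    have "(LBINT u:{t..s}. p (u, t)) + (LBINT u:{t..s}. - q (s, u)) = (LBINT u:{t..s}. p (u, u) + - q (u, u))"
      by (rule closed_form_triangle[OF p_snd q_fst' ts])
    also have "\<dots> = 0" by (simp add: p_init q_init)
    finally have "(LBINT u:{t..s}. p (u, t)) = (LBINT u:{t..s}. q (s, u))"
      by (simp add: set_lebesgue_integral_def)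
    then show "y (s, t) = y (t, t) + (LBINT u:{t..s}. p (u, t))"
      using y_eq[OF ts] y_init by simp
  qed
  have clips: "\<delta> \<le> cw v" "cw v \<le> W" "- W \<le> cz v" "cz v \<le> - \<delta>" "m \<le> cp v" "cp v \<le> M" "m \<le> cq v" "cq v \<le> M" for v
    unfolding cw_def cz_def cp_def cq_def using \<delta> mM' by (auto intro!: clip_bounds)
  have ay_nn: "0 \<le> ay v" for v by (simp add: ay_def a_nonneg)
  have cpq_nn: "0 \<le> cp v" "0 \<le> cq v" for v using clips(5,7)[of v] m by auto
  have w_bounds: "\<delta> \<le> w (s, t)" "w (s, t) \<le> W" if ts: "t \<le> s" for s t
  proof -
    show "\<delta> \<le> w (s, t)"
    proof (rule primitive_on_barrier_backward[OF snd_primitiveD(3)[OF w_snd, of s t]])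
      fix u assume "w (s, u) < \<delta>"
      \<comment> \<open>Beyond a wall the truncated value is the wall itself, so the sign of the
        rate on the wall confines the untruncated \<open>w\<close>. The barrier is run backwards
        because the data sit at \<open>u = s\<close>.\<close>
      then have "cw (Z (s, u)) = \<delta>" using \<delta> by (auto simp: w_def cw_def clip_def)
      then show "- hw (Z (s, u)) \<le> 0"
        unfolding hw_def using rate_w_lower[of "cz (Z (s, u))"] clips ay_nn cpq_nn by simp
    qed (use ts w_init w0 in auto)
    have "- W \<le> - w (s, t)"
    proof (rule primitive_on_barrier_backward[OF primitive_on_minus[OF snd_primitiveD(3)[OF w_snd, of s t]]])
      fix u assume "- w (s, u) < - W"
      then have "cw (Z (s, u)) = W" using \<delta> by (auto simp: w_def cw_def clip_def)
      then show "- (- hw (Z (s, u))) \<le> 0"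
        unfolding hw_def using rate_w_upper[of "cz (Z (s, u))"] clips ay_nn cpq_nn
        by (simp add: mult_nonneg_nonpos mult_nonpos_nonneg)
    qed (use ts w_init w0 in auto)
    then show "w (s, t) \<le> W" by simp
  qed
  have z_bounds: "- W \<le> z (s, t)" "z (s, t) \<le> - \<delta>" if ts: "t \<le> s" for s t
  proof -
    show "- W \<le> z (s, t)"
    proof (rule primitive_on_barrier[OF fst_primitiveD(3)[OF z_fst, of t s]])
      fix u assume "z (u, t) < - W"
      then have "cz (Z (u, t)) = - W" using \<delta> by (auto simp: z_def cz_def clip_def)
      then show "hz (Z (u, t)) \<ge> 0"
        unfolding hz_def rate_z_conv_rate_w using rate_w_upper[of "- cw (Z (u, t))"] clips ay_nn cpq_nn
        by (simp add: mult_nonneg_nonpos mult_nonpos_nonneg)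
    qed (use ts z_init z0 in auto)
    have "\<delta> \<le> - z (s, t)"
    proof (rule primitive_on_barrier[OF primitive_on_minus[OF fst_primitiveD(3)[OF z_fst, of t s]]])
      fix u assume "- z (u, t) < \<delta>"
      then have "cz (Z (u, t)) = - \<delta>" using \<delta> by (auto simp: z_def cz_def clip_def)
      then show "- hz (Z (u, t)) \<ge> 0"
        unfolding hz_def rate_z_conv_rate_w using rate_w_lower[of "- cw (Z (u, t))"] clips ay_nn cpq_nn
        by simp
    qed (use ts z_init z0(2)[of t] in auto)
    then show "z (s, t) \<le> - \<delta>" by simp
  qed
  have cw_eq: "cw (Z (s, t)) = w (s, t)" and cz_eq: "cz (Z (s, t)) = z (s, t)" if "t \<le> s" for s t
    unfolding cw_def cz_def using w_bounds[OF that] z_bounds[OF that] by (auto simp: clip_id w_def z_def)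
  define R where "R = Amax * Hm * M * M"
  have hp_b: "\<bar>hp (Z r)\<bar> \<le> R" for r
    unfolding hp_def R_def abs_mult
    using clips[of "Z r"] ay_nn cpq_nn abs_rate_p[of "cw (Z r)" "cz (Z r)"] Hm Amax mM' m a_le[of "snd (snd (fst (Z r)))"]
    by (intro mult_mono mult_nonneg_nonneg) (auto simp: ay_def Hm_def)
  have R: "R \<ge> 0" using hp_b[of 0] by (meson abs_ge_zero order_trans)
  \<comment> \<open>\<open>R\<close> bounds the truncated rate of \<open>p\<close> and
    \<open>q\<close>, so over a distance \<epsilon> they move by at most \<open>m\<close>; adding 1
    avoids a zero denominator.\<close>
  define \<epsilon> where "\<epsilon> = m / (R + 1)"
  have \<epsilon>: "\<epsilon> > 0" using m R by (simp add: \<epsilon>_def)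
  have R\<epsilon>: "R * \<epsilon> \<le> m" using m R by (simp add: \<epsilon>_def field_simps)
  \<comment> \<open>Continuation in bands around the diagonal: bounds with slack on one band give
    the bounds \<open>m\<close> and \<open>M\<close> on the next, there the truncation is inactive,
    and the logarithmic estimate, taken all the way from the diagonal, restores the slack.\<close>
  have pq: "2 * m \<le> p (s, t) \<and> p (s, t) \<le> M / 2 \<and> 2 * m \<le> q (s, t) \<and> q (s, t) \<le> M / 2"
    if "t \<le> s" "s - t \<le> real n * \<epsilon>" for s t n
    using that
  proof (induction n arbitrary: s t)
    case 0
    then have "s = t" by simp
    have e: "exp (- (Hm * Imax)) \<le> 1" "1 \<le> exp (Hm * Imax)" using Hm Imax by auto
    have "2 * m \<le> 1 / (2 * W)" "1 / (2 * \<delta>) \<le> M / 2"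
      unfolding m_def M_def using e W \<delta> by (auto simp: field_simps)
    then show ?case
      unfolding \<open>s = t\<close> p_init q_init using r0[of t] by auto
  next
    case (Suc n)
    have crude: "m \<le> p (s', t') \<and> p (s', t') \<le> M \<and> m \<le> q (s', t') \<and> q (s', t') \<le> M"
      if st': "t' \<le> s'" "s' - t' \<le> real (Suc n) * \<epsilon>" for s' t'
    proof -
      \<comment> \<open>The first point of the previous band met on the way to the diagonal:
        \<open>b\<close> when moving in the second coordinate, for \<open>p\<close>, and
        \<open>d\<close> below when moving in the first, for \<open>q\<close>.\<close>
      define b where "b = max t' (s' - real n * \<epsilon>)"
      have b: "t' \<le> b" "b \<le> s'" "s' - b \<le> real n * \<epsilon>" "b - t' \<le> \<epsilon>"
        unfolding b_def using st' \<epsilon> by (auto simp: max_def algebra_simps)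
      define d where "d = min s' (t' + real n * \<epsilon>)"
      have d: "t' \<le> d" "d \<le> s'" "d - t' \<le> real n * \<epsilon>" "s' - d \<le> \<epsilon>"
        unfolding d_def using st' \<epsilon> by (auto simp: min_def algebra_simps)
      have hm: "(\<lambda>u. hp (Z (s', u))) \<in> borel_measurable borel" "(\<lambda>u. - hp (Z (u, t'))) \<in> borel_measurable borel"
        using borel_measurable_slice[OF locally_bounded_measurable[OF bbh(3)]] by auto
      have "\<bar>p (s', b) - p (s', t')\<bar> \<le> R * (b - t')"
        using set_integral_norm_bound_Icc[OF hm(1), of t' b R] hp_b b
          primitive_onD[OF snd_primitiveD(3)[OF p_snd, of s' t'], of t' b] by auto
      also have "\<dots> \<le> R * \<epsilon>" using R b by (intro mult_left_mono)
      finally have 1: "\<bar>p (s', b) - p (s', t')\<bar> \<le> m" using R\<epsilon> by linarith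
      have "\<bar>q (s', t') - q (d, t')\<bar> \<le> R * (s' - d)"
        using set_integral_norm_bound_Icc[OF hm(2), of d s' R] hp_b d
          primitive_onD[OF fst_primitiveD(3)[OF q_fst, of t' s'], of d s'] by auto
      also have "\<dots> \<le> R * \<epsilon>" using R d by (intro mult_left_mono)
      finally have 2: "\<bar>q (s', t') - q (d, t')\<bar> \<le> m" using R\<epsilon> by linarith
      show ?thesis
        using 1 2 Suc.IH[OF b(2,3)] Suc.IH[OF d(1,3)] mM m by linarith
    qed
    have cp_eq: "cp (Z (s', t')) = p (s', t')" and cq_eq: "cq (Z (s', t')) = q (s', t')"
      if "t' \<le> s'" "s' - t' \<le> real (Suc n) * \<epsilon>" for s' t'
      using crude[OF that] unfolding cp_def cq_def p_def q_def by (auto simp: clip_id)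
    have hp_eq: "hp (Z (s', t')) = a (y (s', t')) * rate_p (w (s', t')) (z (s', t')) * p (s', t') * q (s', t')"
      if "t' \<le> s'" "s' - t' \<le> real (Suc n) * \<epsilon>" for s' t'
      unfolding hp_def cp_eq[OF that] cq_eq[OF that] cw_eq[OF that(1)] cz_eq[OF that(1)] by (simp add: ay_def y_def)
    have rp: "\<bar>rate_p (w (s', t')) (z (s', t'))\<bar> \<le> Hm" if "t' \<le> s'" for s' t'
      unfolding Hm_def using w_bounds[OF that] z_bounds[OF that] by (intro abs_rate_p)
    have hp_le: "\<bar>hp (Z (s', t'))\<bar> \<le> Hm * a (y (s', t')) * q (s', t') * p (s', t')"
      if "t' \<le> s'" "s' - t' \<le> real (Suc n) * \<epsilon>" for s' t'
    proof -
      have nonneg: "0 \<le> a (y (s', t'))" "0 \<le> p (s', t')" "0 \<le> q (s', t')"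
        using crude[OF that] m a_nonneg by auto
      then have "\<bar>hp (Z (s', t'))\<bar> = \<bar>rate_p (w (s', t')) (z (s', t'))\<bar> * (a (y (s', t')) * (p (s', t') * q (s', t')))"
        unfolding hp_eq[OF that] by (simp add: abs_mult)
      also have "\<dots> \<le> Hm * (a (y (s', t')) * (p (s', t') * q (s', t')))"
        using rp[OF that(1)] nonneg by (intro mult_right_mono) auto
      finally show ?thesis by (simp add: mult_ac)
    qed
    \<comment> \<open>The sign is -1 because \<open>y\<close> decreases in the second coordinate. As
      \<open>A\<close> vanishes at the initial height, the bound becomes
      \<open>Hm * A (y (s, t))\<close>, at most \<open>Hm * Imax\<close> whatever the number of
      bands.\<close>
    have "\<bar>ln (p (s, s)) - ln (p (s, t))\<bar> \<le> - 1 * Hm * (A (y (s, s)) - A (y (s, t)))"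
    proof (rule ln_primitive_bound[OF snd_primitiveD(3)[OF p_snd] snd_primitiveD(3)[OF y_snd] Suc.prems(1) A a_continuous])
      fix u assume u: "u \<in> {t..s}"
      then show "0 < p (s, u)" using crude[of u s] Suc.prems m by auto
      show "\<bar>hp (Z (s, u))\<bar> \<le> Hm * a (y (s, u)) * (- 1 * - q (s, u)) * p (s, u)"
        using hp_le[of u s] Suc.prems u by simp
    qed
    then have lp: "\<bar>ln (p (s, t)) - ln (r0 s)\<bar> \<le> Hm * A (y (s, t))"
      by (simp add: p_init y_init A_init abs_minus_commute)
    have "\<bar>ln (q (s, t)) - ln (q (t, t))\<bar> \<le> 1 * Hm * (A (y (s, t)) - A (y (t, t)))"
    proof (rule ln_primitive_bound[OF fst_primitiveD(3)[OF q_fst] fst_primitiveD(3)[OF y_fst] Suc.prems(1) A a_continuous])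
      fix u assume u: "u \<in> {t..s}"
      then show "0 < q (u, t)" using crude[of t u] Suc.prems m by auto
      show "\<bar>- hp (Z (u, t))\<bar> \<le> Hm * a (y (u, t)) * (1 * p (u, t)) * q (u, t)"
        using hp_le[of t u] Suc.prems u by (simp add: mult_ac)
    qed
    then have lq: "\<bar>ln (q (s, t)) - ln (r0 t)\<bar> \<le> Hm * A (y (s, t))"
      by (simp add: q_init y_init A_init)
    have IA: "Hm * A (y (s, t)) \<le> Hm * Imax" using Hm A_le by simp
    have fin: "2 * m \<le> f \<and> f \<le> M / 2" if "f > 0" "ln (r0 u) - Hm * Imax \<le> ln f" "ln f \<le> ln (r0 u) + Hm * Imax" for f u
    proof -
      have "2 * m = 1 / (2 * W) * exp (- (Hm * Imax))" by (simp add: m_def)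
      also have "\<dots> \<le> r0 u * exp (- (Hm * Imax))" using r0[of u] by (intro mult_right_mono) auto
      also have "\<dots> = exp (ln (r0 u) - Hm * Imax)" using r0(3)[of u] by (simp add: exp_diff exp_minus field_simps)
      also have "\<dots> \<le> f" using that by (metis exp_le_cancel_iff exp_ln)
      finally have 1: "2 * m \<le> f" .
      have "f \<le> exp (ln (r0 u) + Hm * Imax)" using that by (metis exp_le_cancel_iff exp_ln)
      also have "\<dots> = r0 u * exp (Hm * Imax)" using r0(3)[of u] by (simp add: exp_add)
      also have "\<dots> \<le> 1 / (2 * \<delta>) * exp (Hm * Imax)" using r0[of u] by (intro mult_right_mono) auto
      also have "\<dots> = M / 2" by (simp add: M_def)
      finally show ?thesis using 1 by simp
    qed
    have "p (s, t) > 0" "q (s, t) > 0" using crude[OF Suc.prems] m by auto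
    then show ?case
      using fin[of "p (s, t)" s] fin[of "q (s, t)" t] lp lq IA by (simp add: abs_le_iff)
  qed
  have pq': "2 * m \<le> p (s, t)" "p (s, t) \<le> M / 2" "2 * m \<le> q (s, t)" "q (s, t) \<le> M / 2" if "t \<le> s" for s t
  proof -
    obtain n :: nat where "(s - t) / \<epsilon> \<le> real n" using real_arch_simple by blast
    then have "s - t \<le> real n * \<epsilon>" using \<epsilon> by (simp add: field_simps)
    then show "2 * m \<le> p (s, t)" "p (s, t) \<le> M / 2" "2 * m \<le> q (s, t)" "q (s, t) \<le> M / 2"
      using pq[OF that] by auto
  qed
  have M: "M > 0" using m mM by linarith
  have h_eq: "hw (Z r) = a (y r) * rate_w (w r) (z r) * q r" "hz (Z r) = a (y r) * rate_z (w r) (z r) * p r"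
    "hp (Z r) = a (y r) * rate_p (w r) (z r) * p r * q r" if r: "r \<in> halfplane" for r
  proof -
    obtain s t where st: "r = (s, t)" "t \<le> s" using r by (cases r) (auto simp: halfplane_def)
    have "cp (Z r) = p r" "cq (Z r) = q r"
      using pq'[OF st(2)] m M unfolding st cp_def cq_def p_def q_def by (auto simp: clip_id)
    then show "hw (Z r) = a (y r) * rate_w (w r) (z r) * q r" "hz (Z r) = a (y r) * rate_z (w r) (z r) * p r"
      "hp (Z r) = a (y r) * rate_p (w r) (z r) * p r * q r"
      unfolding hw_def hz_def hp_def using cw_eq[OF st(2)] cz_eq[OF st(2)] by (auto simp: ay_def y_def st)
  qed
  have bb_a: "locally_bounded (\<lambda>r. a (y r))"
  proof -
    have "continuous_on UNIV (\<lambda>r :: real \<times> real. a (fst r))"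
      by (intro continuous_on_compose2[OF a_continuous] continuous_intros) auto
    then show ?thesis
      using locally_bounded_compose[OF bb(3) bb(3), of "\<lambda>r. a (fst r)"] by simp
  qed
  have bb_r: "locally_bounded (\<lambda>r. rate_w (w r) (z r))" "locally_bounded (\<lambda>r. rate_z (w r) (z r))" "locally_bounded (\<lambda>r. rate_p (w r) (z r))"
    unfolding rate_w_def rate_z_def rate_p_def divide_inverse diff_conv_add_uminus
    by (intro locally_bounded_mult locally_bounded_add locally_bounded_minus locally_bounded_const bb)+
  have w_snd': "snd_primitive w (\<lambda>r. - (a (y r) * rate_w (w r) (z r) * q r))"
    by (rule snd_primitive_cong[OF w_snd]) (auto simp: h_eq intro!: locally_bounded_minus locally_bounded_mult bb bb_a bb_r)
  have z_fst': "fst_primitive z (\<lambda>r. a (y r) * rate_z (w r) (z r) * p r)"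
    by (rule fst_primitive_cong[OF z_fst]) (auto simp: h_eq intro!: locally_bounded_minus locally_bounded_mult bb bb_a bb_r)
  have p_snd': "snd_primitive p (\<lambda>r. a (y r) * rate_p (w r) (z r) * p r * q r)"
    by (rule snd_primitive_cong[OF p_snd]) (auto simp: h_eq intro!: locally_bounded_minus locally_bounded_mult bb bb_a bb_r)
  have q_fst'': "fst_primitive q (\<lambda>r. - (a (y r) * rate_p (w r) (z r) * p r * q r))"
    by (rule fst_primitive_cong[OF q_fst]) (auto simp: h_eq intro!: locally_bounded_minus locally_bounded_mult bb bb_a bb_r)
  obtain RX where XA: "snd_primitive (\<lambda>r. w r * p r) RX" and XB: "fst_primitive (\<lambda>r. (- z r) * q r) RX"
    using mixed_derivative_x[OF w_snd' z_fst' p_snd' q_fst''] by blast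
  define x where "x = (\<lambda>r. snd r + (LBINT u:{snd r..fst r}. w (u, snd r) * p (u, snd r)))"
  have x_eq: "x (s, t) = t + (LBINT u:{t..s}. w (u, t) * p (u, t))" for s t by (simp add: x_def)
  \<comment> \<open>\<open>x\<close> is defined by integration in the first coordinate; closedness
    of dx gives the formula in the second. On the diagonal w p - z q = 1, which contributes
    \<open>s - t\<close> and turns the starting value \<open>t\<close> into
    \<open>s\<close>.\<close>
  have x_eq': "x (s, t) = s + (LBINT u:{t..s}. - (- (z (s, u) * q (s, u))))" if ts: "t \<le> s" for s t
  proof -
    have "(LBINT u:{t..s}. w (u, t) * p (u, t)) + (LBINT u:{t..s}. (- z (s, u)) * q (s, u)) = (LBINT u:{t..s}. w (u, u) * p (u, u) + (- z (u, u)) * q (u, u))"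
      by (rule closed_form_triangle[OF XA XB ts])
    also have "\<dots> = (LBINT u:{t..s}. 1)"
    proof (intro set_lebesgue_integral_cong allI impI)
      fix u
      have "w0 u - z0 u \<noteq> 0" using w0[of u] z0[of u] \<delta> by auto
      then have "(w0 u - z0 u) * r0 u = 1" by (simp add: r0_def)
      then show "w (u, u) * p (u, u) + (- z (u, u)) * q (u, u) = 1"
        by (simp add: w_init z_init p_init q_init algebra_simps)
    qed simp
    also have "\<dots> = s - t"
      using ts by (simp add: set_lebesgue_integral_def)
    finally show ?thesis by (simp add: x_eq set_lebesgue_integral_def)
  qed
  have x_init: "x (s, s) = s" for s
    unfolding x_eq set_integral_singleton_Icc by simp
  have bbx: "locally_bounded x"
  proof (rule locally_boundedI)
    have wp: "(\<lambda>r. w r * p r) \<in> borel_measurable borel"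
      using bb(1,2)[THEN locally_bounded_measurable] by measurable
    show "x \<in> borel_measurable borel"
      unfolding x_def using borel_measurable_integral_fst_Icc[OF wp] sndm by measurable
    fix \<tau> :: real
    have "\<bar>x (s, t)\<bar> \<le> \<tau> + W * M * (2 * \<tau>)" if st: "- \<tau> \<le> t" "t \<le> s" "s \<le> \<tau>" for s t
    proof -
      have "norm (LBINT u:{t..s}. w (u, t) * p (u, t)) \<le> W * M * (s - t)"
      proof (rule set_integral_norm_bound_Icc[OF borel_measurable_slice(2)[OF wp] _ st(2)])
        fix u assume "t \<le> u"
        then show "norm (w (u, t) * p (u, t)) \<le> W * M"
          using w_bounds[of t u] pq'[of t u] \<delta> m M unfolding real_norm_def abs_mult
          by (intro mult_mono) auto
      qed
      also have "\<dots> \<le> W * M * (2 * \<tau>)"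
        using st W M by (intro mult_left_mono) auto
      finally show ?thesis
        unfolding x_eq real_norm_def using st by linarith
    qed
    then show "\<exists>B. \<forall>s t. - \<tau> \<le> t \<longrightarrow> t \<le> s \<longrightarrow> s \<le> \<tau> \<longrightarrow> \<bar>x (s, t)\<bar> \<le> B"
      by blast
  qed
  have x_fst: "fst_primitive x (\<lambda>r. w r * p r)"
    by (rule fst_primitiveI) (use bbx x_eq x_init bb in \<open>auto intro: locally_bounded_mult\<close>)
  have x_snd: "snd_primitive x (\<lambda>r. - (z r * q r))"
    by (rule snd_primitiveI) (use bbx x_eq' x_init bb in \<open>auto intro: locally_bounded_mult locally_bounded_minus\<close>)
  have "characteristic_solution y0 c \<kappa> \<delta> W Amax Imax a A w0 z0 w z p q x y m M"
  proof
    show "w (s, s) = w0 s" "z (s, s) = z0 s" "p (s, s) = 1 / (w0 s - z0 s)" "q (s, s) = 1 / (w0 s - z0 s)"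
      "y (s, s) = - y0" "x (s, s) = s" for s
      by (simp_all add: w_init z_init p_init q_init y_init x_init r0_def)
    show "\<delta> \<le> w r \<and> w r \<le> W" "- W \<le> z r \<and> z r \<le> - \<delta>" if "r \<in> halfplane" for r
      using w_bounds z_bounds that by (cases r; simp add: halfplane_def)+
    show "m \<le> p r \<and> p r \<le> M" "m \<le> q r \<and> q r \<le> M" if "r \<in> halfplane" for r
      using pq'[of "snd r" "fst r"] that m M by (auto simp: halfplane_def)
  qed (rule w_snd' z_fst' p_snd' q_fst'' y_fst y_snd x_fst x_snd m)+
  then show ?thesis by blast
qed

end

subsection \<open>Change of variables\<close>

lemma closed_halfplane: "closed halfplane"
  unfolding halfplane_def by (intro closed_Collect_le continuous_intros)

lemma halfplane_sets [measurable]: "halfplane \<in> sets borel"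
  using closed_halfplane by simp

lemma set_integrable_halfplane:
  assumes g: "locally_bounded g"
    and supp: "\<And>s t. t \<le> s \<Longrightarrow> g (s, t) \<noteq> 0 \<Longrightarrow> - R \<le> t \<and> s \<le> R"
  shows "set_integrable lborel halfplane g"
proof -
  obtain B where B: "B \<ge> 0" "\<And>s t. - R \<le> t \<Longrightarrow> t \<le> s \<Longrightarrow> s \<le> R \<Longrightarrow> \<bar>g (s, t)\<bar> \<le> B"
    using locally_boundedE[OF g] by metis
  define K where "K = halfplane \<inter> cbox (- R, - R) (R, R)"
  have "(\<lambda>p. indicator halfplane p *\<^sub>R g p) = (\<lambda>p. indicator K p *\<^sub>R g p)"
  proof
    fix p
    show "indicator halfplane p *\<^sub>R g p = indicator K p *\<^sub>R g p"
      using supp[of "snd p" "fst p"] by (cases p) (auto simp: K_def indicator_def halfplane_def cbox_Pair_iff)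
  qed
  moreover have "integrable lborel (\<lambda>p. indicator K p *\<^sub>R g p)"
  proof (rule integrableI_bounded_set_indicator[where B = B])
    show "K \<in> sets lborel" unfolding K_def by simp
    show "g \<in> borel_measurable lborel" using locally_bounded_measurable[OF g] by simp
    show "emeasure lborel K < \<infinity>"
      using emeasure_mono[of K "cbox (- R, - R) (R, R)" lborel] emeasure_lborel_cbox_finite[of "(- R, - R)" "(R, R)"]
      by (auto simp: K_def less_top top_unique)
    show "AE p in lborel. p \<in> K \<longrightarrow> norm (g p) \<le> B"
      using B by (auto simp: K_def halfplane_def cbox_Pair_iff)
  qed
  ultimately show ?thesis unfolding set_integrable_def by simp
qed

lemma integrable_diagonal:
  assumes f: "locally_bounded f"
    and supp: "\<And>s. f (s, s) \<noteq> 0 \<Longrightarrow> - R \<le> s \<and> s \<le> R"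
  shows "integrable lborel (\<lambda>s. f (s, s))"
proof -
  obtain B where B: "\<And>s t. - R \<le> t \<Longrightarrow> t \<le> s \<Longrightarrow> s \<le> R \<Longrightarrow> \<bar>f (s, t)\<bar> \<le> B"
    using locally_boundedE[OF f] by metis
  have m: "(\<lambda>s. f (s, s)) \<in> borel_measurable borel"
    by (rule measurable_compose[OF _ locally_bounded_measurable[OF f]]) simp
  have "(\<lambda>s. f (s, s)) = (\<lambda>s. indicator {- R..R} s *\<^sub>R f (s, s))"
    using supp by (auto simp: indicator_def fun_eq_iff)
  then show ?thesis
    using set_integrable_bounded_Icc[OF m, of "- R" R B] B unfolding set_integrable_def by simp
qed

text \<open>On each line of fixed \<open>t\<close> the integral runs from the diagonal to a point
  beyond the support. The diagonal is the lower end, hence the minus sign; in the other direction it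
  is the upper end.\<close>

lemma halfplane_integral_fst:
  assumes f: "fst_primitive f g"
    and supp: "\<And>s t. t \<le> s \<Longrightarrow> f (s, t) \<noteq> 0 \<or> g (s, t) \<noteq> 0 \<Longrightarrow> - R \<le> t \<and> s \<le> R"
  shows "(LBINT r:halfplane. g r) = - (LINT t|lborel. f (t, t))"
proof -
  have "set_integrable lborel halfplane g"
    using set_integrable_halfplane[OF fst_primitiveD(2)[OF f]] supp by blast
  then have int: "integrable (lborel \<Otimes>\<^sub>M lborel) (\<lambda>(s, t). indicator halfplane (s, t) *\<^sub>R g (s, t))"
    unfolding lborel_prod set_integrable_def by (simp add: split_beta')
  have "(LINT s|lborel. indicator halfplane (s, t) *\<^sub>R g (s, t)) = - f (t, t)" for t
  proof -
    \<comment> \<open>Not below \<open>t\<close> and strictly beyond \<open>R\<close>, so that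
      \<open>f\<close> vanishes at \<open>(N, t)\<close>.\<close>
    define N where "N = max t R + 1"
    have N: "t \<le> N" "\<not> N \<le> R" by (auto simp: N_def)
    have "indicator halfplane (s, t) *\<^sub>R g (s, t) = indicator {t..N} s *\<^sub>R g (s, t)" for s
      using supp[of t s] by (auto simp: indicator_def halfplane_def N_def)
    then have "(LINT s|lborel. indicator halfplane (s, t) *\<^sub>R g (s, t)) = (LBINT s:{t..N}. g (s, t))"
      unfolding set_lebesgue_integral_def by (intro Bochner_Integration.integral_cong refl)
    also have "\<dots> = f (N, t) - f (t, t)"
      using primitive_onD[OF fst_primitiveD(3)[OF f, of t N], of t N] by (simp add: N_def)
    also have "f (N, t) = 0" using supp[of t N] N by blast
    finally show ?thesis by simp
  qed
  then have "(LINT t|lborel. LINT s|lborel. indicator halfplane (s, t) *\<^sub>R g (s, t)) = - (LINT t|lborel. f (t, t))"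
    by simp
  then show ?thesis
    using lborel_pair.integral_snd[OF int] unfolding set_lebesgue_integral_def lborel_prod by (simp add: split_beta')
qed

lemma halfplane_integral_snd:
  assumes f: "snd_primitive f g"
    and supp: "\<And>s t. t \<le> s \<Longrightarrow> f (s, t) \<noteq> 0 \<or> g (s, t) \<noteq> 0 \<Longrightarrow> - R \<le> t \<and> s \<le> R"
  shows "(LBINT r:halfplane. g r) = (LINT s|lborel. f (s, s))"
proof -
  have "set_integrable lborel halfplane g"
    using set_integrable_halfplane[OF snd_primitiveD(2)[OF f]] supp by blast
  then have int: "integrable (lborel \<Otimes>\<^sub>M lborel) (\<lambda>(s, t). indicator halfplane (s, t) *\<^sub>R g (s, t))"
    unfolding lborel_prod set_integrable_def by (simp add: split_beta')
  have "(LINT t|lborel. indicator halfplane (s, t) *\<^sub>R g (s, t)) = f (s, s)" for s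
  proof -
    define N where "N = min s (- R) - 1"
    have N: "N \<le> s" "\<not> - R \<le> N" by (auto simp: N_def)
    have "indicator halfplane (s, t) *\<^sub>R g (s, t) = indicator {N..s} t *\<^sub>R g (s, t)" for t
      using supp[of t s] by (auto simp: indicator_def halfplane_def N_def)
    then have "(LINT t|lborel. indicator halfplane (s, t) *\<^sub>R g (s, t)) = (LBINT t:{N..s}. g (s, t))"
      unfolding set_lebesgue_integral_def by (intro Bochner_Integration.integral_cong refl)
    also have "\<dots> = f (s, s) - f (s, N)"
      using primitive_onD[OF snd_primitiveD(3)[OF f, of s N], of N s] by (simp add: N_def)
    also have "f (s, N) = 0" using supp[of N s] N by blast
    finally show ?thesis by simp
  qed
  then have "(LINT s|lborel. LINT t|lborel. indicator halfplane (s, t) *\<^sub>R g (s, t)) = (LINT s|lborel. f (s, s))"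
    by simp
  then show ?thesis
    using lborel_pair.integral_fst[OF int] unfolding set_lebesgue_integral_def lborel_prod by (simp add: split_beta')
qed

text \<open>Stokes' theorem for the form \<open>\<Phi> (A d\<alpha> + B d\<beta>)\<close>.\<close>

lemma halfplane_Stokes:
  assumes \<Phi>: "fst_primitive \<Phi> \<Phi>1" "snd_primitive \<Phi> \<Phi>2" and A: "snd_primitive A A2" and B: "fst_primitive B B1"
    and supp: "\<And>s t. t \<le> s \<Longrightarrow> \<Phi> (s, t) \<noteq> 0 \<or> \<Phi>1 (s, t) \<noteq> 0 \<or> \<Phi>2 (s, t) \<noteq> 0 \<Longrightarrow> - R \<le> t \<and> s \<le> R"
  shows "set_integrable lborel halfplane (\<lambda>r. \<Phi>1 r * B r - \<Phi>2 r * A r)"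
    "set_integrable lborel halfplane (\<lambda>r. \<Phi> r * (B1 r - A2 r))"
    "(LBINT r:halfplane. \<Phi>1 r * B r - \<Phi>2 r * A r) + (LINT s|lborel. \<Phi> (s, s) * (A (s, s) + B (s, s)))
      = - (LBINT r:halfplane. \<Phi> r * (B1 r - A2 r))"
proof -
  note lb = fst_primitiveD(1,2)[OF \<Phi>(1)] snd_primitiveD(2)[OF \<Phi>(2)] snd_primitiveD(1,2)[OF A] fst_primitiveD(1,2)[OF B]
  have int: "set_integrable lborel halfplane (\<lambda>r. \<Phi>1 r * B r)" "set_integrable lborel halfplane (\<lambda>r. \<Phi> r * B1 r)"
    "set_integrable lborel halfplane (\<lambda>r. \<Phi>2 r * A r)" "set_integrable lborel halfplane (\<lambda>r. \<Phi> r * A2 r)"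
    by (rule set_integrable_halfplane[where R = R], intro locally_bounded_mult lb, use supp in force)+
  have intd: "integrable lborel (\<lambda>s. (\<lambda>r. \<Phi> r * A r) (s, s))" "integrable lborel (\<lambda>s. (\<lambda>r. \<Phi> r * B r) (s, s))"
    by (rule integrable_diagonal[where R = R], intro locally_bounded_mult lb, use supp in force)+
  show "set_integrable lborel halfplane (\<lambda>r. \<Phi>1 r * B r - \<Phi>2 r * A r)"
    "set_integrable lborel halfplane (\<lambda>r. \<Phi> r * (B1 r - A2 r))"
    using set_integral_diff(1)[OF int(1,3)] set_integral_diff(1)[OF int(2,4)] by (simp_all add: right_diff_distrib)
  have "(LBINT r:halfplane. \<Phi>1 r * B r + \<Phi> r * B1 r) = - (LINT t|lborel. \<Phi> (t, t) * B (t, t))"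
    using halfplane_integral_fst[OF fst_primitive_mult[OF \<Phi>(1) B], of R] supp by force
  moreover have "(LBINT r:halfplane. \<Phi>2 r * A r + \<Phi> r * A2 r) = (LINT t|lborel. \<Phi> (t, t) * A (t, t))"
    using halfplane_integral_snd[OF snd_primitive_mult[OF \<Phi>(2) A], of R] supp by force
  ultimately show "(LBINT r:halfplane. \<Phi>1 r * B r - \<Phi>2 r * A r) + (LINT s|lborel. \<Phi> (s, s) * (A (s, s) + B (s, s)))
      = - (LBINT r:halfplane. \<Phi> r * (B1 r - A2 r))"
    using int intd by (simp add: distrib_left right_diff_distrib)
qed

section \<open>Geometry of the coordinate map and transport of test functions\<close>

lemma primitive_on_lower:
  assumes f: "primitive_on f g a b" and st: "a \<le> s" "s \<le> t" "t \<le> b"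
    and g: "\<And>u. s \<le> u \<Longrightarrow> u \<le> t \<Longrightarrow> \<mu> \<le> g u"
  shows "\<mu> * (t - s) \<le> f t - f s"
proof -
  obtain B where "\<And>u. u \<in> {a..b} \<Longrightarrow> \<bar>g u\<bar> \<le> B" "g \<in> borel_measurable borel"
    using f unfolding primitive_on_def by blast
  then have gi: "set_integrable lborel {s..t} g"
    using st by (intro set_integrable_bounded_Icc[where B = B]) auto
  have "\<mu> * (t - s) = (LBINT u:{s..t}. \<mu>)"
    using st by (simp add: set_lebesgue_integral_def)
  also have "\<dots> \<le> (LBINT u:{s..t}. g u)"
    by (rule set_integral_mono[OF set_integrable_bounded_Icc[where B = "\<bar>\<mu>\<bar>"] gi]) (use g in auto)
  finally show ?thesis
    using primitive_onD[OF f st] by simp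
qed

lemma primitive_on_upper:
  assumes f: "primitive_on f g a b" and st: "a \<le> s" "s \<le> t" "t \<le> b"
    and g: "\<And>u. s \<le> u \<Longrightarrow> u \<le> t \<Longrightarrow> g u \<le> \<mu>"
  shows "f t - f s \<le> \<mu> * (t - s)"
  using primitive_on_lower[OF primitive_on_minus[OF f] st, of "- \<mu>"] g by simp

definition C1_test :: "(real \<times> real \<Rightarrow> real) \<Rightarrow> (real \<times> real \<Rightarrow> real) \<Rightarrow> (real \<times> real \<Rightarrow> real) \<Rightarrow> real \<Rightarrow> bool"
  where "C1_test \<phi> \<phi>x \<phi>y \<rho> \<longleftrightarrow>
    (\<forall>P. (\<phi> has_derivative (\<lambda>h. \<phi>x P * fst h + \<phi>y P * snd h)) (at P)) \<and>
    continuous_on UNIV \<phi>x \<and> continuous_on UNIV \<phi>y \<and>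
    (\<forall>X Y. \<bar>X\<bar> > \<rho> \<or> Y > \<rho> \<longrightarrow> \<phi> (X, Y) = 0 \<and> \<phi>x (X, Y) = 0 \<and> \<phi>y (X, Y) = 0)"

context characteristic_solution
begin

definition T :: "real \<times> real \<Rightarrow> real \<times> real"
  where "T r = (x r, y r)"

text \<open>The absolute value of the Jacobian determinant: x_\<alpha> y_\<beta> - x_\<beta>
  y_\<alpha> = -(w - z) p q, so the map reverses orientation.\<close>

definition J :: "real \<times> real \<Rightarrow> real"
  where "J r = (w r - z r) * p r * q r"

lemma unknowns_locally_bounded: "locally_bounded w" "locally_bounded z" "locally_bounded p" "locally_bounded q" "locally_bounded x" "locally_bounded y"
  using snd_primitiveD(1)[OF w_snd] fst_primitiveD(1)[OF z_fst] snd_primitiveD(1)[OF p_snd] fst_primitiveD(1)[OF q_fst]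
    fst_primitiveD(1)[OF x_fst] fst_primitiveD(1)[OF y_fst] by auto

lemmas unknowns_measurable [measurable] = unknowns_locally_bounded[THEN locally_bounded_measurable]

lemma T_measurable [measurable]: "T \<in> borel_measurable borel"
  unfolding T_def by measurable

lemma J_measurable [measurable]: "J \<in> borel_measurable borel"
  unfolding J_def by measurable

lemma unknown_bounds:
  assumes "t \<le> s"
  shows "\<delta> \<le> w (s, t)" "w (s, t) \<le> W" "- W \<le> z (s, t)" "z (s, t) \<le> - \<delta>"
    "m \<le> p (s, t)" "p (s, t) \<le> M" "m \<le> q (s, t)" "q (s, t) \<le> M"
  using w_bounds[of "(s, t)"] z_bounds[of "(s, t)"] p_bounds[of "(s, t)"] q_bounds[of "(s, t)"] assms
  by (auto simp: halfplane_def)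

lemma M: "M > 0"
  using unknown_bounds(5,6)[of 0 0] m by simp

lemma J_pos: "r \<in> halfplane \<Longrightarrow> J r > 0"
  using unknown_bounds[of "snd r" "fst r"] m \<delta> unfolding J_def halfplane_def by (auto intro!: mult_pos_pos)

lemma wp_bounds:
  assumes "t \<le> s"
  shows "\<delta> * m \<le> w (s, t) * p (s, t)" "w (s, t) * p (s, t) \<le> W * M"
    "\<delta> * m \<le> - (z (s, t) * q (s, t))" "- (z (s, t) * q (s, t)) \<le> W * M"
proof -
  note b = unknown_bounds[OF assms]
  show "\<delta> * m \<le> w (s, t) * p (s, t)" "w (s, t) * p (s, t) \<le> W * M"
    using b \<delta> m M by (auto intro!: mult_mono)
  have "\<delta> * m \<le> (- z (s, t)) * q (s, t)" "(- z (s, t)) * q (s, t) \<le> W * M"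
    using b \<delta> m M by (intro mult_mono; auto)+
  then show "\<delta> * m \<le> - (z (s, t) * q (s, t))" "- (z (s, t) * q (s, t)) \<le> W * M" by auto
qed

lemma x_increments:
  assumes "t \<le> s" "s \<le> s'"
  shows "\<delta> * m * (s' - s) \<le> x (s', t) - x (s, t)" "x (s', t) - x (s, t) \<le> W * M * (s' - s)"
  using primitive_on_lower[OF fst_primitiveD(3)[OF x_fst, of t s'], of s s' "\<delta> * m"]
    primitive_on_upper[OF fst_primitiveD(3)[OF x_fst, of t s'], of s s' "W * M"] wp_bounds assms by auto

lemma x_increments':
  assumes "t \<le> t'" "t' \<le> s"
  shows "\<delta> * m * (t' - t) \<le> x (s, t') - x (s, t)" "x (s, t') - x (s, t) \<le> W * M * (t' - t)"
  using primitive_on_lower[OF snd_primitiveD(3)[OF x_snd, of s t], of t t' "\<delta> * m"]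
    primitive_on_upper[OF snd_primitiveD(3)[OF x_snd, of s t], of t t' "W * M"] wp_bounds assms by auto

lemma y_increments:
  assumes "t \<le> s" "s \<le> s'"
  shows "m * (s' - s) \<le> y (s', t) - y (s, t)" "y (s', t) - y (s, t) \<le> M * (s' - s)"
  using primitive_on_lower[OF fst_primitiveD(3)[OF y_fst, of t s'], of s s' m]
    primitive_on_upper[OF fst_primitiveD(3)[OF y_fst, of t s'], of s s' M] unknown_bounds assms by auto

lemma y_increments':
  assumes "t \<le> t'" "t' \<le> s"
  shows "m * (t' - t) \<le> y (s, t) - y (s, t')" "y (s, t) - y (s, t') \<le> M * (t' - t)"
  using primitive_on_upper[OF snd_primitiveD(3)[OF y_snd, of s t], of t t' "- m"]
    primitive_on_lower[OF snd_primitiveD(3)[OF y_snd, of s t], of t t' "- M"] unknown_bounds assms by auto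

text \<open>\<open>x\<close> increases in both coordinates, while \<open>y\<close> increases in the
  first and decreases in the second. Increments of equal sign add up in \<open>x\<close>, those of
  opposite sign in \<open>y\<close>, so one component always detects the full distance.\<close>

lemma T_expansive:
  assumes "r \<in> halfplane" "r' \<in> halfplane"
  shows "m * min 1 \<delta> * dist r r' \<le> dist (T r) (T r')"
proof -
  \<comment> \<open>With \<open>s \<le> s'\<close> the intermediate corner \<open>(s', t)\<close>
    lies in the half-plane, so the increment can be taken one coordinate at a time.\<close>
  have main: "m * min 1 \<delta> * dist (s, t) (s', t') \<le> dist (T (s, t)) (T (s', t'))"
    if ts: "t \<le> s" "t' \<le> s'" "s \<le> s'" for s t s' t'
  proof -
    have d: "dist (s, t) (s', t') \<le> \<bar>s' - s\<bar> + \<bar>t' - t\<bar>"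
      unfolding dist_Pair_Pair dist_real_def using sqrt_sum_squares_le_sum_abs[of "s - s'" "t - t'"]
      by (simp add: abs_minus_commute[of s'] abs_minus_commute[of t'])
    have dx: "\<bar>x (s', t') - x (s, t)\<bar> \<le> dist (T (s, t)) (T (s', t'))" "\<bar>y (s', t') - y (s, t)\<bar> \<le> dist (T (s, t)) (T (s', t'))"
      using dist_fst_le[of "T (s, t)" "T (s', t')"] dist_snd_le[of "T (s, t)" "T (s', t')"]
      by (auto simp: T_def dist_real_def abs_minus_commute)
    have "m * min 1 \<delta> * (\<bar>s' - s\<bar> + \<bar>t' - t\<bar>) \<le> dist (T (s, t)) (T (s', t'))"
    proof (cases "t' \<le> t")
      case True
      have "m * min 1 \<delta> * (\<bar>s' - s\<bar> + \<bar>t' - t\<bar>) \<le> m * 1 * ((s' - s) + (t - t'))"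
        using m \<delta> ts True by (intro mult_mono) auto
      also have "\<dots> \<le> y (s', t') - y (s, t)"
        using y_increments(1)[of t s s'] y_increments'(1)[of t' t s'] ts True by (simp add: algebra_simps)
      finally show ?thesis using dx(2) by linarith
    next
      case False
      have "m * min 1 \<delta> * (\<bar>s' - s\<bar> + \<bar>t' - t\<bar>) \<le> m * \<delta> * ((s' - s) + (t' - t))"
        using m \<delta> ts False by (intro mult_mono) auto
      also have "\<dots> \<le> x (s', t') - x (s, t)"
        using x_increments(1)[of t s s'] x_increments'(1)[of t t' s'] ts False by (simp add: algebra_simps)
      finally show ?thesis using dx(1) by linarith
    qed
    moreover have "m * min 1 \<delta> * dist (s, t) (s', t') \<le> m * min 1 \<delta> * (\<bar>s' - s\<bar> + \<bar>t' - t\<bar>)"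
      using d m \<delta> by (intro mult_left_mono) auto
    ultimately show ?thesis by linarith
  qed
  show ?thesis
    using main[of "snd r" "fst r" "snd r'" "fst r'"] main[of "snd r'" "fst r'" "snd r" "fst r"] assms
    by (cases "fst r \<le> fst r'") (auto simp: halfplane_def dist_commute)
qed

lemma T_inj: "inj_on T halfplane"
proof (rule inj_onI)
  fix r r' assume "r \<in> halfplane" "r' \<in> halfplane" "T r = T r'"
  then have "m * min 1 \<delta> * dist r r' \<le> 0" using T_expansive[of r r'] by simp
  moreover have "m * min 1 \<delta> > 0" using m \<delta> by simp
  ultimately have "dist r r' \<le> 0" using mult_pos_pos[of "m * min 1 \<delta>" "dist r r'"] by linarith
  then show "r = r'" by simp
qed

lemma T_continuous: "continuous_on halfplane T"
proof -
  have main: "\<bar>x (s', t') - x (s, t)\<bar> \<le> W * M * (\<bar>s' - s\<bar> + \<bar>t' - t\<bar>) \<and> \<bar>y (s', t') - y (s, t)\<bar> \<le> M * (\<bar>s' - s\<bar> + \<bar>t' - t\<bar>)"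
    if ts: "t \<le> s" "t' \<le> s'" "s \<le> s'" for s t s' t'
  proof -
    have pos: "0 \<le> \<delta> * m * (s' - s)" "0 \<le> m * (s' - s)"
      using ts \<delta> m by auto
    show ?thesis
    proof (cases "t \<le> t'")
      case True
      then have e: "W * M * (\<bar>s' - s\<bar> + \<bar>t' - t\<bar>) = W * M * (s' - s) + W * M * (t' - t)"
        "M * (\<bar>s' - s\<bar> + \<bar>t' - t\<bar>) = M * (s' - s) + M * (t' - t)"
        using ts by (auto simp: algebra_simps)
      have pos': "0 \<le> \<delta> * m * (t' - t)" "0 \<le> m * (t' - t)" using True \<delta> m by auto
      show ?thesis
        unfolding e abs_le_iff
        using x_increments[OF ts(1,3)] x_increments'[OF True ts(2)] y_increments[OF ts(1,3)] y_increments'[OF True ts(2)] pos pos'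
        by (intro conjI; linarith)
    next
      case False
      then have tt: "t' \<le> t" "t \<le> s'" using ts by auto
      have e: "W * M * (\<bar>s' - s\<bar> + \<bar>t' - t\<bar>) = W * M * (s' - s) + W * M * (t - t')"
        "M * (\<bar>s' - s\<bar> + \<bar>t' - t\<bar>) = M * (s' - s) + M * (t - t')"
        using ts tt by (auto simp: algebra_simps)
      have pos': "0 \<le> \<delta> * m * (t - t')" "0 \<le> m * (t - t')" using tt \<delta> m by auto
      show ?thesis
        unfolding e abs_le_iff
        using x_increments[OF ts(1,3)] x_increments'[OF tt] y_increments[OF ts(1,3)] y_increments'[OF tt] pos pos'
        by (intro conjI; linarith)
    qed
  qed
  have lip: "\<bar>f r' - f r\<bar> \<le> (2 * c) * dist r r'"
    if "\<And>s t s' t'. t \<le> s \<Longrightarrow> t' \<le> s' \<Longrightarrow> s \<le> s' \<Longrightarrow> \<bar>f (s', t') - f (s, t)\<bar> \<le> c * (\<bar>s' - s\<bar> + \<bar>t' - t\<bar>)" "c \<ge> 0"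
      "r \<in> halfplane" "r' \<in> halfplane" for f :: "real \<times> real \<Rightarrow> real" and c r r'
  proof -
    have "\<bar>f r' - f r\<bar> \<le> c * (\<bar>fst r' - fst r\<bar> + \<bar>snd r' - snd r\<bar>)"
      using that(1)[of "snd r" "fst r" "snd r'" "fst r'"] that(1)[of "snd r'" "fst r'" "snd r" "fst r"] that(3,4)
      by (cases "fst r \<le> fst r'") (auto simp: halfplane_def abs_minus_commute)
    also have "\<dots> \<le> c * (dist r r' + dist r r')"
      using that(2) dist_fst_le[of r r'] dist_snd_le[of r r']
      by (intro mult_left_mono add_mono) (auto simp: dist_real_def abs_minus_commute)
    finally show ?thesis by (simp add: algebra_simps)
  qed
  have WM: "W * M \<ge> 0" "M \<ge> 0" using W M by auto
  have "(2 * (W * M))-lipschitz_on halfplane x" "(2 * M)-lipschitz_on halfplane y"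
    using lip[of x "W * M"] lip[of y M] main WM
    by (auto intro!: lipschitz_onI simp: dist_real_def abs_minus_commute)
  then show ?thesis
    unfolding T_def by (intro continuous_on_Pair lipschitz_on_continuous_on)
qed

text \<open>Properness: the height above the initial line bounds the distance \<open>s - t\<close>
  to the diagonal, and \<open>x\<close> lies between \<open>t\<close> and \<open>s\<close>.
  Compactly supported functions thus pull back to functions living on a bounded triangle.\<close>

lemma T_support:
  assumes "t \<le> s" "\<bar>x (s, t)\<bar> \<le> \<rho>" "y (s, t) \<le> \<rho>"
  shows "- (\<rho> + (\<rho> + y0) / m) \<le> t" "s \<le> \<rho> + (\<rho> + y0) / m"
proof -
  have "m * (s - t) \<le> \<rho> + y0"
    using y_increments(1)[of t t s] assms by (simp add: y_init)
  then have st: "s - t \<le> (\<rho> + y0) / m" using m by (simp add: field_simps)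
  have "0 \<le> \<delta> * m * (s - t)" using assms \<delta> m by simp
  then have "t \<le> x (s, t)" "x (s, t) \<le> s"
    using x_increments(1)[of t t s] x_increments'(1)[of t s s] assms by (auto simp: x_init)
  then show "- (\<rho> + (\<rho> + y0) / m) \<le> t" "s \<le> \<rho> + (\<rho> + y0) / m"
    using st assms by linarith+
qed

text \<open>The derivative of \<phi> composed with \<open>T\<close> in the first coordinate;
  \<open>along_snd\<close> is its counterpart.\<close>

definition along_fst :: "(real \<times> real \<Rightarrow> real) \<Rightarrow> (real \<times> real \<Rightarrow> real) \<Rightarrow> real \<times> real \<Rightarrow> real"
  where "along_fst \<phi>x \<phi>y r = \<phi>x (T r) * (w r * p r) + \<phi>y (T r) * p r"

definition along_snd :: "(real \<times> real \<Rightarrow> real) \<Rightarrow> (real \<times> real \<Rightarrow> real) \<Rightarrow> real \<times> real \<Rightarrow> real"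
  where "along_snd \<phi>x \<phi>y r = \<phi>x (T r) * - (z r * q r) + \<phi>y (T r) * - q r"

text \<open>Stokes for \<phi>(T) (U d\<alpha> + V d\<beta>). Only U_\<beta> and V_\<alpha> occur, so
  \<open>U\<close> and \<open>V\<close> need just the one-sided regularity that the unknowns
  possess.\<close>

lemma weak_formulation:
  assumes \<phi>: "C1_test \<phi> \<phi>x \<phi>y \<rho>" and U: "snd_primitive U U2" and V: "fst_primitive V V1"
  shows "set_integrable lborel halfplane (\<lambda>r. along_fst \<phi>x \<phi>y r * V r - along_snd \<phi>x \<phi>y r * U r)"
    "set_integrable lborel halfplane (\<lambda>r. \<phi> (T r) * (V1 r - U2 r))"
    "(LBINT r:halfplane. along_fst \<phi>x \<phi>y r * V r - along_snd \<phi>x \<phi>y r * U r)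
      + (LINT s|lborel. \<phi> (s, - y0) * (U (s, s) + V (s, s))) = - (LBINT r:halfplane. \<phi> (T r) * (V1 r - U2 r))"
proof -
  have d: "\<And>P. (\<phi> has_derivative (\<lambda>h. \<phi>x P * fst h + \<phi>y P * snd h)) (at P)"
    and c: "continuous_on UNIV \<phi>x" "continuous_on UNIV \<phi>y"
    and z0: "\<And>X Y. \<bar>X\<bar> > \<rho> \<or> Y > \<rho> \<Longrightarrow> \<phi> (X, Y) = 0 \<and> \<phi>x (X, Y) = 0 \<and> \<phi>y (X, Y) = 0"
    using \<phi> unfolding C1_test_def by blast+
  have 1: "fst_primitive (\<lambda>r. \<phi> (T r)) (along_fst \<phi>x \<phi>y)"
    unfolding along_fst_def[abs_def] T_def by (rule fst_primitive_compose[OF x_fst y_fst d c])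
  have 2: "snd_primitive (\<lambda>r. \<phi> (T r)) (along_snd \<phi>x \<phi>y)"
    unfolding along_snd_def[abs_def] T_def by (rule snd_primitive_compose[OF x_snd y_snd d c])
  have 3: "- (\<rho> + (\<rho> + y0) / m) \<le> t \<and> s \<le> \<rho> + (\<rho> + y0) / m"
    if "t \<le> s" "\<phi> (T (s, t)) \<noteq> 0 \<or> along_fst \<phi>x \<phi>y (s, t) \<noteq> 0 \<or> along_snd \<phi>x \<phi>y (s, t) \<noteq> 0" for s t
  proof -
    have "\<bar>x (s, t)\<bar> \<le> \<rho> \<and> y (s, t) \<le> \<rho>"
    proof (rule ccontr)
      assume "\<not> (\<bar>x (s, t)\<bar> \<le> \<rho> \<and> y (s, t) \<le> \<rho>)"
      then have "\<bar>x (s, t)\<bar> > \<rho> \<or> y (s, t) > \<rho>" by auto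
      from z0[OF this] that(2) show False unfolding T_def along_fst_def along_snd_def by simp
    qed
    then show ?thesis using T_support[OF that(1)] by blast
  qed
  note S = halfplane_Stokes[OF 1 2 U V 3]
  show "set_integrable lborel halfplane (\<lambda>r. along_fst \<phi>x \<phi>y r * V r - along_snd \<phi>x \<phi>y r * U r)"
    "set_integrable lborel halfplane (\<lambda>r. \<phi> (T r) * (V1 r - U2 r))"
    "(LBINT r:halfplane. along_fst \<phi>x \<phi>y r * V r - along_snd \<phi>x \<phi>y r * U r)
      + (LINT s|lborel. \<phi> (s, - y0) * (U (s, s) + V (s, s))) = - (LBINT r:halfplane. \<phi> (T r) * (V1 r - U2 r))"
    using S by (simp_all add: T_def x_init y_init)
qed

text \<open>For the closed form dx the right-hand side of Stokes vanishes, and d(\<phi> dx) leaves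
  only the term with \<phi>y times the Jacobian. On the diagonal dx = ds.\<close>

lemma area_identity:
  assumes \<phi>: "C1_test \<phi> \<phi>x \<phi>y \<rho>"
  shows "set_integrable lborel halfplane (\<lambda>r. \<phi>y (T r) * J r)"
    "(LBINT r:halfplane. \<phi>y (T r) * J r) = - (LINT s|lborel. \<phi> (s, - y0))"
proof -
  obtain R where R: "snd_primitive (\<lambda>r. w r * p r) R" "fst_primitive (\<lambda>r. - z r * q r) R"
    using mixed_derivative_x[OF w_snd z_fst p_snd q_fst] by blast
  have eq: "along_fst \<phi>x \<phi>y r * (- z r * q r) - along_snd \<phi>x \<phi>y r * (w r * p r) = \<phi>y (T r) * J r" for r
    by (simp add: J_def along_fst_def along_snd_def algebra_simps)
  have diag: "w (s, s) * p (s, s) + - z (s, s) * q (s, s) = 1" for s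
  proof -
    have "w0 s - z0 s \<noteq> 0" using w0(1)[of s] z0(2)[of s] \<delta> by auto
    then show ?thesis unfolding w_init z_init p_init q_init by (simp add: diff_divide_distrib[symmetric])
  qed
  note wf = weak_formulation[OF \<phi> R, unfolded eq diag]
  show "set_integrable lborel halfplane (\<lambda>r. \<phi>y (T r) * J r)" by (rule wf(1))
  show "(LBINT r:halfplane. \<phi>y (T r) * J r) = - (LINT s|lborel. \<phi> (s, - y0))"
    using wf(3) by simp
qed

end

section \<open>Bump functions and identification of measures\<close>

lemma DERIV_pos_part_squared:
  "((\<lambda>x. (max 0 x)\<^sup>2) has_real_derivative 2 * max 0 x) (at (x :: real))"
proof -
  consider "x > 0" | "x < 0" | "x = 0" by linarith
  then show ?thesis
  proof cases
    case 1
    have "((\<lambda>x. x\<^sup>2) has_real_derivative 2 * max 0 x) (at x)"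
      using 1 by (auto intro!: derivative_eq_intros)
    then show ?thesis
      by (rule has_field_derivative_transform_within_open[where S = "{0<..}"]) (use 1 in auto)
  next
    case 2
    have "((\<lambda>x. 0) has_real_derivative 2 * max 0 x) (at x)"
      using 2 by (auto intro!: derivative_eq_intros)
    then show ?thesis
      by (rule has_field_derivative_transform_within_open[where S = "{..<0}"]) (use 2 in auto)
  next
    case 3
    have "((\<lambda>h :: real. (max 0 h)\<^sup>2 / h) \<longlongrightarrow> 0) (at 0)"
    proof (rule Lim_null_comparison)
      show "\<forall>\<^sub>F h in at 0. norm ((max 0 h)\<^sup>2 / h) \<le> \<bar>h\<bar>" for h :: real
        by (auto simp: eventually_at_filter max_def power2_eq_square)
      show "((\<lambda>h :: real. \<bar>h\<bar>) \<longlongrightarrow> 0) (at 0)"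
        by (rule tendsto_eq_intros | simp)+
    qed
    then show ?thesis using 3 by (simp add: DERIV_def)
  qed
qed

text \<open>The squared positive parts make this continuously differentiable with support in
  \<open>[l, u]\<close>, and the exponential makes it increase with \<open>n\<close> to the
  indicator of the open interval.\<close>

definition bump :: "real \<Rightarrow> real \<Rightarrow> nat \<Rightarrow> real \<Rightarrow> real"
  where "bump l u n x = 1 - exp (- (real n * ((max 0 (x - l))\<^sup>2 * (max 0 (u - x))\<^sup>2)))"

definition bump' :: "real \<Rightarrow> real \<Rightarrow> nat \<Rightarrow> real \<Rightarrow> real"
  where "bump' l u n x = exp (- (real n * ((max 0 (x - l))\<^sup>2 * (max 0 (u - x))\<^sup>2)))
    * (real n * (2 * max 0 (x - l) * (max 0 (u - x))\<^sup>2 - (max 0 (x - l))\<^sup>2 * (2 * max 0 (u - x))))"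

lemma DERIV_bump: "(bump l u n has_real_derivative bump' l u n x) (at x)"
proof -
  have 1: "((\<lambda>x. (max 0 (x - l))\<^sup>2) has_real_derivative 2 * max 0 (x - l)) (at x)"
  proof -
    have "((\<lambda>x. x - l) has_real_derivative 1) (at x)" by (auto intro!: derivative_eq_intros)
    from DERIV_chain2[OF DERIV_pos_part_squared this] show ?thesis by simp
  qed
  have 2: "((\<lambda>x. (max 0 (u - x))\<^sup>2) has_real_derivative - (2 * max 0 (u - x))) (at x)"
  proof -
    have "((\<lambda>x. u - x) has_real_derivative - 1) (at x)" by (auto intro!: derivative_eq_intros)
    from DERIV_chain2[OF DERIV_pos_part_squared this] show ?thesis by simp
  qed
  show ?thesis
    unfolding bump_def[abs_def] bump'_def
    by (rule derivative_eq_intros 1 2 refl | simp add: algebra_simps)+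
qed

lemma continuous_bump: "continuous_on S (bump l u n)" "continuous_on S (bump' l u n)"
  unfolding bump_def[abs_def] bump'_def[abs_def] by (intro continuous_intros)+

lemma bump_outside: "x \<le> l \<or> u \<le> x \<Longrightarrow> bump l u n x = 0" "x \<le> l \<or> u \<le> x \<Longrightarrow> bump' l u n x = 0"
  by (auto simp: bump_def bump'_def max_def)

lemma bump_bounds: "0 \<le> bump l u n x" "bump l u n x \<le> 1"
  by (auto simp: bump_def)

lemma bump_mono: "n \<le> n' \<Longrightarrow> bump l u n x \<le> bump l u n' x"
  unfolding bump_def by (auto intro!: mult_right_mono)

lemma bump_tendsto: "(\<lambda>n. bump l u n x) \<longlonglongrightarrow> indicator {l<..<u} x"
proof (cases "x \<in> {l<..<u}")
  case True
  define c where "c = (max 0 (x - l))\<^sup>2 * (max 0 (u - x))\<^sup>2"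
  have "c > 0" using True by (auto simp: c_def intro!: mult_pos_pos)
  have "(\<lambda>n. (exp (- c)) ^ n) \<longlonglongrightarrow> 0"
    using \<open>c > 0\<close> by (intro LIMSEQ_realpow_zero) auto
  then have "(\<lambda>n. 1 - (exp (- c)) ^ n) \<longlonglongrightarrow> 1 - 0"
    by (rule tendsto_diff[OF tendsto_const])
  then show ?thesis
    using True unfolding bump_def c_def[symmetric] exp_of_nat_mult[symmetric] by simp
next
  case False
  then have "bump l u n x = 0" for n by (intro bump_outside) auto
  then show ?thesis using False by simp
qed

lemma bump_measurable [measurable]: "bump l u n \<in> borel_measurable borel"
  by (intro borel_measurable_continuous_onI continuous_bump)

lemma integrable_bump:
  assumes [measurable]: "S \<in> sets borel"
  shows "integrable lborel (\<lambda>x. indicator S x * bump l u n x)"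
proof -
  have le: "norm (indicator S x * bump l u n x) \<le> 1" for x
    using bump_bounds[of l u n x] by (simp add: indicator_def)
  have "integrable lborel (\<lambda>x. indicator {l..u} x *\<^sub>R (indicator S x * bump l u n x))"
  proof (rule integrableI_bounded_set_indicator[where B = 1])
    show "(\<lambda>x. indicator S x * bump l u n x) \<in> borel_measurable lborel"
      by measurable
  qed (use le in \<open>simp_all add: emeasure_lborel_Icc_eq\<close>)
  also have "(\<lambda>x. indicator {l..u} x *\<^sub>R (indicator S x * bump l u n x)) = (\<lambda>x. indicator S x * bump l u n x)"
  proof
    fix x
    show "indicator {l..u} x *\<^sub>R (indicator S x * bump l u n x) = indicator S x * bump l u n x"
      using bump_outside(1)[of x l u n] by (cases "x \<in> {l..u}") auto
  qed
  finally show ?thesis .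
qed

text \<open>Products of bumps increase to indicators of open boxes, so monotone convergence yields
  agreement on boxes, a generator of the Borel sets that is stable under intersection.\<close>

lemma measure_eqI_bump:
  fixes M N :: "(real \<times> real) measure"
  assumes sets: "sets M = sets borel" "sets N = sets borel"
    and fin: "\<And>a b. emeasure M (box a b) \<noteq> \<infinity>"
    and eq: "\<And>l1 u1 l2 u2 n. (\<integral>\<^sup>+P. ennreal (bump l1 u1 n (fst P) * bump l2 u2 n (snd P)) \<partial>M)
       = (\<integral>\<^sup>+P. ennreal (bump l1 u1 n (fst P) * bump l2 u2 n (snd P)) \<partial>N)"
  shows "M = N"
proof (rule measure_eqI_generator_eq)
  let ?E = "range (\<lambda>(a, b). box a b :: (real \<times> real) set)"
  show "Int_stable ?E"
    by (auto simp: Int_stable_def box_Int_box)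
  show "?E \<subseteq> Pow UNIV" by simp
  show "sets M = sigma_sets UNIV ?E" "sets N = sigma_sets UNIV ?E"
    unfolding sets by (simp_all add: borel_eq_box)
  define D where "D = (\<lambda>i. box (- real i, - real i) (real i, real i))"
  show "range D \<subseteq> ?E" by (auto simp: D_def)
  show "(\<Union>i. D i) = UNIV"
  proof -
    have "\<exists>i. P \<in> D i" for P :: "real \<times> real"
    proof -
      obtain i :: nat where "\<bar>fst P\<bar> + \<bar>snd P\<bar> < real i" using reals_Archimedean2 by blast
      then show ?thesis by (intro exI[of _ i]) (cases P; auto simp: D_def mem_box Basis_prod_def)
    qed
    then show ?thesis by blast
  qed
  show "emeasure M (D i) \<noteq> \<infinity>" for i unfolding D_def by (rule fin)
  fix X assume "X \<in> ?E"
  then obtain l1 l2 u1 u2 where X: "X = box (l1, l2) (u1, u2)" by auto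
  define F where "F = (\<lambda>n P. ennreal (bump l1 u1 n (fst P) * bump l2 u2 n (snd P)))"
  have lim: "(\<lambda>n. \<integral>\<^sup>+P. F n P \<partial>Q) \<longlonglongrightarrow> emeasure Q X" if "sets Q = sets borel" for Q
  proof -
    have "(\<lambda>n. \<integral>\<^sup>+P. F n P \<partial>Q) \<longlonglongrightarrow> (\<integral>\<^sup>+P. indicator X P \<partial>Q)"
    proof (rule nn_integral_LIMSEQ)
      show "incseq F"
        unfolding F_def incseq_def le_fun_def
        by (intro allI impI ennreal_leI mult_mono bump_mono bump_bounds) auto
      have "F i \<in> borel_measurable borel" for i
        unfolding F_def borel_prod[symmetric] by measurable
      then show "F i \<in> borel_measurable Q" for i
        using measurable_cong_sets[OF that refl] by blast
      show "(\<lambda>i. F i P) \<longlonglongrightarrow> indicator X P" for P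
      proof -
        have "(\<lambda>i. F i P) \<longlonglongrightarrow> ennreal (indicator {l1<..<u1} (fst P) * indicator {l2<..<u2} (snd P))"
          unfolding F_def by (intro tendsto_ennrealI tendsto_mult bump_tendsto)
        also have "ennreal (indicator {l1<..<u1} (fst P) * indicator {l2<..<u2} (snd P)) = indicator X P"
          unfolding X by (cases P) (auto simp: indicator_def mem_box Basis_prod_def)
        finally show ?thesis .
      qed
    qed
    also have "(\<integral>\<^sup>+P. indicator X P \<partial>Q) = emeasure Q X"
      by (rule nn_integral_indicator) (simp add: that X)
    finally show ?thesis .
  qed
  have "(\<lambda>n. \<integral>\<^sup>+P. F n P \<partial>M) \<longlonglongrightarrow> emeasure N X"
    using lim[OF sets(2)] eq unfolding F_def by simp
  then show "emeasure M X = emeasure N X"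
    using LIMSEQ_unique[OF lim[OF sets(1)]] by simp
qed

lemma antiderivative_exists:
  fixes g :: "real \<Rightarrow> real"
  assumes "continuous_on UNIV g"
  obtains G where "\<And>y. (G has_real_derivative g y) (at y)"
proof -
  have "isCont g y" for y using assms continuous_on_eq_continuous_at by blast
  then obtain G where "\<forall>y. (- \<infinity> :: ereal) < ereal y \<longrightarrow> ereal y < \<infinity> \<longrightarrow> (G has_vector_derivative g y) (at y)"
    using einterval_antiderivative[of "- \<infinity>" "\<infinity>" g] by auto
  then show thesis
    using that[of G] by (simp add: has_real_derivative_iff_has_vector_derivative)
qed

context characteristic_solution
begin

definition image_measure :: "(real \<times> real) measure"
  where "image_measure = distr (density lborel (\<lambda>r. ennreal (indicator halfplane r * J r))) borel T"

definition upper_measure :: "(real \<times> real) measure"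
  where "upper_measure = density lborel (\<lambda>P. ennreal (indicator {P. - y0 \<le> snd P} P))"

lemma upper_sets [measurable]: "{P :: real \<times> real. - y0 \<le> snd P} \<in> sets borel"
  by (intro borel_closed closed_Collect_le continuous_intros)

lemma indicator_J_nonneg: "0 \<le> indicator halfplane r * J r"
  using J_pos[of r] by (auto simp: indicator_def)

text \<open>\<open>J\<close> is the Jacobian of \<open>T\<close>. Since \<open>T\<close> is merely Lipschitz, this is derived from
  Stokes' theorem, tested with \<open>F(x) \<integral>\<^sub>y\<^sup>\<infinity> g\<close> for bumps \<open>F\<close>, \<open>g\<close> increasing to
  indicators of intervals.\<close>

lemma image_measure_eq: "image_measure = upper_measure"
proof (rule measure_eqI_bump[symmetric])
  show "sets upper_measure = sets borel" "sets image_measure = sets borel"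
    by (simp_all add: upper_measure_def image_measure_def)
  show "emeasure upper_measure (box a b) \<noteq> \<infinity>" for a b
  proof -
    have "emeasure upper_measure (box a b) \<le> (\<integral>\<^sup>+P. indicator (box a b) P \<partial>lborel)"
    proof -
      have "emeasure upper_measure (box a b) = (\<integral>\<^sup>+P. ennreal (indicator {P. - y0 \<le> snd P} P) * indicator (box a b) P \<partial>lborel)"
        unfolding upper_measure_def by (subst emeasure_density) simp_all
      also have "\<dots> \<le> (\<integral>\<^sup>+P. indicator (box a b) P \<partial>lborel)"
        by (intro nn_integral_mono) (simp add: indicator_def)
      finally show ?thesis .
    qed
    also have "\<dots> < \<infinity>" by (simp add: emeasure_lborel_box_eq less_top[symmetric])
    finally show ?thesis by simp
  qed
  fix l1 u1 l2 u2 :: real and n :: nat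
  define f where "f = bump l1 u1 n"
  define g where "g = bump l2 u2 n"
  have fm[measurable]: "f \<in> borel_measurable borel" and gm[measurable]: "g \<in> borel_measurable borel"
    by (simp_all add: f_def g_def)
  have fg: "0 \<le> f s" "0 \<le> g s" for s by (simp_all add: f_def g_def bump_bounds)
  obtain G where G: "\<And>y. (G has_real_derivative g y) (at y)"
    using antiderivative_exists[OF continuous_bump(1)] unfolding g_def by blast
  have Gint: "(LBINT s:{r..t}. g s) = G t - G r" if "r \<le> t" for r t
  proof -
    have 1: "continuous_on {r..t} g" unfolding g_def by (rule continuous_bump(1))
    have 2: "(G has_vector_derivative g s) (at s within {r..t})" for s
      by (rule has_vector_derivative_at_within[OF G[unfolded has_real_derivative_iff_has_vector_derivative]])
    show ?thesis
      unfolding set_lebesgue_integral_def by (rule integral_FTC_atLeastAtMost[OF that 2 1])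
  qed
  have G_const: "G Y = G u2" if "u2 \<le> Y" for Y
  proof -
    have "(LBINT s:{u2..Y}. g s) = (LBINT s:{u2..Y}. 0)"
      by (intro set_lebesgue_integral_cong) (auto simp: g_def bump_outside)
    then show ?thesis using Gint[OF that] by simp
  qed
  have G_upper: "G u2 - G (- y0) = (LINT Y|lborel. indicator {- y0..} Y * g Y)"
  proof -
    define N where "N = max u2 (- y0)"
    have "(LINT Y|lborel. indicator {- y0..} Y * g Y) = (LBINT Y:{- y0..N}. g Y)"
      unfolding set_lebesgue_integral_def
      by (intro Bochner_Integration.integral_cong) (auto simp: indicator_def N_def g_def bump_outside not_le less_imp_le)
    also have "\<dots> = G N - G (- y0)" by (intro Gint) (simp add: N_def)
    also have "G N = G u2" by (intro G_const) (simp add: N_def)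
    finally show ?thesis by simp
  qed
  define \<rho> where "\<rho> = max \<bar>l1\<bar> (max \<bar>u1\<bar> \<bar>u2\<bar>)"
  \<comment> \<open>Since \<open>g\<close> vanishes beyond \<open>u2\<close>, the value
    \<open>G u2\<close> acts as the limit at infinity and \<open>G u2 - G Y\<close> is the full
    upper tail integral of \<open>g\<close>.\<close>
  define H where "H = (\<lambda>P :: real \<times> real. f (fst P) * (G u2 - G (snd P)))"
  define Hx where "Hx = (\<lambda>P :: real \<times> real. bump' l1 u1 n (fst P) * (G u2 - G (snd P)))"
  define Hy where "Hy = (\<lambda>P :: real \<times> real. - (f (fst P) * g (snd P)))"
  have Gc: "continuous_on UNIV G"
    using G DERIV_isCont by (auto intro!: continuous_at_imp_continuous_on)
  have "C1_test H Hx Hy \<rho>"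
    unfolding C1_test_def
  proof (intro conjI allI impI)
    fix P :: "real \<times> real"
    have 1: "((\<lambda>P :: real \<times> real. f (fst P)) has_derivative (\<lambda>h. bump' l1 u1 n (fst P) * fst h)) (at P)"
      using has_derivative_compose[OF has_derivative_fst[OF has_derivative_ident] DERIV_bump[of l1 u1 n, unfolded has_field_derivative_def], of P UNIV]
      by (simp add: f_def)
    have 2: "((\<lambda>P :: real \<times> real. G (snd P)) has_derivative (\<lambda>h. g (snd P) * snd h)) (at P)"
      using has_derivative_compose[OF has_derivative_snd[OF has_derivative_ident] G[unfolded has_field_derivative_def], of P UNIV]
      by simp
    show "(H has_derivative (\<lambda>h. Hx P * fst h + Hy P * snd h)) (at P)"
      unfolding H_def Hx_def Hy_def
      by (rule has_derivative_eq_rhs[OF has_derivative_mult[OF 1 has_derivative_diff[OF has_derivative_const 2]]])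
        (simp add: fun_eq_iff algebra_simps)
    show "continuous_on UNIV Hx"
      unfolding Hx_def by (intro continuous_intros continuous_on_compose2[OF continuous_bump(2)] continuous_on_compose2[OF Gc]) auto
    show "continuous_on UNIV Hy"
      unfolding Hy_def f_def g_def by (intro continuous_intros continuous_on_compose2[OF continuous_bump(1)]) auto
    fix X Y assume XY: "\<rho> < \<bar>X\<bar> \<or> \<rho> < Y"
    have "\<bar>l1\<bar> \<le> \<rho>" "\<bar>u1\<bar> \<le> \<rho>" "\<bar>u2\<bar> \<le> \<rho>" by (auto simp: \<rho>_def)
    then have "X \<le> l1 \<or> u1 \<le> X \<or> u2 \<le> Y" using XY by arith
    then consider "X \<le> l1 \<or> u1 \<le> X" | "u2 \<le> Y" by blast
    then have "H (X, Y) = 0 \<and> Hx (X, Y) = 0 \<and> Hy (X, Y) = 0"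
    proof cases
      case 1
      then show ?thesis by (simp add: H_def Hx_def Hy_def f_def bump_outside)
    next
      case 2
      then show ?thesis using G_const[OF 2] by (simp add: H_def Hx_def Hy_def g_def bump_outside)
    qed
    then show "H (X, Y) = 0" "Hx (X, Y) = 0" "Hy (X, Y) = 0" by auto
  qed
  note area = area_identity[OF this]
  have int: "set_integrable lborel halfplane (\<lambda>r. f (x r) * g (y r) * J r)"
    using area(1) unfolding Hy_def T_def set_integrable_def by simp
  have I: "(LBINT r:halfplane. f (x r) * g (y r) * J r) = (LINT s|lborel. f s) * (G u2 - G (- y0))"
    using area(2) unfolding Hy_def T_def H_def set_lebesgue_integral_def by simp
  have "(\<integral>\<^sup>+P. ennreal (f (fst P) * g (snd P)) \<partial>image_measure)
      = (\<integral>\<^sup>+r. ennreal (indicator halfplane r * J r) * ennreal (f (x r) * g (y r)) \<partial>lborel)"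
  proof -
    have m1: "(\<lambda>P :: real \<times> real. ennreal (f (fst P) * g (snd P))) \<in> borel_measurable borel"
      unfolding borel_prod[symmetric] by measurable
    have m2: "(\<lambda>r. ennreal (f (x r) * g (y r))) \<in> borel_measurable borel" by measurable
    show ?thesis
      unfolding image_measure_def
      by (subst nn_integral_distr, simp, simp add: m1, subst nn_integral_density) (simp_all add: T_def m2)
  qed
  also have "\<dots> = (\<integral>\<^sup>+r. ennreal (indicator halfplane r *\<^sub>R (f (x r) * g (y r) * J r)) \<partial>lborel)"
    using indicator_J_nonneg fg by (intro nn_integral_cong) (simp add: ennreal_mult[symmetric] mult_ac)
  also have "\<dots> = ennreal (LBINT r:halfplane. f (x r) * g (y r) * J r)"
    using int fg J_pos unfolding set_integrable_def set_lebesgue_integral_def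
    by (intro nn_integral_eq_integral) (auto simp: indicator_def less_imp_le intro!: always_eventually mult_nonneg_nonneg)
  also have "\<dots> = ennreal (LINT s|lborel. f s) * ennreal (LINT Y|lborel. indicator {- y0..} Y * g Y)"
    unfolding I G_upper using fg by (intro ennreal_mult Bochner_Integration.integral_nonneg) auto
  also have "\<dots> = (\<integral>\<^sup>+X. f X \<partial>lborel) * (\<integral>\<^sup>+Y. ennreal (indicator {- y0..} Y * g Y) \<partial>lborel)"
    using integrable_bump[of UNIV l1 u1 n] integrable_bump[of "{- y0..}" l2 u2 n] fg
    by (subst (1 2) nn_integral_eq_integral) (auto simp: f_def g_def)
  also have "\<dots> = (\<integral>\<^sup>+X. \<integral>\<^sup>+Y. ennreal (f X) * ennreal (indicator {- y0..} Y * g Y) \<partial>lborel \<partial>lborel)"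
    by (simp add: nn_integral_cmult nn_integral_multc)
  also have "\<dots> = (\<integral>\<^sup>+X. \<integral>\<^sup>+Y. (\<lambda>P. ennreal (indicator {P. - y0 \<le> snd P} P) * ennreal (f (fst P) * g (snd P))) (X, Y) \<partial>lborel \<partial>lborel)"
    using fg by (intro nn_integral_cong) (auto simp: indicator_def ennreal_mult)
  also have "\<dots> = (\<integral>\<^sup>+P. ennreal (indicator {P. - y0 \<le> snd P} P) * ennreal (f (fst P) * g (snd P)) \<partial>(lborel \<Otimes>\<^sub>M lborel))"
    by (rule lborel.nn_integral_fst) (measurable; simp add: borel_prod)
  also have "\<dots> = (\<integral>\<^sup>+P. ennreal (f (fst P) * g (snd P)) \<partial>upper_measure)"
  proof -
    have "(\<lambda>P :: real \<times> real. ennreal (f (fst P) * g (snd P))) \<in> borel_measurable borel"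
      unfolding borel_prod[symmetric] by measurable
    then show ?thesis
      unfolding upper_measure_def lborel_prod by (subst nn_integral_density) simp_all
  qed
  finally show "(\<integral>\<^sup>+P. ennreal (bump l1 u1 n (fst P) * bump l2 u2 n (snd P)) \<partial>upper_measure)
      = (\<integral>\<^sup>+P. ennreal (bump l1 u1 n (fst P) * bump l2 u2 n (snd P)) \<partial>image_measure)"
    unfolding f_def g_def by simp
qed

text \<open>Integrability is not a premise: both sides integrate a measurable function against
  measures already shown to be equal. The separate \<open>G\<close> lets the transformed integrand
  be simplified on the half-plane, where the bounds hold.\<close>

lemma change_of_variables:
  fixes F G :: "real \<times> real \<Rightarrow> real"
  assumes [measurable]: "F \<in> borel_measurable borel"
    and G: "\<And>r. r \<in> halfplane \<Longrightarrow> J r * F (T r) = G r"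
  shows "(LBINT P:{P. - y0 \<le> snd P}. F P) = (LBINT r:halfplane. G r)"
proof -
  have "(LBINT P:{P. - y0 \<le> snd P}. F P) = integral\<^sup>L upper_measure F"
    unfolding upper_measure_def set_lebesgue_integral_def by (subst integral_density) auto
  also have "\<dots> = integral\<^sup>L (density lborel (\<lambda>r. ennreal (indicator halfplane r * J r))) (\<lambda>r. F (T r))"
    unfolding image_measure_eq[symmetric] image_measure_def by (subst integral_distr) auto
  also have "\<dots> = (LBINT r:halfplane. J r * F (T r))"
    unfolding set_lebesgue_integral_def
    by (subst integral_density) (auto simp: indicator_J_nonneg mult.assoc)
  also have "\<dots> = (LBINT r:halfplane. G r)"
    using G by (intro set_lebesgue_integral_cong) auto
  finally show ?thesis .
qed

section \<open>Functions carried from the half-plane to the (x, y)-plane\<close>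

text \<open>Composition with the inverse of \<open>T\<close>; the default \<open>d\<close> makes it
  a total function, so that bounds and algebraic identities can hold at every point.\<close>

definition transplant :: "real \<Rightarrow> (real \<times> real \<Rightarrow> real) \<Rightarrow> real \<times> real \<Rightarrow> real"
  where "transplant d h P = (if P \<in> T ` halfplane then h (the_inv_into halfplane T P) else d)"

lemma transplant_T: "r \<in> halfplane \<Longrightarrow> transplant d h (T r) = h r"
  unfolding transplant_def by (simp add: the_inv_into_f_f[OF T_inj])

text \<open>The half-plane is a countable union of compact sets, and continuous images of these are
  compact.\<close>

lemma image_T_sets [measurable]: "T ` halfplane \<in> sets borel"
proof -
  have "halfplane = (\<Union>n. halfplane \<inter> cball 0 (real n))"
    using real_arch_simple by (auto simp: dist_norm)
  then have "T ` halfplane = (\<Union>n. T ` (halfplane \<inter> cball 0 (real n)))"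
    by (metis image_UN)
  moreover have "compact (T ` (halfplane \<inter> cball 0 (real n)))" for n
    using closed_halfplane
    by (intro compact_continuous_image continuous_on_subset[OF T_continuous]) (auto intro: closed_Int_compact)
  then have "T ` (halfplane \<inter> cball 0 (real n)) \<in> sets borel" for n
    by (intro borel_closed compact_imp_closed)
  ultimately show ?thesis by auto
qed

lemma transplant_measurable:
  assumes [measurable]: "h \<in> borel_measurable borel"
  shows "transplant d h \<in> borel_measurable borel"
proof -
  define k where "k = m * min 1 \<delta>"
  have k: "k > 0" using m \<delta> by (simp add: k_def)
  have "(1 / k)-lipschitz_on (T ` halfplane) (the_inv_into halfplane T)"
  proof (rule lipschitz_onI)
    fix P P' assume "P \<in> T ` halfplane" "P' \<in> T ` halfplane"
    then obtain r r' where r: "r \<in> halfplane" "r' \<in> halfplane" "P = T r" "P' = T r'" by blast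
    then show "dist (the_inv_into halfplane T P) (the_inv_into halfplane T P') \<le> 1 / k * dist P P'"
      using T_expansive[OF r(1,2)] k by (simp add: the_inv_into_f_f[OF T_inj] k_def field_simps)
  qed (use k in simp)
  then have c: "continuous_on (T ` halfplane) (the_inv_into halfplane T)"
    by (rule lipschitz_on_continuous_on)
  have [measurable]: "(\<lambda>P. if P \<in> T ` halfplane then the_inv_into halfplane T P else 0) \<in> borel_measurable borel"
    by (rule borel_measurable_continuous_on_if[OF image_T_sets c]) simp
  have "transplant d h = (\<lambda>P. if P \<in> T ` halfplane then h (if P \<in> T ` halfplane then the_inv_into halfplane T P else 0) else d)"
    by (simp add: transplant_def fun_eq_iff)
  also have "\<dots> \<in> borel_measurable borel" by measurable
  finally show ?thesis .
qed

lemma transplant_bounds: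
  assumes "\<And>r. r \<in> halfplane \<Longrightarrow> lo \<le> h r \<and> h r \<le> hi" "lo \<le> d" "d \<le> hi"
  shows "lo \<le> transplant d h P" "transplant d h P \<le> hi"
proof -
  have "lo \<le> transplant d h P \<and> transplant d h P \<le> hi"
  proof (cases "P \<in> T ` halfplane")
    case True
    then obtain r where "r \<in> halfplane" "P = T r" by blast
    then show ?thesis using assms(1) by (simp add: transplant_T)
  next
    case False
    then show ?thesis using assms(2,3) by (simp add: transplant_def)
  qed
  then show "lo \<le> transplant d h P" "transplant d h P \<le> hi" by auto
qed

end

subsection \<open>The weak equations\<close>

context characteristic_solution
begin

text \<open>With \<open>g0 = \<gamma>(- y0)\<close> this is \<open>\<gamma>\<close> on \<open>[- y0, 0]\<close>, because \<open>\<gamma>\<close> is a constant times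
  \<open>E powr (- \<beta>\<^sup>2 / 2)\<close> and \<open>\<beta>\<^sup>2 = 2 + \<kappa>\<close>.\<close>

definition gamma_ext :: "real \<Rightarrow> real \<Rightarrow> real"
  where "gamma_ext g0 Y = g0 * exp ((2 + \<kappa>) * A Y)"

text \<open>The image of \<open>T\<close> has full measure; the values off it are chosen such that the
  Gauss equation and the bounds hold everywhere.\<close>

definition sol_U :: "real \<times> real \<Rightarrow> real"
  where "sol_U = transplant 0 (\<lambda>r. (w r + z r) / 2)"

definition sol_V :: "real \<times> real \<Rightarrow> real"
  where "sol_V = transplant 1 (\<lambda>r. (w r - z r) / 2)"

definition sol_L :: "real \<Rightarrow> real \<times> real \<Rightarrow> real"
  where "sol_L g0 P = gamma_ext g0 (snd P) / sol_V P"

definition sol_M :: "real \<Rightarrow> real \<times> real \<Rightarrow> real"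
  where "sol_M g0 P = - gamma_ext g0 (snd P) * sol_U P / sol_V P"

definition sol_N :: "real \<Rightarrow> real \<times> real \<Rightarrow> real"
  where "sol_N g0 P = gamma_ext g0 (snd P) * ((sol_U P)\<^sup>2 - (sol_V P)\<^sup>2) / sol_V P"

lemma A_continuous: "continuous_on UNIV A"
  using A DERIV_isCont by (auto intro!: continuous_at_imp_continuous_on)

lemma gamma_ext_measurable [measurable]: "gamma_ext g0 \<in> borel_measurable borel"
  unfolding gamma_ext_def[abs_def]
  by (intro borel_measurable_continuous_onI continuous_intros A_continuous)

lemma UV_measurable [measurable]: "sol_U \<in> borel_measurable borel" "sol_V \<in> borel_measurable borel"
  unfolding sol_U_def sol_V_def by (intro transplant_measurable; measurable)+

lemma snd_measurable [measurable]: "(snd :: real \<times> real \<Rightarrow> real) \<in> borel_measurable borel"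
  by (intro borel_measurable_continuous_onI continuous_intros)

lemma LMN_measurable [measurable]:
  "sol_L g0 \<in> borel_measurable borel" "sol_M g0 \<in> borel_measurable borel" "sol_N g0 \<in> borel_measurable borel"
  unfolding sol_L_def[abs_def] sol_M_def[abs_def] sol_N_def[abs_def] by measurable

lemma V_lower: "min \<delta> 1 \<le> sol_V P" and V_upper: "sol_V P \<le> max W 1"
  and U_lower: "- W \<le> sol_U P" and U_upper: "sol_U P \<le> W"
proof -
  have b: "min \<delta> 1 \<le> (w r - z r) / 2 \<and> (w r - z r) / 2 \<le> max W 1" "- W \<le> (w r + z r) / 2 \<and> (w r + z r) / 2 \<le> W"
    if "r \<in> halfplane" for r
    using w_bounds[OF that] z_bounds[OF that] \<delta> by (auto simp: min_def max_def)
  show "min \<delta> 1 \<le> sol_V P" "sol_V P \<le> max W 1"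
    unfolding sol_V_def using transplant_bounds[where lo = "min \<delta> 1" and hi = "max W 1" and d = 1, OF b(1)] by auto
  show "- W \<le> sol_U P" "sol_U P \<le> W"
    unfolding sol_U_def using transplant_bounds[where lo = "- W" and hi = W and d = 0, OF b(2)] W by auto
qed

lemma V_pos: "sol_V P > 0"
  using V_lower[of P] \<delta> by (smt (verit) min_def)

lemma gauss_equation: "sol_L g0 P * sol_N g0 P - (sol_M g0 P)\<^sup>2 = - (gamma_ext g0 (snd P))\<^sup>2"
  unfolding sol_L_def sol_N_def sol_M_def using V_pos[of P] by (simp add: field_simps power2_eq_square)

lemma LMN_bounded: "\<exists>B. \<forall>P. \<bar>sol_L g0 P\<bar> \<le> B \<and> \<bar>sol_M g0 P\<bar> \<le> B \<and> \<bar>sol_N g0 P\<bar> \<le> B"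
proof -
  define G where "G = \<bar>g0\<bar> * exp ((2 + \<kappa>) * Imax)"
  define D where "D = min \<delta> 1"
  have D: "D > 0" using \<delta> by (simp add: D_def)
  have G: "\<bar>gamma_ext g0 Y\<bar> \<le> G" for Y
    unfolding gamma_ext_def G_def abs_mult using A_le[of Y] \<kappa> by (intro mult_left_mono) auto
  have G0: "G \<ge> 0" by (simp add: G_def)
  define Q where "Q = 1 + W + (W\<^sup>2 + (max W 1)\<^sup>2)"
  have bound: "\<bar>gamma_ext g0 (snd P) * e / sol_V P\<bar> \<le> G * Q / D" if "\<bar>e\<bar> \<le> Q" for P e
  proof -
    have "\<bar>gamma_ext g0 (snd P)\<bar> * \<bar>e\<bar> \<le> G * Q"
      using G that G0 by (intro mult_mono) auto
    then have "\<bar>gamma_ext g0 (snd P)\<bar> * \<bar>e\<bar> / sol_V P \<le> G * Q / D"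
      using V_lower[of P] D that G0 by (intro frac_le) (auto simp: D_def)
    then show ?thesis using V_pos[of P] by (simp add: abs_mult)
  qed
  have Q: "\<bar>1\<bar> \<le> Q" "\<bar>- sol_U P\<bar> \<le> Q" "\<bar>(sol_U P)\<^sup>2 - (sol_V P)\<^sup>2\<bar> \<le> Q" for P
  proof -
    have "(sol_U P)\<^sup>2 \<le> W\<^sup>2" using U_lower[of P] U_upper[of P] by (intro abs_le_square_iff[THEN iffD1]) auto
    moreover have "(sol_V P)\<^sup>2 \<le> (max W 1)\<^sup>2" using V_pos[of P] V_upper[of P] by (intro power_mono) auto
    moreover have "\<bar>sol_U P\<bar> \<le> W" using U_lower[of P] U_upper[of P] by auto
    moreover have "0 \<le> (sol_U P)\<^sup>2" "0 \<le> (sol_V P)\<^sup>2" "0 < W" using W by auto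
    ultimately show "\<bar>1\<bar> \<le> Q" "\<bar>- sol_U P\<bar> \<le> Q" "\<bar>(sol_U P)\<^sup>2 - (sol_V P)\<^sup>2\<bar> \<le> Q" unfolding Q_def by linarith+
  qed
  show ?thesis
    using bound[OF Q(1)] bound[OF Q(2)] bound[OF Q(3)]
    by (intro exI[of _ "G * Q / D"]) (simp add: sol_L_def sol_M_def sol_N_def)
qed

definition gam :: "real \<Rightarrow> real \<times> real \<Rightarrow> real"
  where "gam g0 r = gamma_ext g0 (y r)"

lemma LMN_T:
  assumes "r \<in> halfplane"
  shows "sol_L g0 (T r) = 2 * gam g0 r / (w r - z r)"
    "sol_M g0 (T r) = - gam g0 r * (w r + z r) / (w r - z r)"
    "sol_N g0 (T r) = 2 * gam g0 r * (w r * z r) / (w r - z r)"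
proof -
  have d: "w r - z r > 0" using w_bounds[OF assms] z_bounds[OF assms] \<delta> by linarith
  have s: "((w r + z r) / 2)\<^sup>2 - ((w r - z r) / 2)\<^sup>2 = w r * z r"
    by (simp add: power2_eq_square field_simps)
  show "sol_L g0 (T r) = 2 * gam g0 r / (w r - z r)"
    "sol_M g0 (T r) = - gam g0 r * (w r + z r) / (w r - z r)"
    "sol_N g0 (T r) = 2 * gam g0 r * (w r * z r) / (w r - z r)"
    unfolding sol_L_def sol_M_def sol_N_def sol_U_def sol_V_def transplant_T[OF assms] s using d
    by (simp_all add: gam_def T_def)
qed

lemma gamma_ext_DERIV: "(gamma_ext g0 has_real_derivative (2 + \<kappa>) * a Y * gamma_ext g0 Y) (at Y)"
  unfolding gamma_ext_def[abs_def] by (rule derivative_eq_intros A refl | simp)+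

text \<open>The composition rule is stated for functions of two variables; here \<gamma> is one that
  is constant in the first.\<close>

lemma gamma_ext_snd_derivative:
  "((\<lambda>P :: real \<times> real. gamma_ext g0 (snd P)) has_derivative (\<lambda>h. 0 * fst h + ((2 + \<kappa>) * a (snd P) * gamma_ext g0 (snd P)) * snd h)) (at P)"
  using has_derivative_compose[OF has_derivative_snd[OF has_derivative_ident] gamma_ext_DERIV[of g0, unfolded has_field_derivative_def], of P UNIV]
  by simp

lemma gamma_ext_snd_continuous: "continuous_on UNIV (\<lambda>P :: real \<times> real. (2 + \<kappa>) * a (snd P) * gamma_ext g0 (snd P))"
  unfolding gamma_ext_def
  by (intro continuous_intros continuous_on_compose2[OF a_continuous] continuous_on_compose2[OF A_continuous]) auto

lemma gam_fst: "fst_primitive (gam g0) (\<lambda>r. (2 + \<kappa>) * a (y r) * gam g0 r * p r)"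
  using fst_primitive_compose[OF y_fst y_fst gamma_ext_snd_derivative[of g0] continuous_on_const gamma_ext_snd_continuous]
  by (simp add: gam_def[abs_def])

lemma gam_snd: "snd_primitive (gam g0) (\<lambda>r. - ((2 + \<kappa>) * a (y r) * gam g0 r * q r))"
  using snd_primitive_compose[OF y_snd y_snd gamma_ext_snd_derivative[of g0] continuous_on_const gamma_ext_snd_continuous]
  by (simp add: gam_def[abs_def])

text \<open>With U = \<gamma> p and V = \<gamma> q, the \<kappa> in \<gamma>_y = (2 + \<kappa>) a
  \<gamma> cancels the one in \<open>rate_p\<close>, so V_\<alpha> - U_\<beta> = 2 a \<gamma> p q (1
  - w z / c), which is J (a L - a N / c).\<close>

lemma first_equation:
  assumes \<phi>: "C1_test \<phi> \<phi>x \<phi>y \<rho>"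
  shows "(LBINT P:{P. - y0 \<le> snd P}. - sol_M g0 P * \<phi>x P + sol_L g0 P * \<phi>y P)
      + (LINT s|lborel. 2 * g0 / (w0 s - z0 s) * \<phi> (s, - y0))
    = (LBINT P:{P. - y0 \<le> snd P}. (- a (snd P) * sol_L g0 P + a (snd P) / c * sol_N g0 P) * \<phi> P)"
proof -
  note [measurable] = borel_measurable_continuous_onI[OF a_continuous]
  have c\<phi>: "continuous_on UNIV \<phi>" "continuous_on UNIV \<phi>x" "continuous_on UNIV \<phi>y"
    using \<phi> unfolding C1_test_def by (auto intro!: continuous_at_imp_continuous_on has_derivative_continuous)
  note [measurable] = c\<phi>[THEN borel_measurable_continuous_onI]
  note wf = weak_formulation[OF \<phi> snd_primitive_mult[OF gam_snd[of g0] p_snd] fst_primitive_mult[OF gam_fst[of g0] q_fst]]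
  have 1: "(LBINT P:{P. - y0 \<le> snd P}. - sol_M g0 P * \<phi>x P + sol_L g0 P * \<phi>y P)
    = (LBINT r:halfplane. along_fst \<phi>x \<phi>y r * (gam g0 r * q r)
        - along_snd \<phi>x \<phi>y r * (gam g0 r * p r))"
  proof (rule change_of_variables)
    fix r assume r: "r \<in> halfplane"
    have d: "w r - z r \<noteq> 0" using w_bounds[OF r] z_bounds[OF r] \<delta> by linarith
    show "J r * (- sol_M g0 (T r) * \<phi>x (T r) + sol_L g0 (T r) * \<phi>y (T r))
      = along_fst \<phi>x \<phi>y r * (gam g0 r * q r)
        - along_snd \<phi>x \<phi>y r * (gam g0 r * p r)"
      unfolding LMN_T[OF r] J_def along_fst_def along_snd_def using d by (simp add: divide_simps) (simp add: algebra_simps)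
  qed measurable
  have 2: "(LINT s|lborel. \<phi> (s, - y0) * (gam g0 (s, s) * p (s, s) + gam g0 (s, s) * q (s, s)))
    = (LINT s|lborel. 2 * g0 / (w0 s - z0 s) * \<phi> (s, - y0))"
    by (intro Bochner_Integration.integral_cong) (simp_all add: gam_def gamma_ext_def y_init A_init p_init q_init)
  have 3: "(LBINT P:{P. - y0 \<le> snd P}. (- a (snd P) * sol_L g0 P + a (snd P) / c * sol_N g0 P) * \<phi> P)
    = (LBINT r:halfplane. - (\<phi> (T r) * ((2 + \<kappa>) * a (y r) * gam g0 r * p r * q r + gam g0 r * - (a (y r) * rate_p (w r) (z r) * p r * q r)
       - (- ((2 + \<kappa>) * a (y r) * gam g0 r * q r) * p r + gam g0 r * (a (y r) * rate_p (w r) (z r) * p r * q r)))))"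
  proof (rule change_of_variables)
    fix r assume r: "r \<in> halfplane"
    have d: "w r - z r \<noteq> 0" using w_bounds[OF r] z_bounds[OF r] \<delta> by linarith
    have "J r * ((- a (y r) * (2 * gam g0 r / (w r - z r)) + a (y r) / c * (2 * gam g0 r * (w r * z r) / (w r - z r))) * \<phi> (T r))
      = p r * q r * ((- a (y r) * (2 * gam g0 r) + a (y r) / c * (2 * gam g0 r * (w r * z r))) * \<phi> (T r))"
      unfolding J_def using d c by (simp add: divide_simps)
    then show "J r * ((- a (snd (T r)) * sol_L g0 (T r) + a (snd (T r)) / c * sol_N g0 (T r)) * \<phi> (T r)) =
      - (\<phi> (T r) * ((2 + \<kappa>) * a (y r) * gam g0 r * p r * q r + gam g0 r * - (a (y r) * rate_p (w r) (z r) * p r * q r)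
       - (- ((2 + \<kappa>) * a (y r) * gam g0 r * q r) * p r + gam g0 r * (a (y r) * rate_p (w r) (z r) * p r * q r))))"
      unfolding LMN_T[OF r] by (simp add: T_def rate_p_def algebra_simps)
  qed measurable
  show ?thesis
    unfolding 1 3 using wf(3) unfolding 2 by (simp add: set_lebesgue_integral_def)
qed

text \<open>With U = - \<gamma> w p and V = - \<gamma> z q, the identity rate_w + rate_z = (w + z)
  (rate_p - \<kappa>) removes \<open>rate_p\<close> and \<kappa> from V_\<alpha> - U_\<beta>. What
  remains is -2 a \<gamma> p q (w + z) = 2 a J M.\<close>

lemma second_equation:
  assumes \<phi>: "C1_test \<phi> \<phi>x \<phi>y \<rho>"
  shows "(LBINT P:{P. - y0 \<le> snd P}. - sol_N g0 P * \<phi>x P + sol_M g0 P * \<phi>y P)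
      + (LINT s|lborel. - g0 * (w0 s + z0 s) / (w0 s - z0 s) * \<phi> (s, - y0))
    = (LBINT P:{P. - y0 \<le> snd P}. (2 * - a (snd P) * sol_M g0 P) * \<phi> P)"
proof -
  note [measurable] = borel_measurable_continuous_onI[OF a_continuous]
  have c\<phi>: "continuous_on UNIV \<phi>" "continuous_on UNIV \<phi>x" "continuous_on UNIV \<phi>y"
    using \<phi> unfolding C1_test_def by (auto intro!: continuous_at_imp_continuous_on has_derivative_continuous)
  note [measurable] = c\<phi>[THEN borel_measurable_continuous_onI]
  define X2 where "X2 = (\<lambda>r. - ((- ((2 + \<kappa>) * a (y r) * gam g0 r * q r) * p r + gam g0 r * (a (y r) * rate_p (w r) (z r) * p r * q r)) * w r
     + gam g0 r * p r * - (a (y r) * rate_w (w r) (z r) * q r)))"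
  define X1 where "X1 = (\<lambda>r. - (((2 + \<kappa>) * a (y r) * gam g0 r * p r * q r + gam g0 r * - (a (y r) * rate_p (w r) (z r) * p r * q r)) * z r
     + gam g0 r * q r * (a (y r) * rate_z (w r) (z r) * p r)))"
  have P2: "snd_primitive (\<lambda>r. - (gam g0 r * p r * w r)) X2"
    unfolding X2_def by (intro snd_primitive_minus snd_primitive_mult gam_snd p_snd w_snd)
  have P1: "fst_primitive (\<lambda>r. - (gam g0 r * q r * z r)) X1"
    unfolding X1_def by (intro fst_primitive_minus fst_primitive_mult gam_fst q_fst z_fst)
  have X: "X1 r - X2 r = - 2 * a (y r) * gam g0 r * p r * q r * (w r + z r)" for r
  proof -
    have "X1 r - X2 r = a (y r) * gam g0 r * p r * q r * (- (2 + \<kappa>) * (w r + z r) + rate_p (w r) (z r) * (w r + z r) - (rate_w (w r) (z r) + rate_z (w r) (z r)))"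
      unfolding X1_def X2_def by (simp add: algebra_simps)
    also have "rate_w (w r) (z r) + rate_z (w r) (z r) = (w r + z r) * (rate_p (w r) (z r) - \<kappa>)"
      unfolding rate_w_def rate_z_def rate_p_def using c by (simp add: field_simps)
    finally show ?thesis by (simp add: algebra_simps)
  qed
  note wf = weak_formulation[OF \<phi> P2 P1]
  have 1: "(LBINT P:{P. - y0 \<le> snd P}. - sol_N g0 P * \<phi>x P + sol_M g0 P * \<phi>y P)
    = (LBINT r:halfplane. along_fst \<phi>x \<phi>y r * - (gam g0 r * q r * z r)
        - along_snd \<phi>x \<phi>y r * - (gam g0 r * p r * w r))"
  proof (rule change_of_variables)
    fix r assume r: "r \<in> halfplane"
    have d: "w r - z r \<noteq> 0" using w_bounds[OF r] z_bounds[OF r] \<delta> by linarith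
    show "J r * (- sol_N g0 (T r) * \<phi>x (T r) + sol_M g0 (T r) * \<phi>y (T r))
      = along_fst \<phi>x \<phi>y r * - (gam g0 r * q r * z r)
        - along_snd \<phi>x \<phi>y r * - (gam g0 r * p r * w r)"
      unfolding LMN_T[OF r] J_def along_fst_def along_snd_def using d by (simp add: divide_simps) (simp add: algebra_simps)
  qed measurable
  have 2: "(LINT s|lborel. \<phi> (s, - y0) * (- (gam g0 (s, s) * p (s, s) * w (s, s)) + - (gam g0 (s, s) * q (s, s) * z (s, s))))
    = (LINT s|lborel. - g0 * (w0 s + z0 s) / (w0 s - z0 s) * \<phi> (s, - y0))"
    by (intro Bochner_Integration.integral_cong refl)
      (simp add: gam_def gamma_ext_def y_init A_init p_init q_init w_init z_init add_divide_distrib diff_divide_distrib algebra_simps)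
  have 3: "(LBINT P:{P. - y0 \<le> snd P}. (2 * - a (snd P) * sol_M g0 P) * \<phi> P)
    = (LBINT r:halfplane. - (\<phi> (T r) * (X1 r - X2 r)))"
  proof (rule change_of_variables)
    fix r assume r: "r \<in> halfplane"
    have d: "w r - z r \<noteq> 0" using w_bounds[OF r] z_bounds[OF r] \<delta> by linarith
    show "J r * ((2 * - a (snd (T r)) * sol_M g0 (T r)) * \<phi> (T r)) = - (\<phi> (T r) * (X1 r - X2 r))"
      unfolding LMN_T[OF r] J_def X using d by (simp add: T_def divide_simps)
  qed measurable
  show ?thesis
    unfolding 1 3 using wf(3) unfolding 2 by (simp add: set_lebesgue_integral_def)
qed

end

subsection \<open>Reduction to the characteristic system\<close>

lemma bounded_lipschitz_inverse:
  assumes f: "bounded_lipschitz f" and e: "e > 0" "\<And>x. e \<le> f x"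
  shows "bounded_lipschitz (\<lambda>x. 1 / f x)"
proof -
  obtain C where C: "C-lipschitz_on UNIV f"
    using f unfolding bounded_lipschitz_def by blast
  have pos: "f x > 0" for x using e(1) e(2)[of x] by linarith
  have "(C / (e * e))-lipschitz_on UNIV (\<lambda>x. 1 / f x)"
  proof (rule lipschitz_onI)
    fix x y
    have "\<bar>1 / f x - 1 / f y\<bar> = \<bar>f x - f y\<bar> / (f x * f y)"
      using pos[of x] pos[of y] by (simp add: field_simps abs_mult abs_divide abs_minus_commute)
    also have "\<dots> \<le> C * dist x y / (e * e)"
      using lipschitz_onD[OF C, of x y] lipschitz_on_nonneg[OF C] e pos
      by (intro frac_le mult_mono) (auto simp: dist_real_def less_imp_le)
    finally show "dist (1 / f x) (1 / f y) \<le> C / (e * e) * dist x y"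
      by (simp add: dist_real_def)
  qed (use lipschitz_on_nonneg[OF C] e in simp)
  moreover have "\<bar>1 / f x\<bar> \<le> 1 / e" for x
    using pos[of x] e by (simp add: frac_le)
  ultimately show ?thesis unfolding bounded_lipschitz_def by blast
qed

lemma bounded_lipschitz_clip_compose:
  assumes f: "C-lipschitz_on {lo..hi} f" and "lo \<le> hi"
  shows "bounded_lipschitz (\<lambda>r. f (clip lo hi r))"
proof -
  have sub: "clip lo hi ` UNIV \<subseteq> {lo..hi}" using clip_bounds[OF assms(2)] by auto
  have "(C * 1)-lipschitz_on UNIV (\<lambda>r. f (clip lo hi r))"
    by (rule lipschitz_on_compose2[OF lipschitz_on_clip lipschitz_on_subset[OF f sub]])
  moreover have "bounded (f ` {lo..hi})"
    using lipschitz_on_continuous_on[OF f] by (intro compact_imp_bounded compact_continuous_image) auto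
  then obtain B where "\<And>r. r \<in> {lo..hi} \<Longrightarrow> \<bar>f r\<bar> \<le> B"
    unfolding bounded_iff ball_simps(9) real_norm_def by blast
  then have "\<bar>f (clip lo hi r)\<bar> \<le> B" for r using sub by blast
  ultimately show ?thesis unfolding bounded_lipschitz_def by blast
qed

text \<open>Beyond \<open>y = 0\<close> the coefficient \<open>- E' / (2 E)\<close> is continued so as to vanish for large \<open>y\<close>;
  the problem can then be solved for all \<open>y \<ge> - y0\<close> with an antiderivative bounded above.\<close>

lemma extended_coefficient:
  fixes E E' :: "real \<Rightarrow> real"
  assumes y0: "y0 > 0"
    and E: "\<And>y. y \<in> {-y0..0} \<Longrightarrow> (E has_real_derivative E' y) (at y within {-y0..0})"
    and E'_lip: "\<exists>C. C-lipschitz_on {-y0..0} E'"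
    and E_pos: "\<And>y. y \<in> {-y0..0} \<Longrightarrow> E y > 0"
    and E'_neg: "\<And>y. y \<in> {-y0..<0} \<Longrightarrow> E' y < 0"
  obtains a A :: "real \<Rightarrow> real" and Amax Imax :: real
  where "\<exists>C. C-lipschitz_on UNIV a" "\<And>y. 0 \<le> a y" "\<And>y. a y \<le> Amax"
    "\<And>y. (A has_real_derivative a y) (at y)" "A (- y0) = 0" "\<And>y. A y \<le> Imax"
    "\<And>y. y \<in> {-y0..0} \<Longrightarrow> E' y = - 2 * a y * E y"
    "\<And>y. y \<in> {-y0..0} \<Longrightarrow> E y = E (- y0) * exp (- 2 * A y)"
proof -
  have cont: "continuous_on {-y0..0} E'"
    using E'_lip by (auto intro: lipschitz_on_continuous_on)
  \<comment> \<open>Negativity is given for y < 0 only; continuity of \<open>E'\<close> carries the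
    weak sign to y = 0.\<close>
  have E'_nonpos: "E' y \<le> 0" if "y \<in> {-y0..0}" for y
  proof -
    have "closure {-y0..<0} = {-y0..0}" using y0 by (simp add: closure_atLeastLessThan)
    then show ?thesis
      using continuous_le_on_closure[of "{-y0..<0}" E' y 0] cont that E'_neg by (auto simp: less_imp_le)
  qed
  have "bounded (E' ` {-y0..0})"
    using cont by (intro compact_imp_bounded compact_continuous_image) auto
  then obtain B where B: "\<And>y. y \<in> {-y0..0} \<Longrightarrow> \<bar>E' y\<bar> \<le> B"
    unfolding bounded_iff ball_simps(9) real_norm_def by blast
  have B0: "B \<ge> 0" using B[of 0] y0 by auto
  have E_lip: "B-lipschitz_on {-y0..0} E"
  proof (rule lipschitz_onI[OF _ B0])
    fix r t assume "r \<in> {-y0..0}" "t \<in> {-y0..0}"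
    then show "dist (E r) (E t) \<le> B * dist r t"
      using field_differentiable_bound[of "{-y0..0}" E E' B r t] E B by (auto simp: dist_norm)
  qed
  have E_cont: "continuous_on {-y0..0} E" using E_lip by (rule lipschitz_on_continuous_on)
  obtain t where t: "t \<in> {-y0..0}" "\<And>y. y \<in> {-y0..0} \<Longrightarrow> E t \<le> E y"
    using continuous_attains_inf[of "{-y0..0}" E] E_cont y0 by auto
  define cl where "cl = clip (- y0) 0"
  have cl: "cl y \<in> {-y0..0}" for y
    using clip_bounds[of "- y0" 0 y] y0 by (auto simp: cl_def)
  have cl_id: "cl y = y" if "y \<in> {-y0..0}" for y
    using that by (auto simp: cl_def clip_id)
  \<comment> \<open>The coefficient frozen outside \<open>[-y0, 0]\<close>, times a ramp that equals
    1 for y <= 0 and 0 for y >= 1.\<close>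
  define a where "a = (\<lambda>y. - (E' (cl y)) * ((1/2) * (1 / E (cl y))) * clip 0 1 (1 + - y))"
  have 1: "bounded_lipschitz (\<lambda>y. E' (cl y))"
    unfolding cl_def using E'_lip y0 by (auto intro!: bounded_lipschitz_clip_compose)
  have 2: "bounded_lipschitz (\<lambda>y. 1 / E (cl y))"
    by (rule bounded_lipschitz_inverse[where e = "E t"])
      (use bounded_lipschitz_clip_compose[OF E_lip] y0 t E_pos cl in \<open>auto simp: cl_def\<close>)
  have "(0 + 1)-lipschitz_on UNIV (\<lambda>y :: real. 1 + - y)"
    by (intro lipschitz_on_add lipschitz_on_constant lipschitz_on_minus lipschitz_on_id)
  then have 3: "bounded_lipschitz (\<lambda>y. clip 0 1 (1 + - y))"
    by (rule bounded_lipschitz_compose[OF bounded_lipschitz_clip])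
  have bl: "bounded_lipschitz a"
    unfolding a_def by (intro bounded_lipschitz_mult bounded_lipschitz_minus bounded_lipschitz_const 1 2 3)
  then obtain Amax where Amax: "\<And>y. \<bar>a y\<bar> \<le> Amax" and lip: "\<exists>C. C-lipschitz_on UNIV a"
    unfolding bounded_lipschitz_def by blast
  have nn: "0 \<le> a y" for y
  proof -
    have "0 \<le> - (E' (cl y))" "0 < E (cl y)" using E'_nonpos[OF cl] E_pos[OF cl] by auto
    then show ?thesis
      unfolding a_def using clip_bounds(1)[of 0 1 "1 + - y"] by (intro mult_nonneg_nonneg) auto
  qed
  have zero: "a y = 0" if "1 \<le> y" for y
    using that by (simp add: a_def clip_def)
  have a_eq: "E' y = - 2 * a y * E y" if "y \<in> {-y0..0}" for y
    using E_pos[OF that] that by (simp add: a_def cl_id clip_def)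
  have "continuous_on UNIV a" using lip by (auto intro: lipschitz_on_continuous_on)
  then obtain G where G: "\<And>y. (G has_real_derivative a y) (at y)"
    using antiderivative_exists by blast
  define A where "A = (\<lambda>y. G y - G (- y0))"
  have A: "(A has_real_derivative a y) (at y)" for y
    unfolding A_def using G[of y] by (auto intro!: derivative_eq_intros)
  have mono: "A s \<le> A t" if "s \<le> t" for s t
    using DERIV_nonneg_imp_nondecreasing[OF that, of A] A nn by blast
  have A_le: "A y \<le> A 1" for y
  proof (cases "y \<le> 1")
    case False
    have "A y = A 1"
    proof (rule DERIV_isconst2[of 1 y])
      show "continuous_on {1..y} A"
        using A DERIV_isCont by (auto intro!: continuous_at_imp_continuous_on)
      show "(A has_real_derivative 0) (at s)" if "1 < s" "s < y" for s
        using A[of s] zero[of s] that by simp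
    qed (use False in auto)
    then show ?thesis by simp
  qed (rule mono)
  have E_eq: "E y = E (- y0) * exp (- 2 * A y)" if y: "y \<in> {-y0..0}" for y
  proof -
    \<comment> \<open>\<open>E\<close> solves the linear equation E' = -2 a E, and this product is
      its integrating-factor form.\<close>
    have "((\<lambda>y. E y * exp (2 * A y)) has_real_derivative 0) (at r within {-y0..0})" if "r \<in> {-y0..0}" for r
    proof -
      have "((\<lambda>y. E y * exp (2 * A y)) has_real_derivative E' r * exp (2 * A r) + (exp (2 * A r) * (2 * a r)) * E r) (at r within {-y0..0})"
        by (rule DERIV_mult[OF E[OF that]])
          (auto intro!: derivative_eq_intros DERIV_subset[OF A])
      then show ?thesis using a_eq[OF that] by (simp add: algebra_simps)
    qed
    then obtain k where "\<And>r. r \<in> {-y0..0} \<Longrightarrow> E r * exp (2 * A r) = k"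
      using has_field_derivative_zero_constant[of "{-y0..0}" "\<lambda>y. E y * exp (2 * A y)"] by auto
    then have "E y * exp (2 * A y) = E (- y0) * exp (2 * A (- y0))" using y y0 by auto
    then have "E y * exp (2 * A y) = E (- y0)" by (simp add: A_def)
    then have "E y * (exp (2 * A y) * exp (- 2 * A y)) = E (- y0) * exp (- 2 * A y)"
      by (simp add: mult.assoc[symmetric])
    then show ?thesis by (simp add: exp_add[symmetric])
  qed
  show thesis
  proof (rule that[OF lip nn _ A _ A_le a_eq E_eq])
    show "a y \<le> Amax" for y using Amax[of y] by linarith
    show "A (- y0) = 0" by (simp add: A_def)
  qed
qed

text \<open>With the product fixed, shrinking \<delta> enlarges \<open>W\<close>, so the box can
  absorb any bounded data kept away from zero. Taking \<delta> at most \<open>sqrt k\<close> ensures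
  \<delta> \<le> W.\<close>

lemma invariant_box_exists:
  fixes k d D :: real
  assumes "k > 0" "d > 0"
  obtains \<delta> W where "\<delta> > 0" "\<delta> \<le> W" "\<delta> * W = k" "\<delta> \<le> d" "D \<le> W"
proof -
  \<comment> \<open>Replaces a possibly nonpositive \<open>D\<close> by a positive number that may
    serve as denominator.\<close>
  define D' where "D' = max D 1"
  define \<delta> where "\<delta> = min d (min (sqrt k) (k / D'))"
  have D': "D' > 0" "D \<le> D'" by (auto simp: D'_def)
  have \<delta>: "\<delta> > 0" "\<delta> \<le> d" "\<delta> \<le> sqrt k" "\<delta> \<le> k / D'"
    using assms D' by (auto simp: \<delta>_def)
  have "\<delta> * \<delta> \<le> sqrt k * sqrt k" using \<delta> assms by (intro mult_mono) auto
  then have "\<delta> \<le> k / \<delta>" using \<delta> assms by (simp add: field_simps)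
  moreover have "D \<le> k / \<delta>"
  proof -
    have "\<delta> * D' \<le> k" using \<delta>(4) D' by (simp add: field_simps)
    then have "D' \<le> k / \<delta>" using \<delta>(1) by (simp add: field_simps)
    then show ?thesis using D' by linarith
  qed
  ultimately show thesis
    using that[of \<delta> "k / \<delta>"] \<delta> by simp
qed

section \<open>Test functions and integrals over the strip\<close>

text \<open>The complement of the closed support is open and \<phi> vanishes on it, so the partial
  derivatives vanish there too, in particular for y >= 0.\<close>

lemma test_functionE:
  assumes "test_function \<phi>"
  obtains \<phi>x \<phi>y \<rho> where "C1_test \<phi> \<phi>x \<phi>y \<rho>" "\<And>P. dx \<phi> P = \<phi>x P" "\<And>P. dy \<phi> P = \<phi>y P"
    "\<And>P. snd P \<ge> 0 \<Longrightarrow> \<phi> P = 0 \<and> \<phi>x P = 0 \<and> \<phi>y P = 0"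
proof -
  let ?K = "closure {P. \<phi> P \<noteq> 0}"
  have "C_class (Suc 0) \<phi>" using assms unfolding test_function_def by blast
  then obtain \<phi>x \<phi>y where d: "\<And>P. (\<phi> has_derivative (\<lambda>h. \<phi>x P * fst h + \<phi>y P * snd h)) (at P)"
    and c: "continuous_on UNIV \<phi>x" "continuous_on UNIV \<phi>y"
    by auto
  have K: "compact ?K" "?K \<subseteq> UNIV \<times> {..<0}"
    using assms unfolding test_function_def by auto
  have zero: "\<phi> P = 0 \<and> \<phi>x P = 0 \<and> \<phi>y P = 0" if P: "P \<notin> ?K" for P
  proof -
    have z: "\<phi> Q = 0" if "Q \<in> - ?K" for Q using that closure_subset[of "{P. \<phi> P \<noteq> 0}"] by blast
    have "((\<lambda>Q. 0) has_derivative (\<lambda>h. \<phi>x P * fst h + \<phi>y P * snd h)) (at P)"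
    proof (rule has_derivative_transform_within_open[OF d])
      show "open (- ?K)" by (rule open_Compl) (rule closed_closure)
      show "P \<in> - ?K" using P by blast
    qed (rule z)
    then have "(\<lambda>h. \<phi>x P * fst h + \<phi>y P * snd h) = (\<lambda>h :: real \<times> real. 0)"
      by (rule has_derivative_unique) simp
    from fun_cong[OF this, of "(1, 0)"] fun_cong[OF this, of "(0, 1)"] have "\<phi>x P = 0" "\<phi>y P = 0"
      by simp_all
    then show ?thesis
      using z[of P] P by blast
  qed
  obtain \<rho> where \<rho>: "\<And>P. P \<in> ?K \<Longrightarrow> norm P \<le> \<rho>"
    using compact_imp_bounded[OF K(1)] unfolding bounded_iff by blast
  have "C1_test \<phi> \<phi>x \<phi>y \<rho>"
    unfolding C1_test_def
  proof (intro conjI allI d c impI)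
    fix X Y assume XY: "\<rho> < \<bar>X\<bar> \<or> \<rho> < Y"
    have "(X, Y) \<notin> ?K"
    proof
      assume "(X, Y) \<in> ?K"
      then have "norm (X, Y) \<le> \<rho>" by (rule \<rho>)
      moreover have "\<bar>X\<bar> \<le> norm (X, Y)" "\<bar>Y\<bar> \<le> norm (X, Y)"
        using norm_fst_le[of X Y] norm_snd_le[of Y X] by simp_all
      ultimately show False using XY by arith
    qed
    from zero[OF this] show "\<phi> (X, Y) = 0" "\<phi>x (X, Y) = 0" "\<phi>y (X, Y) = 0" by blast+
  qed
  moreover have "dx \<phi> P = \<phi>x P" for P
  proof -
    have "((\<lambda>s. (s, snd P)) has_derivative (\<lambda>h. (h, 0))) (at (fst P))"
      by (auto intro!: derivative_eq_intros)
    then have "((\<lambda>s. \<phi> (s, snd P)) has_derivative (\<lambda>h. \<phi>x P * h)) (at (fst P))"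
      using has_derivative_compose[OF _ d, of "\<lambda>s. (s, snd P)" "\<lambda>h. (h, 0)" "fst P" UNIV] by simp
    then show ?thesis
      unfolding dx_def by (intro DERIV_imp_deriv) (simp add: has_field_derivative_def)
  qed
  moreover have "dy \<phi> P = \<phi>y P" for P
  proof -
    have "((\<lambda>s. (fst P, s)) has_derivative (\<lambda>h. (0, h))) (at (snd P))"
      by (auto intro!: derivative_eq_intros)
    then have "((\<lambda>s. \<phi> (fst P, s)) has_derivative (\<lambda>h. \<phi>y P * h)) (at (snd P))"
      using has_derivative_compose[OF _ d, of "\<lambda>s. (fst P, s)" "\<lambda>h. (0, h)" "snd P" UNIV] by simp
    then show ?thesis
      unfolding dy_def by (intro DERIV_imp_deriv) (simp add: has_field_derivative_def)
  qed
  moreover have "\<phi> P = 0 \<and> \<phi>x P = 0 \<and> \<phi>y P = 0" if "snd P \<ge> 0" for P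
  proof -
    have "P \<notin> ?K" using K(2) that by force
    then show ?thesis by (rule zero)
  qed
  ultimately show thesis by (rule that)
qed

lemma strip_sets: "strip y0 \<in> sets borel"
  unfolding strip_def by (intro borel_closed closed_Times) auto

text \<open>Passes from Lebesgue measure on the strip to Borel integrals over y >= -y0, where the
  change of variables applies; an integrand vanishing for y >= 0 does not see the enlarged
  domain.\<close>

lemma strip_integral:
  fixes F F' :: "real \<times> real \<Rightarrow> real"
  assumes m: "F' \<in> borel_measurable borel" and eq: "\<And>P. P \<in> strip y0 \<Longrightarrow> F P = F' P"
    and zero: "\<And>P. snd P \<ge> 0 \<Longrightarrow> F' P = 0"
  shows "(LINT P|lebesgue_on (strip y0). F P) = (LBINT P:{P. - y0 \<le> snd P}. F' P)"
proof -
  have [measurable]: "strip y0 \<in> sets borel" by (rule strip_sets)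
  have "(LINT P|lebesgue_on (strip y0). F P) = (LINT P|lebesgue_on (strip y0). F' P)"
    by (rule Bochner_Integration.integral_cong) (simp_all add: eq)
  also have "\<dots> = (LINT P|lebesgue. indicator (strip y0) P *\<^sub>R F' P)"
    by (rule integral_restrict_space) simp
  also have "\<dots> = (LINT P|lborel. indicator (strip y0) P *\<^sub>R F' P)"
    by (rule integral_completion) (use m in measurable)
  also have "\<dots> = (LBINT P:{P. - y0 \<le> snd P}. F' P)"
    unfolding set_lebesgue_integral_def
    by (intro Bochner_Integration.integral_cong refl)
      (use zero in \<open>auto simp: strip_def indicator_def mem_Times_iff\<close>)
  finally show ?thesis .
qed

lemma L_infinityI:
  fixes f :: "real \<times> real \<Rightarrow> real"
  assumes "f \<in> borel_measurable borel" "\<And>P. \<bar>f P\<bar> \<le> B"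
  shows "L_infinity (strip y0) f"
  unfolding L_infinity_def
proof
  have "f \<in> borel_measurable lebesgue" using assms(1) by (intro measurable_completion) simp
  then show "f \<in> borel_measurable (lebesgue_on (strip y0))" by (rule measurable_restrict_space1)
  show "\<exists>B. AE P in lebesgue_on (strip y0). \<bar>f P\<bar> \<le> B"
    by (intro exI[of _ B] AE_I2 assms(2))
qed

theorem theorem5p1:
  fixes y0 c k0 \<beta> :: real
    and E E' K \<gamma> u0 v0 :: "real \<Rightarrow> real"
  assumes "y0 > 0" and "c > 0" and "k0 > 0" and "\<beta> \<ge> sqrt 2"
    and "\<And>y. y \<in> {-y0..0} \<Longrightarrow> (E has_real_derivative E' y) (at y within {-y0..0})"
    and "\<exists>C. C-lipschitz_on {-y0..0} E'"
    and "\<And>y. y \<in> {-y0..0} \<Longrightarrow> E y > 0"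
    and "\<And>y. y \<in> {-y0..<0} \<Longrightarrow> E' y < 0"
    and "\<And>y. y \<in> {-y0..0} \<Longrightarrow> K y = - k0 * E y powr (- (\<beta>\<^sup>2))"
    and "AE y in lebesgue. y \<in> {-y0<..<0} \<longrightarrow> has_gauss_curvature c E E' (K y) y"
    and "\<And>y. y \<in> {-y0..0} \<Longrightarrow> \<gamma> y > 0 \<and> K y = - (\<gamma> y)\<^sup>2"
    and "u0 \<in> borel_measurable lebesgue" and "v0 \<in> borel_measurable lebesgue"
    and "bounded (range (\<lambda>x. u0 x + v0 x))" and "bounded (range (\<lambda>x. u0 x - v0 x))"
    and "(INF x. u0 x + v0 x) > 0" and "(SUP x. u0 x - v0 x) < 0"
  shows "\<exists>L M N. gauss_codazzi_weak_solution y0 c E E' K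
            (\<lambda>x. \<gamma> (- y0) / v0 x) (\<lambda>x. - \<gamma> (- y0) * u0 x / v0 x) L M N"
proof -
  define \<kappa> where "\<kappa> = \<beta>\<^sup>2 - 2"
  have "(sqrt 2)\<^sup>2 \<le> \<beta>\<^sup>2" using assms(4) by (intro power_mono) auto
  then have \<kappa>: "\<kappa> \<ge> 0" "2 + \<kappa> = \<beta>\<^sup>2" by (simp_all add: \<kappa>_def)
  obtain a A Amax Imax where a: "\<exists>C. C-lipschitz_on UNIV a" "\<And>y. 0 \<le> a y" "\<And>y. a y \<le> Amax"
    and A: "\<And>y. (A has_real_derivative a y) (at y)" "A (- y0) = 0" "\<And>y. A y \<le> Imax"
    and E'_eq: "\<And>y. y \<in> {-y0..0} \<Longrightarrow> E' y = - 2 * a y * E y"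
    and E_eq: "\<And>y. y \<in> {-y0..0} \<Longrightarrow> E y = E (- y0) * exp (- 2 * A y)"
    using extended_coefficient[OF assms(1,5,6,7,8)] by metis
  obtain D1 D2 where D: "\<And>x. \<bar>u0 x + v0 x\<bar> \<le> D1" "\<And>x. \<bar>u0 x - v0 x\<bar> \<le> D2"
    using assms(14,15) unfolding bounded_iff ball_simps(9) real_norm_def by blast
  define d where "d = min (INF x. u0 x + v0 x) (- (SUP x. u0 x - v0 x))"
  have d: "d > 0" using assms(16,17) by (simp add: d_def)
  have lower: "d \<le> u0 x + v0 x" "u0 x - v0 x \<le> - d" for x
    using cINF_lower[OF bounded_imp_bdd_below[OF assms(14)], of x] cSUP_upper[OF _ bounded_imp_bdd_above[OF assms(15)], of x]
    by (auto simp: d_def)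
  have "c * (1 + \<kappa>) > 0" using assms(2) \<kappa>(1) by simp
  then obtain \<delta> W where box: "\<delta> > 0" "\<delta> \<le> W" "\<delta> * W = c * (1 + \<kappa>)" "\<delta> \<le> d" "max D1 D2 \<le> W"
    using invariant_box_exists[OF _ d] by metis
  \<comment> \<open>The Picard scheme needs Borel data, while the given data are only Lebesgue
    measurable; Borel representatives differ from them on a null set.\<close>
  obtain u' v' where [measurable]: "u' \<in> borel_measurable lborel" "v' \<in> borel_measurable lborel"
    and AE_uv: "AE x in lborel. u0 x = u' x" "AE x in lborel. v0 x = v' x"
    using completion_ex_borel_measurable_real[OF assms(12)] completion_ex_borel_measurable_real[OF assms(13)] by blast
  \<comment> \<open>On the exceptional null set the representatives may leave the box. Clipping
    enforces the bounds at every point, as the locale demands, and changes nothing almost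
    everywhere.\<close>
  define w0 where "w0 = (\<lambda>x. clip \<delta> W (u' x + v' x))"
  define z0 where "z0 = (\<lambda>x. clip (- W) (- \<delta>) (u' x - v' x))"
  have wz_m[measurable]: "w0 \<in> borel_measurable borel" "z0 \<in> borel_measurable borel"
  proof -
    have "w0 \<in> borel_measurable lborel" "z0 \<in> borel_measurable lborel"
      unfolding w0_def z0_def clip_def by measurable
    then show "w0 \<in> borel_measurable borel" "z0 \<in> borel_measurable borel" by simp_all
  qed
  have AE_wz: "AE x in lebesgue. w0 x = u0 x + v0 x \<and> z0 x = u0 x - v0 x"
  proof (rule AE_completion)
    show "AE x in lborel. w0 x = u0 x + v0 x \<and> z0 x = u0 x - v0 x"
      using AE_uv
    proof eventually_elim
      case (elim x)
      have "\<delta> \<le> u0 x + v0 x" "u0 x + v0 x \<le> W" "- W \<le> u0 x - v0 x" "u0 x - v0 x \<le> - \<delta>"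
        using D(1)[of x] D(2)[of x] lower[of x] box(4,5) by auto
      then show ?case
        unfolding w0_def z0_def elim by (simp add: clip_id elim[symmetric])
    qed
  qed
  interpret data: characteristic_data y0 c \<kappa> \<delta> W Amax Imax a A w0 z0
  proof
    show "\<delta> \<le> w0 s" "w0 s \<le> W" "- W \<le> z0 s" "z0 s \<le> - \<delta>" for s
      unfolding w0_def z0_def using box(2) by (auto intro!: clip_bounds)
  qed (use assms(2) \<kappa>(1) box a A wz_m in auto)
  obtain w z p q x y m M where "characteristic_solution y0 c \<kappa> \<delta> W Amax Imax a A w0 z0 w z p q x y m M"
    using data.characteristic_solution_exists by blast
  then interpret S: characteristic_solution y0 c \<kappa> \<delta> W Amax Imax a A w0 z0 w z p q x y m M .
  define g0 where "g0 = \<gamma> (- y0)"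
  \<comment> \<open>The curvature law is a power of \<open>E\<close>, and \<open>E\<close> is
    \<open>E (- y0)\<close> times \<open>exp (- 2 * A Y)\<close>; since the exponent
    \<open>\<beta>\<^sup>2\<close> is 2 + \<kappa>, the square root of -K is the exponential
    defining \<open>gamma_ext\<close>.\<close>
  have K_eq: "K Y = - (S.gamma_ext g0 Y)\<^sup>2" if Y: "Y \<in> {-y0..0}" for Y
  proof -
    have y0': "- y0 \<in> {-y0..0}" using assms(1) by simp
    have "g0\<^sup>2 = k0 * E (- y0) powr (- (\<beta>\<^sup>2))"
      unfolding g0_def using assms(9)[OF y0'] assms(11)[OF y0'] by simp
    moreover have "E Y powr (- (\<beta>\<^sup>2)) = E (- y0) powr (- (\<beta>\<^sup>2)) * exp (2 * (\<beta>\<^sup>2 * A Y))"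
    proof -
      have "E Y powr (- (\<beta>\<^sup>2)) = E (- y0) powr (- (\<beta>\<^sup>2)) * exp (- 2 * A Y) powr (- (\<beta>\<^sup>2))"
        using E_eq[OF Y] assms(7)[OF y0'] by (metis exp_ge_zero less_imp_le powr_mult)
      also have "exp (- 2 * A Y) powr (- (\<beta>\<^sup>2)) = exp (2 * (\<beta>\<^sup>2 * A Y))"
        by (simp add: powr_def)
      finally show ?thesis .
    qed
    ultimately show ?thesis
      using assms(9)[OF Y] unfolding S.gamma_ext_def \<kappa>(2) power_mult_distrib by (simp add: exp_double[symmetric] mult.assoc)
  qed
  have initial: "(LINT s|lebesgue. F (u0 s) (v0 s) * \<phi> (s, - y0)) = (LINT s|lborel. G s * \<phi> (s, - y0))"
    if "continuous_on UNIV \<phi>" "(\<lambda>s. F (u0 s) (v0 s)) \<in> borel_measurable lebesgue" "G \<in> borel_measurable borel"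
      "\<And>s. w0 s = u0 s + v0 s \<Longrightarrow> z0 s = u0 s - v0 s \<Longrightarrow> G s = F (u0 s) (v0 s)"
    for F :: "real \<Rightarrow> real \<Rightarrow> real" and G and \<phi> :: "real \<times> real \<Rightarrow> real"
  proof -
    have \<phi>m[measurable]: "(\<lambda>s. \<phi> (s, - y0)) \<in> borel_measurable borel"
      by (intro borel_measurable_continuous_onI continuous_on_compose2[OF that(1)] continuous_intros) auto
    note [measurable] = that(3)
    have \<phi>m': "(\<lambda>s. \<phi> (s, - y0)) \<in> borel_measurable lebesgue"
      by (intro measurable_completion) simp
    have "(LINT s|lebesgue. F (u0 s) (v0 s) * \<phi> (s, - y0)) = (LINT s|lebesgue. G s * \<phi> (s, - y0))"
    proof (rule integral_cong_AE)
      show "(\<lambda>s. F (u0 s) (v0 s) * \<phi> (s, - y0)) \<in> borel_measurable lebesgue"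
        by (intro borel_measurable_times that(2) \<phi>m')
      show "(\<lambda>s. G s * \<phi> (s, - y0)) \<in> borel_measurable lebesgue"
        by (intro measurable_completion) simp
      show "AE s in lebesgue. F (u0 s) (v0 s) * \<phi> (s, - y0) = G s * \<phi> (s, - y0)"
        using AE_wz by eventually_elim (use that(4) in simp)
    qed
    also have "\<dots> = (LINT s|lborel. G s * \<phi> (s, - y0))"
      by (rule integral_completion) simp
    finally show ?thesis .
  qed
  note [measurable] = S.LMN_measurable borel_measurable_continuous_onI[OF data.a_continuous]
  have "gauss_codazzi_weak_solution y0 c E E' K (\<lambda>x. \<gamma> (- y0) / v0 x) (\<lambda>x. - \<gamma> (- y0) * u0 x / v0 x)
    (S.sol_L g0) (S.sol_M g0) (S.sol_N g0)"
    unfolding gauss_codazzi_weak_solution_def g0_def[symmetric]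
  proof (intro conjI allI impI)
    obtain B where "\<And>P. \<bar>S.sol_L g0 P\<bar> \<le> B \<and> \<bar>S.sol_M g0 P\<bar> \<le> B \<and> \<bar>S.sol_N g0 P\<bar> \<le> B"
      using S.LMN_bounded by blast
    then show "L_infinity (strip y0) (S.sol_L g0)" "L_infinity (strip y0) (S.sol_M g0)" "L_infinity (strip y0) (S.sol_N g0)"
      by (intro L_infinityI[where B = B] S.LMN_measurable; blast)+
    show "AE P in lebesgue_on (strip y0). S.sol_L g0 P * S.sol_N g0 P - (S.sol_M g0 P)\<^sup>2 = K (snd P)"
      unfolding S.gauss_equation
      by (rule AE_I2) (use K_eq in \<open>auto simp: strip_def\<close>)
  next
    fix \<phi> assume "test_function \<phi>"
    then obtain \<phi>x \<phi>y \<rho> where \<phi>: "C1_test \<phi> \<phi>x \<phi>y \<rho>" "\<And>P. dx \<phi> P = \<phi>x P" "\<And>P. dy \<phi> P = \<phi>y P"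
      and zero: "\<And>P. snd P \<ge> 0 \<Longrightarrow> \<phi> P = 0 \<and> \<phi>x P = 0 \<and> \<phi>y P = 0"
      using test_functionE by blast
    have c\<phi>: "continuous_on UNIV \<phi>" "continuous_on UNIV \<phi>x" "continuous_on UNIV \<phi>y"
      using \<phi>(1) unfolding C1_test_def by (auto intro!: continuous_at_imp_continuous_on has_derivative_continuous)
    note [measurable] = c\<phi>[THEN borel_measurable_continuous_onI]
    \<comment> \<open>All nonvanishing symbols are multiples of the coefficient \<open>a\<close>,
      which coincides with -E' / (2 E) on the strip.\<close>
    have christoffel: "\<Gamma>222 c E E' (snd P) = - a (snd P)" "\<Gamma>112 c E E' (snd P) = - a (snd P)" "\<Gamma>211 c E E' (snd P) = a (snd P) / c"
      if "P \<in> strip y0" for P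
    proof -
      have P: "snd P \<in> {-y0..0}" using that by (auto simp: strip_def)
      show "\<Gamma>222 c E E' (snd P) = - a (snd P)" "\<Gamma>112 c E E' (snd P) = - a (snd P)" "\<Gamma>211 c E E' (snd P) = a (snd P) / c"
        unfolding \<Gamma>222_def \<Gamma>112_def \<Gamma>211_def E'_eq[OF P] using assms(7)[OF P] assms(2) by simp_all
    qed
    have wz: "w0 s - z0 s \<noteq> 0" for s
      using data.w0(1)[of s] data.z0(2)[of s] box(1) by linarith
    have e1: "(LINT P|lebesgue_on (strip y0). - S.sol_M g0 P * dx \<phi> P + S.sol_L g0 P * dy \<phi> P)
        = (LBINT P:{P. - y0 \<le> snd P}. - S.sol_M g0 P * \<phi>x P + S.sol_L g0 P * \<phi>y P)" (is "?l1 = _")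
      by (rule strip_integral) (measurable, simp_all add: \<phi> zero)
    have e2: "(LINT s|lebesgue. g0 / v0 s * \<phi> (s, - y0)) = (LINT s|lborel. 2 * g0 / (w0 s - z0 s) * \<phi> (s, - y0))" (is "?i1 = _")
    proof (rule initial[where F = "\<lambda>u v. g0 / v", OF c\<phi>(1)])
      show "(\<lambda>s. g0 / v0 s) \<in> borel_measurable lebesgue" using assms(13) by measurable
      show "(\<lambda>s. 2 * g0 / (w0 s - z0 s)) \<in> borel_measurable borel" by measurable
      fix s assume "w0 s = u0 s + v0 s" "z0 s = u0 s - v0 s"
      then have "w0 s - z0 s = 2 * v0 s" by simp
      then show "2 * g0 / (w0 s - z0 s) = g0 / v0 s" by simp
    qed
    have e3: "(LINT P|lebesgue_on (strip y0). (\<Gamma>222 c E E' (snd P) * S.sol_L g0 P - 2 * \<Gamma>212 c E E' (snd P) * S.sol_M g0 P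
            + \<Gamma>211 c E E' (snd P) * S.sol_N g0 P) * \<phi> P)
        = (LBINT P:{P. - y0 \<le> snd P}. (- a (snd P) * S.sol_L g0 P + a (snd P) / c * S.sol_N g0 P) * \<phi> P)" (is "?r1 = _")
      by (rule strip_integral) (measurable, simp_all add: christoffel \<Gamma>212_def zero)
    show "?l1 + ?i1 = ?r1" unfolding e1 e2 e3 by (rule S.first_equation[OF \<phi>(1)])
    have e4: "(LINT P|lebesgue_on (strip y0). - S.sol_N g0 P * dx \<phi> P + S.sol_M g0 P * dy \<phi> P)
        = (LBINT P:{P. - y0 \<le> snd P}. - S.sol_N g0 P * \<phi>x P + S.sol_M g0 P * \<phi>y P)" (is "?l2 = _")
      by (rule strip_integral) (measurable, simp_all add: \<phi> zero)
    have e5: "(LINT s|lebesgue. - g0 * u0 s / v0 s * \<phi> (s, - y0)) = (LINT s|lborel. - g0 * (w0 s + z0 s) / (w0 s - z0 s) * \<phi> (s, - y0))" (is "?i2 = _")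
    proof (rule initial[where F = "\<lambda>u v. - g0 * u / v", OF c\<phi>(1)])
      show "(\<lambda>s. - g0 * u0 s / v0 s) \<in> borel_measurable lebesgue" using assms(12,13) by measurable
      show "(\<lambda>s. - g0 * (w0 s + z0 s) / (w0 s - z0 s)) \<in> borel_measurable borel" by measurable
      fix s assume "w0 s = u0 s + v0 s" "z0 s = u0 s - v0 s"
      then have "w0 s + z0 s = 2 * u0 s" "w0 s - z0 s = 2 * v0 s" by simp_all
      then show "- g0 * (w0 s + z0 s) / (w0 s - z0 s) = - g0 * u0 s / v0 s"
        using wz[of s] by simp
    qed
    have e6: "(LINT P|lebesgue_on (strip y0). (- \<Gamma>122 c E E' (snd P) * S.sol_L g0 P + 2 * \<Gamma>112 c E E' (snd P) * S.sol_M g0 P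
            - \<Gamma>111 c E E' (snd P) * S.sol_N g0 P) * \<phi> P)
        = (LBINT P:{P. - y0 \<le> snd P}. (2 * - a (snd P) * S.sol_M g0 P) * \<phi> P)" (is "?r2 = _")
      by (rule strip_integral) (measurable, simp_all add: christoffel \<Gamma>122_def \<Gamma>111_def zero)
    show "?l2 + ?i2 = ?r2" unfolding e4 e5 e6 by (rule S.second_equation[OF \<phi>(1)])
  qed
  then show ?thesis by blast
qed

end
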